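(* Let $0<r<1/2$ and $s=\frac{r}{2-4r}$. The balls $U=\mathbb B^s_{2\infty}(P_0)$, $P_0>0$, in the Besov space $\mathbb B^s_{2\infty}$ are completely perfect maxisets for the kernel-based test statistics $T_n(Y_n)$ with $h_n\asymp n^{4r-2}$; that is, for $0<\alpha<1$ and a sequence of tests $K_n$ generated by $T_n$ with $\alpha(K_n)=\alpha(1+o(1))$: for any $\epsilon>0$ and any constants $0<c<C$ there are $\gamma_\epsilon$ and $n_\epsilon$ such that, if a sequence of alternatives $f_n\in\mathbb L_2^{per}(\mathbb R^1)$ with $cn^{-r}\le\|f_n\|\le Cn^{-r}$ is consistent, then for all $n>n_\epsilon$ and all $\gamma>\gamma_\epsilon$ $$|\beta(K_n,f_n)-\beta(K_n,f_{n\gamma})|\le\epsilon\quad\text{and}\quad \beta(K_n,f_n-f_{n\gamma})\ge1-\alpha-\epsilon .$$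
   Context: Model: one observes $dY_n(t)=f(t)dt+\frac{\sigma}{\sqrt n}dw(t)$, $t\in[0,1]$, $\sigma>0$, $dw$ Gaussian white noise, where the unknown signal $f$ belongs to $\mathbb L_2^{per}(\mathbb R^1)$, the set of (real) 1-periodic functions whose restriction to $[0,1)$ is in $\mathbb L_2(0,1)$; $\|\cdot\|$ is the $\mathbb L_2(0,1)$ norm. Signal and noise are extended 1-periodically to the real line. The hypothesis is $H_0:f=0$. $\alpha(K_n)$, $\beta(K_n,f)$ are the type I error probability and the type II error probability at $f$ of a test $K_n$. A test is generated by $T_n$ if it rejects $H_0$ when $T_n$ exceeds a threshold. $a_n\asymp b_n$ means $ca_n\le b_n\le Ca_n$ for all $n$ with constants $0<c\le C$. Kernel-based statistics: $\hat f_{h_n}(t)=\frac1{h_n}\int_{-\infty}^\infty K\bigl(\frac{t-u}{h_n}\bigr)dY_n(u)$, $t\in(0,1)$ (with the periodic extension of $Y_n$), where $h_n>0$, $h_n\to0$, and $K$ is a bounded function supported in $[-1,1]$ with $K(t)=K(-t)$ and $\int K=1$. Then $T_n(Y_n)=nh_n^{1/2}\sigma^{-2}\kappa^{-1}\bigl(\|\hat f_{h_n}\|^2-\sigma^2(nh_n)^{-1}\|K\|^2\bigr)$, with $\kappa^2=2\int\bigl(\int K(t-s)K(s)ds\bigr)^2dt$ and $\|K\|^2=\int K^2$. Consistency: a sequence $f_n$ is consistent if for some choice of bandwidths $h_n\asymp n^{4r-2}$ there is a sequence of tests generated by the corresponding $T_n$ with $\limsup_{n\to\infty}(\alpha(K_n)+\beta(K_n,f_n))<1$.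 Balls: with $\phi_j(t)=\exp\{2\pi ijt\}$, $\mathbb B^s_{2\infty}(P_0)=\{f=\sum_{j\in\mathbb Z}\theta_j\phi_j:\ \sup_{\lambda>0}\lambda^{2s}\sum_{|j|>\lambda}|\theta_j|^2\le P_0\}$ (real-valued $f$), and $\gamma U=\{\gamma g:g\in U\}$. For $\gamma>0$, $f_{n\gamma}\in\gamma U$ is the point of $\gamma U$ nearest to $f_n$: $\|f_{n\gamma}-f_n\|=\inf\{\|g-f_n\|:g\in\gamma U\}$. *)

theory Defs
  imports "HOL-Probability.Probability"
begin

definition unit_L2 :: "(real \<Rightarrow> real) set" where
  "unit_L2 = {g \<in> borel_measurable borel. set_integrable lborel {0..<1} (\<lambda>u. (g u)\<^sup>2)}"

definition L2_per :: "(real \<Rightarrow> real) set" where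
  "L2_per = {f \<in> unit_L2. \<forall>t. f (t + 1) = f t}"

definition L2_norm1 :: "(real \<Rightarrow> real) \<Rightarrow> real" where
  "L2_norm1 f = sqrt (LBINT t:{0..<1}. (f t)\<^sup>2)"

text \<open>Gaussian white noise on the unit interval as an isonormal process: \<open>W g\<close> stands for the
  stochastic integral of \<open>g\<close> over the unit interval. Every linear combination of the \<open>W g\<close> is almost
  surely of the form \<open>W g'\<close>, so linearity and the one-dimensional laws already give joint
  Gaussianity, and by polarization the covariance of \<open>W g\<close> and \<open>W h\<close> is the \<open>L\<^sub>2\<close> inner product.
  The case of norm zero is separate because \<open>normal_density\<close> needs a positive deviation.\<close>

definition white_noise :: "'a measure \<Rightarrow> ((real \<Rightarrow> real) \<Rightarrow> 'a \<Rightarrow> real) \<Rightarrow> bool" where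
  "white_noise M W \<longleftrightarrow>
     prob_space M \<and>
     (\<forall>g\<in>unit_L2. W g \<in> borel_measurable M \<and>
        (if L2_norm1 g = 0 then (AE \<omega> in M. W g \<omega> = 0)
         else distributed M lborel (W g) (normal_density 0 (L2_norm1 g)))) \<and>
     (\<forall>g\<in>unit_L2. \<forall>h\<in>unit_L2. \<forall>a b.
        AE \<omega> in M. W (\<lambda>u. a * g u + b * h u) \<omega> = a * W g \<omega> + b * W h \<omega>)"

text \<open>The observation \<open>dY\<^sub>n = f dt + (\<sigma> / sqrt n) dw\<close>, given by its integrals against \<open>g\<close> over the unit
  interval.\<close>

definition observation ::
  "((real \<Rightarrow> real) \<Rightarrow> 'a \<Rightarrow> real) \<Rightarrow> real \<Rightarrow> nat \<Rightarrow> (real \<Rightarrow> real) \<Rightarrow> (real \<Rightarrow> real) \<Rightarrow> 'a \<Rightarrow> real"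
  where
  "observation W \<sigma> n f g \<omega> = (LBINT u:{0..<1}. g u * f u) + \<sigma> / sqrt (real n) * W g \<omega>"

text \<open>Integrating \<open>g\<close> over the real line against the 1-periodic extension of \<open>Y\<close> is integrating
  \<open>periodize g\<close> over the unit interval against \<open>Y\<close>. The sum is finite for \<open>g\<close> of bounded support.\<close>

definition periodize :: "(real \<Rightarrow> real) \<Rightarrow> real \<Rightarrow> real" where
  "periodize g u = (\<Sum>\<^sub>\<infinity>k\<in>(UNIV :: int set). g (u + of_int k))"

definition smoothing_kernel :: "(real \<Rightarrow> real) \<Rightarrow> bool" where
  "smoothing_kernel K \<longleftrightarrow>
     K \<in> borel_measurable borel \<and> (\<exists>B. \<forall>t. \<bar>K t\<bar> \<le> B) \<and> (\<forall>t. t \<notin> {-1..1} \<longrightarrow> K t = 0) \<and>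
     (\<forall>t. K t = K (- t)) \<and> (LBINT t. K t) = 1"

text \<open>A stochastic integral is determined only up to a null set for each \<open>t\<close>, so the kernel
  estimator is taken to be a jointly measurable version; such a version exists since
  \<open>t \<mapsto> K ((t - \<cdot>) / h)\<close> is continuous into \<open>L\<^sub>2\<close>. By Fubini, two versions agree almost surely
  for almost every \<open>t\<close>, so the norm used below does not depend on the choice (almost surely).\<close>

definition kernel_estimator ::
  "'a measure \<Rightarrow> (real \<Rightarrow> real) \<Rightarrow> real \<Rightarrow> ((real \<Rightarrow> real) \<Rightarrow> 'a \<Rightarrow> real) \<Rightarrow> real \<Rightarrow> 'a \<Rightarrow> real" where
  "kernel_estimator M K h Y =
     (SOME F. (\<lambda>(t, \<omega>). F t \<omega>) \<in> borel_measurable (lborel \<Otimes>\<^sub>M M) \<and>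
        (\<forall>t\<in>{0<..<1}. AE \<omega> in M.
           F t \<omega> = 1 / h * Y (periodize (\<lambda>u. K ((t - u) / h))) \<omega>))"

definition kernel_kappa :: "(real \<Rightarrow> real) \<Rightarrow> real" where
  "kernel_kappa K = sqrt (2 * (LBINT t. (LBINT s. K (t - s) * K s)\<^sup>2))"

definition kernel_stat ::
  "'a measure \<Rightarrow> (real \<Rightarrow> real) \<Rightarrow> real \<Rightarrow> nat \<Rightarrow> real \<Rightarrow> ((real \<Rightarrow> real) \<Rightarrow> 'a \<Rightarrow> real) \<Rightarrow> 'a \<Rightarrow> real"
  where
  "kernel_stat M K \<sigma> n h Y \<omega> =
     real n * sqrt h / (\<sigma>\<^sup>2 * kernel_kappa K) *
       ((L2_norm1 (\<lambda>t. kernel_estimator M K h Y t \<omega>))\<^sup>2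
        - \<sigma>\<^sup>2 / (real n * h) * (LBINT t. (K t)\<^sup>2))"

text \<open>A test generated by the statistic is given by its threshold \<open>x\<close>: it rejects when the
  statistic exceeds \<open>x\<close>.\<close>

definition type1_error ::
  "'a measure \<Rightarrow> ((real \<Rightarrow> real) \<Rightarrow> 'a \<Rightarrow> real) \<Rightarrow> (real \<Rightarrow> real) \<Rightarrow> real \<Rightarrow> nat \<Rightarrow> real \<Rightarrow> real \<Rightarrow> real"
  where
  "type1_error M W K \<sigma> n h x =
     measure M {\<omega> \<in> space M. kernel_stat M K \<sigma> n h (observation W \<sigma> n (\<lambda>t. 0)) \<omega> > x}"

definition type2_error ::
  "'a measure \<Rightarrow> ((real \<Rightarrow> real) \<Rightarrow> 'a \<Rightarrow> real) \<Rightarrow> (real \<Rightarrow> real) \<Rightarrow> real \<Rightarrow> nat \<Rightarrow> real \<Rightarrow> real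
     \<Rightarrow> (real \<Rightarrow> real) \<Rightarrow> real"
  where
  "type2_error M W K \<sigma> n h x f =
     measure M {\<omega> \<in> space M. kernel_stat M K \<sigma> n h (observation W \<sigma> n f) \<omega> \<le> x}"

text \<open>Sequences are indexed by \<open>n \<ge> 1\<close>; the value at \<open>0\<close> is irrelevant.\<close>

definition same_order :: "(nat \<Rightarrow> real) \<Rightarrow> (nat \<Rightarrow> real) \<Rightarrow> bool" where
  "same_order a b \<longleftrightarrow> (\<exists>c C. 0 < c \<and> c \<le> C \<and> (\<forall>n\<ge>1. c * a n \<le> b n \<and> b n \<le> C * a n))"

definition bandwidths :: "real \<Rightarrow> (nat \<Rightarrow> real) \<Rightarrow> bool" where
  "bandwidths r h \<longleftrightarrow> (\<forall>n\<ge>1. 0 < h n) \<and> same_order h (\<lambda>n. real n powr (4 * r - 2))"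

definition consistent ::
  "'a measure \<Rightarrow> ((real \<Rightarrow> real) \<Rightarrow> 'a \<Rightarrow> real) \<Rightarrow> (real \<Rightarrow> real) \<Rightarrow> real \<Rightarrow> real
     \<Rightarrow> (nat \<Rightarrow> real \<Rightarrow> real) \<Rightarrow> bool" where
  "consistent M W K \<sigma> r f \<longleftrightarrow>
     (\<exists>h x. bandwidths r h \<and>
        limsup (\<lambda>n. ereal (type1_error M W K \<sigma> n (h n) (x n)
                          + type2_error M W K \<sigma> n (h n) (x n) (f n))) < 1)"

definition fourier_basis :: "int \<Rightarrow> real \<Rightarrow> complex" where
  "fourier_basis j t = exp (2 * of_real pi * \<i> * of_int j * of_real t)"

text \<open>\<open>f = \<Sum>\<^sub>j \<theta>\<^sub>j \<phi>\<^sub>j\<close> in the sense of \<open>L\<^sub>2\<close> convergence.\<close>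

definition fourier_expansion :: "(real \<Rightarrow> real) \<Rightarrow> (int \<Rightarrow> complex) \<Rightarrow> bool" where
  "fourier_expansion f \<theta> \<longleftrightarrow>
     (\<lambda>N. LBINT t:{0..<1}.
        (cmod (of_real (f t) - (\<Sum>j\<in>{- int N..int N}. \<theta> j * fourier_basis j t)))\<^sup>2)
     \<longlonglongrightarrow> 0"

text \<open>The tail sums converge because the expansion converges in \<open>L\<^sub>2\<close>.\<close>

definition besov_ball :: "real \<Rightarrow> real \<Rightarrow> (real \<Rightarrow> real) set" where
  "besov_ball s P\<^sub>0 =
     {f \<in> L2_per. \<exists>\<theta>. fourier_expansion f \<theta> \<and>
        (\<forall>\<Lambda>>0. \<Lambda> powr (2 * s) * (\<Sum>\<^sub>\<infinity>j\<in>{j. \<Lambda> < \<bar>real_of_int j\<bar>}. (cmod (\<theta> j))\<^sup>2) \<le> P\<^sub>0)}"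

definition dilate :: "real \<Rightarrow> (real \<Rightarrow> real) set \<Rightarrow> (real \<Rightarrow> real) set" where
  "dilate \<gamma> U = (\<lambda>g t. \<gamma> * g t) ` U"

text \<open>For the dilated Besov balls, which are closed and convex in \<open>L\<^sub>2\<close>, a nearest point exists and is
  unique up to equality almost everywhere.\<close>

definition nearest_point :: "(real \<Rightarrow> real) set \<Rightarrow> (real \<Rightarrow> real) \<Rightarrow> (real \<Rightarrow> real) \<Rightarrow> bool" where
  "nearest_point V f g \<longleftrightarrow>
     g \<in> V \<and> L2_norm1 (\<lambda>t. g t - f t) = (INF g'\<in>V. L2_norm1 (\<lambda>t. g' t - f t))"

end

theory Submission
  imports Defs
begin

text \<open>In the real orthonormal system \<open>cas j t = cos (2\<pi>jt) + sin (2\<pi>jt)\<close> the smoothing operator is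
  diagonal with multipliers \<open>K^(jh)\<close>, where \<open>K^\<close> is the Fourier transform of the even kernel, so the
  statistic is a quadratic form \<open>\<Sum>\<^sub>j K^(jh)\<^sup>2 (\<theta>\<^sub>j + \<sigma>n\<^sup>-\<^sup>1\<^sup>/\<^sup>2\<xi>\<^sub>j)\<^sup>2\<close> in independent standard normal \<open>\<xi>\<^sub>j\<close>.
  For large \<open>\<gamma>\<close> the nearest point of the dilated ball has the same coefficients as \<open>f\<close> up to
  frequencies of order \<open>L n\<^bsup>2 - 4r\<^esup>\<close> with \<open>L\<close> large, since replacing the low frequencies does not leave
  the ball; this cut-off is a large multiple of \<open>1/h\<close>. On the remaining frequencies \<open>K^(jh)\<close> is small by
  the Riemann-Lebesgue lemma, so the statistics at \<open>f\<close> and at the nearest point differ little in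
  probability, and likewise those at the difference and at \<open>0\<close>. Finally the statistic does not
  concentrate near any threshold, uniformly in \<open>f\<close>: its characteristic function at \<open>t\<close> is bounded by
  \<open>(1 + bt\<^sup>2)\<^bsup>-1/4\<^esup>\<close>, by the order of \<open>1/h\<close> frequencies near \<open>0\<close>.\<close>

section \<open>Square-integrable functions on the unit interval\<close>

text \<open>The exponents are tied together by \<open>(2 - 4 * r) * (2 * s) = 2 * r\<close>. At a
  cut-off J of order n^(2 - 4r) the weight J^(2s) in the ball grows exactly as fast as the squared
  norm of an alternative, of order n^(-2r), decays. A \<gamma> that is independent of n therefore
  leaves room in the dilated ball for any low-frequency part of that size. On the same scale n
  sqrt(h) times the squared norm stays bounded. The obstacle is uniformity: both thresholds are
  chosen before the sequence of alternatives, which is arbitrary within its norm bounds. So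
  distribution functions are compared at the threshold itself, which takes only a modulus of
  continuity common to all signals. The characteristic function bound provides it because it ignores
  the shifts in the quadratic form, and the signal enters through the shifts alone. A second
  obstacle is that white noise is linear only almost surely and the estimator is an arbitrary
  measurable version. The infinite quadratic form is therefore never handled directly: all
  comparisons are made for truncations to frequencies up to N, with N going to infinity at fixed
  n.\<close>

abbreviation freqs :: "nat \<Rightarrow> int set" where
  "freqs N \<equiv> {- int N..int N}"

lemma sum_flip: "(\<Sum>j\<in>freqs N. f (- j)) = (\<Sum>j\<in>freqs N. f j :: real)"
  by (rule sum.reindex_bij_witness[of _ uminus uminus]) auto

definition ip :: "(real \<Rightarrow> real) \<Rightarrow> (real \<Rightarrow> real) \<Rightarrow> real" where
  "ip f g = (LBINT u:{0..<1}. f u * g u)"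

lemma unit_L2_mult_integrable:
  assumes "f \<in> unit_L2" "g \<in> unit_L2"
  shows "set_integrable lborel {0..<1} (\<lambda>u. f u * g u)"
proof -
  have [measurable]: "f \<in> borel_measurable borel" "g \<in> borel_measurable borel"
    using assms by (auto simp: unit_L2_def)
  have "set_integrable lborel {0..<1} (\<lambda>u. (f u)^2 + (g u)^2)"
    using assms by (auto simp: unit_L2_def)
  moreover have "\<bar>f u * g u\<bar> \<le> (f u)^2 + (g u)^2" for u
    using sum_squares_bound[of "\<bar>f u\<bar>" "\<bar>g u\<bar>"] mult_nonneg_nonneg[of "\<bar>f u\<bar>" "\<bar>g u\<bar>"]
    unfolding abs_mult power2_abs by linarith
  ultimately show ?thesis
    by (elim set_integrable_bound) (auto simp: set_borel_measurable_def)
qed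

lemma unit_L2_scale: "f \<in> unit_L2 \<Longrightarrow> (\<lambda>u. a * f u) \<in> unit_L2"
  by (auto simp: unit_L2_def power_mult_distrib)

lemma unit_L2_add:
  assumes "f \<in> unit_L2" "g \<in> unit_L2"
  shows "(\<lambda>u. f u + g u) \<in> unit_L2"
proof -
  have "set_integrable lborel {0..<1} (\<lambda>u. ((f u)^2 + (g u)^2) + 2 * (f u * g u))"
    using assms unit_L2_mult_integrable[OF assms] by (auto simp: unit_L2_def)
  then show ?thesis
    using assms by (auto simp: unit_L2_def power2_sum algebra_simps)
qed

lemma unit_L2_diff:
  assumes "f \<in> unit_L2" "g \<in> unit_L2"
  shows "(\<lambda>u. f u - g u) \<in> unit_L2"
  using unit_L2_add[OF assms(1) unit_L2_scale[OF assms(2), of "-1"]] by simp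

lemma unit_L2_bounded:
  assumes [measurable]: "f \<in> borel_measurable borel" and "\<And>u. u \<in> {0..<1} \<Longrightarrow> \<bar>f u\<bar> \<le> B"
  shows "f \<in> unit_L2"
proof -
  have "(f u)^2 \<le> B^2" if "u \<in> {0..<1}" for u
    using assms(2)[OF that] power_mono[of "\<bar>f u\<bar>" B 2] by simp
  moreover have "set_integrable lborel {0..<1::real} (\<lambda>u. B^2)"
    by (auto simp: set_integrable_def)
  ultimately have "set_integrable lborel {0..<1} (\<lambda>u. (f u)^2)"
    by (elim set_integrable_bound) (simp_all add: set_borel_measurable_def)
  then show ?thesis by (simp add: unit_L2_def)
qed

lemma unit_L2_zero: "(\<lambda>u. 0) \<in> unit_L2"
  by (rule unit_L2_bounded[of _ 0]) auto

lemma unit_L2_sum: "(\<And>i. i \<in> I \<Longrightarrow> f i \<in> unit_L2) \<Longrightarrow> (\<lambda>u. \<Sum>i\<in>I. f i u) \<in> unit_L2"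
  by (induction I rule: infinite_finite_induct) (auto intro: unit_L2_zero unit_L2_add)

lemma L2_norm1_sq: "(L2_norm1 f)^2 = ip f f"
  unfolding L2_norm1_def ip_def power2_eq_square[symmetric]
  by (subst real_sqrt_pow2) (auto simp: set_lebesgue_integral_def intro!: integral_nonneg_AE)

lemma L2_norm1_nonneg: "0 \<le> L2_norm1 f"
  unfolding L2_norm1_def by (auto simp: set_lebesgue_integral_def intro!: integral_nonneg_AE)

lemma ip_self_nonneg: "0 \<le> ip f f"
  by (metis L2_norm1_sq zero_le_power2)

lemma ip_commute: "ip f g = ip g f"
  by (simp add: ip_def mult.commute)

lemma ip_add_left:
  "f \<in> unit_L2 \<Longrightarrow> g \<in> unit_L2 \<Longrightarrow> k \<in> unit_L2 \<Longrightarrow> ip (\<lambda>u. f u + g u) k = ip f k + ip g k"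
  unfolding ip_def by (simp add: unit_L2_mult_integrable distrib_right)

lemma ip_diff_left:
  "f \<in> unit_L2 \<Longrightarrow> g \<in> unit_L2 \<Longrightarrow> k \<in> unit_L2 \<Longrightarrow> ip (\<lambda>u. f u - g u) k = ip f k - ip g k"
  unfolding ip_def by (simp add: unit_L2_mult_integrable left_diff_distrib)

lemma ip_scale_left: "ip (\<lambda>u. a * f u) k = a * ip f k"
  unfolding ip_def by (simp add: mult.assoc)

lemma ip_zero_left: "ip (\<lambda>u. 0) k = 0"
  unfolding ip_def by (simp add: set_lebesgue_integral_def)

lemma ip_sum_left:
  "(\<And>i. i \<in> I \<Longrightarrow> f i \<in> unit_L2) \<Longrightarrow> k \<in> unit_L2 \<Longrightarrow> ip (\<lambda>u. \<Sum>i\<in>I. f i u) k = (\<Sum>i\<in>I. ip (f i) k)"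
  by (induction I rule: infinite_finite_induct) (auto simp: ip_zero_left ip_add_left unit_L2_sum)

lemma ip_add_right:
  "f \<in> unit_L2 \<Longrightarrow> g \<in> unit_L2 \<Longrightarrow> k \<in> unit_L2 \<Longrightarrow> ip k (\<lambda>u. f u + g u) = ip k f + ip k g"
  by (simp add: ip_commute[of k] ip_add_left)

lemma ip_diff_right:
  "f \<in> unit_L2 \<Longrightarrow> g \<in> unit_L2 \<Longrightarrow> k \<in> unit_L2 \<Longrightarrow> ip k (\<lambda>u. f u - g u) = ip k f - ip k g"
  by (simp add: ip_commute[of k] ip_diff_left)

lemma ip_scale_right: "ip k (\<lambda>u. a * f u) = a * ip k f"
  by (simp add: ip_commute[of k] ip_scale_left)

lemma ip_sum_right:
  "(\<And>i. i \<in> I \<Longrightarrow> f i \<in> unit_L2) \<Longrightarrow> k \<in> unit_L2 \<Longrightarrow> ip k (\<lambda>u. \<Sum>i\<in>I. f i u) = (\<Sum>i\<in>I. ip k (f i))"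
  by (simp add: ip_commute[of k] ip_sum_left)

lemma ip_Cauchy_Schwarz:
  assumes f: "f \<in> unit_L2" and g: "g \<in> unit_L2"
  shows "(ip f g)^2 \<le> ip f f * ip g g"
proof -
  have q: "0 \<le> ip f f * b^2 + 2 * a * b * ip f g + a^2 * ip g g" for a b
  proof -
    have "0 \<le> ip (\<lambda>u. b * f u + a * g u) (\<lambda>u. b * f u + a * g u)" by (rule ip_self_nonneg)
    also have "... = ip f f * b^2 + 2 * a * b * ip f g + a^2 * ip g g"
      using f g by (simp add: ip_add_left ip_add_right ip_scale_left ip_scale_right unit_L2_scale
          unit_L2_add ip_commute[of g f] power2_eq_square algebra_simps)
    finally show ?thesis .
  qed
  show ?thesis
  proof (cases "ip f f = 0")
    case True
    have "ip f g = 0"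
    proof (rule ccontr)
      assume n: "ip f g \<noteq> 0"
      \<comment> \<open>With \<open>ip f f = 0\<close> and weight 1 on \<open>g\<close>, the form is
        affine in the weight of \<open>f\<close>; this weight gives it the value -1.\<close>
      show False using q[of "- (ip g g + 1) / (2 * ip f g)" 1] True n ip_self_nonneg[of g] by (simp add: field_simps)
    qed
    then show ?thesis using True by simp
  next
    case False
    then have pos: "0 < ip f f" using ip_self_nonneg[of f] by linarith
    have "0 \<le> ip f f * (- ip f g)^2 + 2 * ip f f * (- ip f g) * ip f g + (ip f f)^2 * ip g g"
      by (rule q)
    also have "... = ip f f * (ip f f * ip g g - (ip f g)^2)" by (simp add: power2_eq_square algebra_simps)
    finally show ?thesis using pos by (simp add: zero_le_mult_iff)
  qed
qed

lemma ip_abs_le: "f \<in> unit_L2 \<Longrightarrow> g \<in> unit_L2 \<Longrightarrow> \<bar>ip f g\<bar> \<le> L2_norm1 f * L2_norm1 g"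
proof -
  assume "f \<in> unit_L2" "g \<in> unit_L2"
  then have "\<bar>ip f g\<bar>^2 \<le> (L2_norm1 f * L2_norm1 g)^2"
    by (simp add: power_mult_distrib L2_norm1_sq ip_Cauchy_Schwarz)
  then show ?thesis
    by (rule power2_le_imp_le) (simp add: L2_norm1_nonneg)
qed

lemma L2_norm1_triangle:
  assumes f: "f \<in> unit_L2" and g: "g \<in> unit_L2"
  shows "L2_norm1 (\<lambda>u. f u + g u) \<le> L2_norm1 f + L2_norm1 g"
proof -
  have "(L2_norm1 (\<lambda>u. f u + g u))^2 = ip f f + 2 * ip f g + ip g g"
    using f g by (simp add: L2_norm1_sq ip_add_left ip_add_right unit_L2_add ip_commute[of g f])
  also have "... \<le> (L2_norm1 f + L2_norm1 g)^2"
    using ip_abs_le[OF f g] by (simp add: power2_sum L2_norm1_sq)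
  finally show ?thesis by (rule power2_le_imp_le) (simp add: L2_norm1_nonneg)
qed

lemma L2_norm1_scale: "L2_norm1 (\<lambda>u. a * f u) = \<bar>a\<bar> * L2_norm1 f"
proof -
  have "(L2_norm1 (\<lambda>u. a * f u))^2 = (\<bar>a\<bar> * L2_norm1 f)^2"
    unfolding power_mult_distrib power2_abs L2_norm1_sq ip_scale_left ip_scale_right
    by (simp add: power2_eq_square)
  then show ?thesis
    by (rule power2_eq_imp_eq) (simp_all add: L2_norm1_nonneg)
qed

section \<open>The Hartley system: one real orthonormal function for each integer frequency\<close>

definition cas :: "int \<Rightarrow> real \<Rightarrow> real" where
  "cas j t = cos (2 * pi * of_int j * t) + sin (2 * pi * of_int j * t)"

lemma cas_measurable [measurable]: "cas j \<in> borel_measurable borel"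
  unfolding cas_def by measurable

lemma abs_cas_le: "\<bar>cas j t\<bar> \<le> 2"
  unfolding cas_def
  using abs_cos_le_one[of "2 * pi * of_int j * t"] abs_sin_le_one[of "2 * pi * of_int j * t"] by linarith

lemma cas_unit_L2: "cas j \<in> unit_L2"
  by (rule unit_L2_bounded[of _ 2]) (auto simp: abs_cas_le)

lemma sin_2pi_int: "sin (2 * pi * of_int k) = 0"
  using sin_integer_2pi[of "of_int k"] by (simp add: mult.commute mult.left_commute)

lemma cos_2pi_int: "cos (2 * pi * of_int k) = 1"
  using cos_integer_2pi[of "of_int k"] by (simp add: mult.commute mult.left_commute)

lemma set_integral_half_open:
  fixes f :: "real \<Rightarrow> 'b::{banach, second_countable_topology}"
  shows "(LBINT u:{0..<1}. f u) = (LBINT u:{0..1}. f u)"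
  unfolding set_lebesgue_integral_def
  by (rule integral_discrete_difference[of "{1}"]) (auto simp: indicator_def)

lemma integral_cos_2pi: "(LBINT u:{0..<1}. cos (2 * pi * of_int k * u)) = (if k = 0 then 1 else 0)"
proof (cases "k = 0")
  case False
  have "(LBINT u:{0..1}. cos (2 * pi * of_int k * u))
      = sin (2 * pi * of_int k * 1) / (2 * pi * of_int k) - sin (2 * pi * of_int k * 0) / (2 * pi * of_int k)"
    unfolding set_lebesgue_integral_def
    using False
    by (intro integral_FTC_Icc) (auto intro!: derivative_eq_intros continuous_intros simp: has_real_derivative_iff_has_vector_derivative[symmetric])
  then show ?thesis using False by (simp add: set_integral_half_open sin_2pi_int)
qed (simp add: set_lebesgue_integral_def)

lemma integral_sin_2pi: "(LBINT u:{0..<1}. sin (2 * pi * of_int k * u)) = 0"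
proof (cases "k = 0")
  case False
  have "(LBINT u:{0..1}. sin (2 * pi * of_int k * u))
      = - cos (2 * pi * of_int k * 1) / (2 * pi * of_int k) - - cos (2 * pi * of_int k * 0) / (2 * pi * of_int k)"
    unfolding set_lebesgue_integral_def
    using False
    by (intro integral_FTC_Icc) (auto intro!: derivative_eq_intros continuous_intros simp: has_real_derivative_iff_has_vector_derivative[symmetric])
  then show ?thesis using False by (simp add: set_integral_half_open cos_2pi_int)
qed (simp add: set_lebesgue_integral_def)

lemma set_integrable_bounded:
  fixes f :: "real \<Rightarrow> real"
  assumes [measurable]: "f \<in> borel_measurable borel" and "\<And>u. \<bar>f u\<bar> \<le> B"
  shows "set_integrable lborel {0..<1} f"
proof -
  have "set_integrable lborel {0..<1::real} (\<lambda>u. B)"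
    by (auto simp: set_integrable_def)
  then show ?thesis
    using assms(2)
    by (elim set_integrable_bound) (auto simp: set_borel_measurable_def intro!: AE_I2 order_trans[OF assms(2)])
qed

lemma cas_mult: "cas j u * cas k u = cos (2 * pi * of_int (j - k) * u) + sin (2 * pi * of_int (j + k) * u)"
proof -
  have "2 * pi * of_int (j - k) * u = 2 * pi * of_int j * u - 2 * pi * of_int k * u"
    "2 * pi * of_int (j + k) * u = 2 * pi * of_int j * u + 2 * pi * of_int k * u"
    by (simp_all add: algebra_simps)
  then show ?thesis
    unfolding cas_def by (simp only: cos_diff sin_add) (simp add: algebra_simps)
qed

lemma ip_cas: "ip (cas j) (cas k) = (if j = k then 1 else 0)"
proof -
  have "ip (cas j) (cas k) = (LBINT u:{0..<1}. cos (2 * pi * of_int (j - k) * u)) + (LBINT u:{0..<1}. sin (2 * pi * of_int (j + k) * u))"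
    unfolding ip_def cas_mult
    by (intro set_integral_add set_integrable_bounded[of _ 1]) auto
  then show ?thesis by (simp only: integral_cos_2pi integral_sin_2pi) auto
qed

lemma ip_cas_sum:
  assumes "finite I"
  shows "ip (\<lambda>u. \<Sum>j\<in>I. a j * cas j u) (cas k) = (if k \<in> I then a k else 0)"
proof -
  have "ip (\<lambda>u. \<Sum>j\<in>I. a j * cas j u) (cas k) = (\<Sum>j\<in>I. a j * ip (cas j) (cas k))"
    by (simp add: ip_sum_left unit_L2_scale cas_unit_L2 ip_scale_left)
  also have "... = (\<Sum>j\<in>I. if j = k then a k else 0)"
    by (intro sum.cong) (auto simp: ip_cas)
  finally show ?thesis using assms by simp
qed

lemma cas_sum_unit_L2: "(\<lambda>u. \<Sum>j\<in>I. a j * cas j u) \<in> unit_L2"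
  by (intro unit_L2_sum unit_L2_scale cas_unit_L2)

lemma ip_cas_sums:
  assumes "finite I"
  shows "ip (\<lambda>u. \<Sum>j\<in>I. a j * cas j u) (\<lambda>u. \<Sum>j\<in>I. b j * cas j u) = (\<Sum>j\<in>I. a j * b j)"
  using assms
  by (subst ip_sum_right)
    (auto simp: unit_L2_scale cas_unit_L2 cas_sum_unit_L2 ip_scale_right ip_cas_sum mult.commute)

text \<open>Pythagoras for arbitrary coefficients \<open>a\<close>: taking
  \<open>a j = ip f (cas j)\<close> gives Bessel, and any other choice gives the best-approximation
  property on which \<open>kernel_tail_tendsto_0\<close> rests.\<close>

lemma ip_minus_cas_sum:
  assumes "finite I" and f: "f \<in> unit_L2"
  shows "ip (\<lambda>u. f u - (\<Sum>j\<in>I. a j * cas j u)) (\<lambda>u. f u - (\<Sum>j\<in>I. a j * cas j u))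
       = ip f f - (\<Sum>j\<in>I. (ip f (cas j))^2) + (\<Sum>j\<in>I. (ip f (cas j) - a j)^2)"
proof -
  define p where "p = (\<lambda>u. \<Sum>j\<in>I. a j * cas j u)"
  have p: "p \<in> unit_L2" unfolding p_def by (rule cas_sum_unit_L2)
  have pp: "ip p p = (\<Sum>j\<in>I. a j * a j)" unfolding p_def by (rule ip_cas_sums[OF assms(1)])
  have fp: "ip f p = (\<Sum>j\<in>I. a j * ip f (cas j))"
    unfolding p_def by (simp add: ip_sum_right unit_L2_scale cas_unit_L2 f ip_scale_right)
  have "ip (\<lambda>u. f u - p u) (\<lambda>u. f u - p u) = ip f f - 2 * ip f p + ip p p"
    using f p by (simp add: ip_diff_left ip_diff_right unit_L2_diff ip_commute[of p f])
  also have "... = ip f f - (\<Sum>j\<in>I. (ip f (cas j))^2) + (\<Sum>j\<in>I. (ip f (cas j) - a j)^2)"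
    unfolding pp fp
    by (simp add: power2_diff sum.distrib sum_subtractf sum_distrib_left power2_eq_square algebra_simps)
  finally show ?thesis unfolding p_def .
qed

lemma Bessel:
  assumes "finite I" and "f \<in> unit_L2"
  shows "(\<Sum>j\<in>I. (ip f (cas j))^2) \<le> ip f f"
  using ip_minus_cas_sum[OF assms, of "\<lambda>j. ip f (cas j)"]
    ip_self_nonneg[of "\<lambda>u. f u - (\<Sum>j\<in>I. ip f (cas j) * cas j u)"] by simp

section \<open>Independence from factorizing characteristic functions\<close>

context prob_space
begin

text \<open>Adding a constant makes the weight a positive density, under which \<open>X\<close> keeps its characteristic
  function, hence its law by Levy uniqueness.\<close>

lemma bounded_weight_char_factor:
  fixes V X :: "'a \<Rightarrow> real"
  assumes [measurable]: "V \<in> borel_measurable M" "X \<in> borel_measurable M" "A \<in> sets borel"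
    and B: "\<And>z. \<bar>V z\<bar> \<le> B"
    and char: "\<And>s. (\<integral>z. V z * iexp (s * X z) \<partial>M) = (\<integral>z. V z \<partial>M) * (\<integral>z. iexp (s * X z) \<partial>M)"
  shows "(\<integral>z. V z * indicator A (X z) \<partial>M) = (\<integral>z. V z \<partial>M) * (\<integral>z. indicator A (X z) \<partial>M)"
proof -
  define U where "U = (\<lambda>z. V z + (B + 1))"
  have U1: "1 \<le> U z" for z using B[of z] by (simp add: U_def)
  have [measurable]: "U \<in> borel_measurable M" by (simp add: U_def)
  have iV: "integrable M V" by (rule integrable_const_bound[of _ B]) (auto simp: B)
  have iU: "integrable M U" unfolding U_def using iV by simp
  define c where "c = (\<integral>z. U z \<partial>M)"
  have c: "c = (\<integral>z. V z \<partial>M) + (B + 1)" using iV by (simp add: c_def U_def prob_space)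
  have "1 \<le> c"
    unfolding c_def using integral_mono[OF _ iU, of "\<lambda>_. 1"] U1 by (simp add: prob_space)
  then have c0: "0 < c" by simp
  define N where "N = density M (\<lambda>z. U z / c)"
  have [measurable_cong]: "sets N = sets M" by (simp add: N_def)
  have dU: "0 \<le> U z / c" for z using U1[of z] c0 by (auto intro!: divide_nonneg_pos)
  have "emeasure N (space N) = 1"
  proof -
    have "emeasure N (space N) = (\<integral>\<^sup>+z. ennreal (U z / c) \<partial>M)"
      unfolding N_def by (subst emeasure_density) (auto intro!: nn_integral_cong)
    also have "... = ennreal (\<integral>z. U z / c \<partial>M)"
      by (rule nn_integral_eq_integral) (use iU dU in auto)
    also have "... = 1" using c0 by (simp add: c_def)
    finally show ?thesis .
  qed
  then interpret N: prob_space N by (rule prob_spaceI)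
  have XN: "X \<in> borel_measurable N" by simp
  have rdN: "real_distribution (distr N borel X)" by (rule N.real_distribution_distr) (rule XN)
  have rdM: "real_distribution (distr M borel X)" by (rule real_distribution_distr) simp
  have ii: "integrable M (\<lambda>z. iexp (s * X z))" for s by (rule integrable_iexp) auto
  have iVi: "integrable M (\<lambda>z. V z * iexp (s * X z))" for s
    by (rule integrable_const_bound[of _ B]) (auto simp: norm_mult B)
  have "char (distr N borel X) s = char (distr M borel X) s" for s
  proof -
    have "char (distr N borel X) s = (\<integral>z. iexp (s * X z) \<partial>N)"
      unfolding char_def by (subst integral_distr) auto
    also have "... = (\<integral>z. (U z / c) *\<^sub>R iexp (s * X z) \<partial>M)"
      unfolding N_def by (subst integral_density) (auto simp: dU)
    also have "... = (\<integral>z. (V z * iexp (s * X z) + (B + 1) * iexp (s * X z)) / c \<partial>M)"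
      by (intro Bochner_Integration.integral_cong) (auto simp: U_def scaleR_conv_of_real field_simps)
    also have "... = ((\<integral>z. V z * iexp (s * X z) \<partial>M) + (B + 1) * (\<integral>z. iexp (s * X z) \<partial>M)) / c"
      using ii iVi by simp
    also have "... = (\<integral>z. iexp (s * X z) \<partial>M) * complex_of_real ((\<integral>z. V z \<partial>M) + (B + 1)) / c"
      unfolding char by (simp add: algebra_simps)
    also have "... = (\<integral>z. iexp (s * X z) \<partial>M)"
      using c0 unfolding c[symmetric] by simp
    also have "... = char (distr M borel X) s"
      unfolding char_def by (subst integral_distr) auto
    finally show ?thesis .
  qed
  then have eq: "distr N borel X = distr M borel X"
    by (intro Levy_uniqueness rdN rdM ext)
  have "(\<integral>z. (U z / c) * indicator A (X z) \<partial>M) = (\<integral>z. indicator A (X z) \<partial>N)"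
    unfolding N_def by (subst integral_density) (auto simp: dU)
  also have "... = (\<integral>x. indicator A x \<partial>distr N borel X)" by (subst integral_distr) auto
  also have "... = (\<integral>z. indicator A (X z) \<partial>M)" unfolding eq by (subst integral_distr) auto
  finally have "(\<integral>z. (U z * indicator A (X z)) / c \<partial>M) = (\<integral>z. indicator A (X z) \<partial>M :: real)"
    by simp
  then have 1: "(\<integral>z. U z * indicator A (X z) \<partial>M) = c * (\<integral>z. indicator A (X z) \<partial>M)"
    using c0 by (simp add: field_simps)
  have iA: "integrable M (\<lambda>z. indicator A (X z) :: real)"
    by (rule integrable_const_bound[of _ 1]) (auto simp: indicator_def)
  have iVA: "integrable M (\<lambda>z. V z * indicator A (X z))"
    by (rule integrable_const_bound[of _ B]) (use B B[THEN order_trans[OF abs_ge_zero]] in \<open>auto simp: indicator_def\<close>)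
  have "(\<integral>z. U z * indicator A (X z) \<partial>M) = (\<integral>z. V z * indicator A (X z) + (B + 1) * indicator A (X z) \<partial>M)"
    by (simp add: U_def algebra_simps)
  also have "... = (\<integral>z. V z * indicator A (X z) \<partial>M) + (B + 1) * (\<integral>z. indicator A (X z) \<partial>M)"
    using iA iVA by simp
  finally show ?thesis using 1 c by (simp add: algebra_simps)
qed

text \<open>Conjugation together with \<open>s\<close> replaced by \<open>- s\<close> turns the
  factorization for \<open>Y\<close> into the one for \<open>cnj Y\<close>. The real part inherits
  it, so the real-valued lemma applies; the imaginary part is the real part of
  \<open>- \<i> * Y\<close>.\<close>

lemma complex_weight_char_factor:
  fixes Y :: "'a \<Rightarrow> complex" and X :: "'a \<Rightarrow> real"
  assumes Y: "Y \<in> borel_measurable M" and [measurable]: "X \<in> borel_measurable M" "A \<in> sets borel"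
    and B: "\<And>z. norm (Y z) \<le> B"
    and char: "\<And>s. (\<integral>z. Y z * iexp (s * X z) \<partial>M) = (\<integral>z. Y z \<partial>M) * (\<integral>z. iexp (s * X z) \<partial>M)"
  shows "(\<integral>z. Y z * indicator A (X z) \<partial>M) = (\<integral>z. Y z \<partial>M) * prob (X -` A \<inter> space M)"
proof -
  let ?e = "\<lambda>s z. iexp (s * X z)"
  have real_part: "(\<integral>z. Re (V z) * indicator A (X z) \<partial>M) = (\<integral>z. Re (V z) \<partial>M) * (\<integral>z. indicator A (X z) \<partial>M)"
    if [measurable]: "V \<in> borel_measurable M" and VB: "\<And>z. norm (V z) \<le> B"
      and char: "\<And>s. (\<integral>z. V z * ?e s z \<partial>M) = (\<integral>z. V z \<partial>M) * (\<integral>z. ?e s z \<partial>M)" for V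
  proof (rule bounded_weight_char_factor)
    show "\<bar>Re (V z)\<bar> \<le> B" for z using VB[of z] abs_Re_le_cmod[of "V z"] by linarith
    fix s
    have [measurable]: "(\<lambda>z. cnj (V z)) \<in> borel_measurable M"
      by (rule borel_measurable_continuous_on[where f=cnj]) (auto intro: continuous_intros)
    have i: "integrable M V" "integrable M (\<lambda>z. V z * ?e s z)" "integrable M (\<lambda>z. cnj (V z) * ?e s z)"
      by (rule integrable_const_bound[of _ B]; simp add: norm_mult VB)+
    have "(\<integral>z. cnj (V z) * ?e s z \<partial>M) = cnj (\<integral>z. V z * ?e (- s) z \<partial>M)"
      using Bochner_Integration.integral_cnj[of M "\<lambda>z. V z * ?e (- s) z"] by (simp add: exp_cnj)
    also have "... = cnj (\<integral>z. V z \<partial>M) * cnj (\<integral>z. ?e (- s) z \<partial>M)"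
      unfolding char by simp
    also have "cnj (\<integral>z. ?e (- s) z \<partial>M) = (\<integral>z. ?e s z \<partial>M)"
      by (subst Bochner_Integration.integral_cnj[symmetric]) (simp add: exp_cnj)
    finally have cnj_char: "(\<integral>z. cnj (V z) * ?e s z \<partial>M) = cnj (\<integral>z. V z \<partial>M) * (\<integral>z. ?e s z \<partial>M)" .
    have "(\<integral>z. of_real (Re (V z)) * ?e s z \<partial>M) = (\<integral>z. (V z * ?e s z + cnj (V z) * ?e s z) / 2 \<partial>M)"
      by (intro Bochner_Integration.integral_cong) (auto simp: complex_eq_iff)
    also have "... = ((\<integral>z. V z * ?e s z \<partial>M) + (\<integral>z. cnj (V z) * ?e s z \<partial>M)) / 2"
      using i by simp
    also have "... = ((\<integral>z. V z \<partial>M) + cnj (\<integral>z. V z \<partial>M)) / 2 * (\<integral>z. ?e s z \<partial>M)"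
      unfolding char cnj_char by (simp add: algebra_simps)
    also have "((\<integral>z. V z \<partial>M) + cnj (\<integral>z. V z \<partial>M)) / 2 = of_real (\<integral>z. Re (V z) \<partial>M)"
      using i by (auto simp: complex_eq_iff)
    finally show "(\<integral>z. of_real (Re (V z)) * ?e s z \<partial>M) = of_real (\<integral>z. Re (V z) \<partial>M) * (\<integral>z. ?e s z \<partial>M)" .
  qed auto
  note [measurable] = Y
  have Re_eq: "(\<integral>z. Re (Y z) * indicator A (X z) \<partial>M) = (\<integral>z. Re (Y z) \<partial>M) * (\<integral>z. indicator A (X z) \<partial>M)"
    by (rule real_part[OF Y B char])
  have Im_eq: "(\<integral>z. Im (Y z) * indicator A (X z) \<partial>M) = (\<integral>z. Im (Y z) \<partial>M) * (\<integral>z. indicator A (X z) \<partial>M)"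
  proof -
    have "(\<integral>z. (- \<i> * Y z) * ?e s z \<partial>M) = (\<integral>z. - \<i> * Y z \<partial>M) * (\<integral>z. ?e s z \<partial>M)" for s
      by (simp only: mult.assoc integral_mult_right_zero char)
    from real_part[OF _ _ this] show ?thesis by (simp add: B norm_mult)
  qed
  have i: "integrable M Y" "integrable M (\<lambda>z. Y z * indicator A (X z))"
    by (rule integrable_const_bound[of _ B]; use B B[THEN order_trans[OF norm_ge_zero]] in \<open>auto simp: indicator_def\<close>)+
  have p: "(\<integral>z. indicator A (X z) \<partial>M) = prob (X -` A \<inter> space M)"
  proof -
    have "(\<integral>z. indicator A (X z) \<partial>M) = (\<integral>z. indicator (X -` A \<inter> space M) z \<partial>M :: real)"
      by (intro Bochner_Integration.integral_cong) (auto simp: indicator_def)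
    then show ?thesis by (simp add: Int_absorb2)
  qed
  have R: "Re (indicator A x) = indicator A x" "Im (indicator A x) = 0" for x :: real
    by (auto simp: indicator_def)
  have "Re (\<integral>z. Y z * indicator A (X z) \<partial>M) = (\<integral>z. Re (Y z) * indicator A (X z) \<partial>M)"
    "Im (\<integral>z. Y z * indicator A (X z) \<partial>M) = (\<integral>z. Im (Y z) * indicator A (X z) \<partial>M)"
    using i by (auto simp: R integral_Re[symmetric] integral_Im[symmetric] simp del: integral_Re integral_Im)
  then show ?thesis
    using Re_eq Im_eq p i by (intro complex_eqI) (simp_all add: integral_Re integral_Im)
qed

text \<open>The variables in \<open>K\<close> are already converted from exponentials to indicators,
  those in \<open>L\<close> not yet. The induction converts one more variable at a time, for which
  \<open>L\<close> and \<open>t\<close> have to stay arbitrary.\<close>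

lemma indicator_char_product:
  fixes X :: "'i \<Rightarrow> 'a \<Rightarrow> real"
  assumes X: "\<And>i. i \<in> K \<union> L \<Longrightarrow> X i \<in> borel_measurable M"
    and fin: "finite K" "finite L" and disj: "K \<inter> L = {}"
    and A: "\<And>i. i \<in> K \<Longrightarrow> A i \<in> sets borel"
    and char: "\<And>J t. J \<subseteq> K \<union> L \<Longrightarrow>
      (\<integral>z. iexp (\<Sum>i\<in>J. t i * X i z) \<partial>M) = (\<Prod>i\<in>J. \<integral>z. iexp (t i * X i z) \<partial>M)"
  shows "(\<integral>z. (\<Prod>i\<in>K. indicator (A i) (X i z)) * iexp (\<Sum>i\<in>L. t i * X i z) \<partial>M)
     = (\<Prod>i\<in>K. complex_of_real (prob (X i -` A i \<inter> space M))) * (\<Prod>i\<in>L. \<integral>z. iexp (t i * X i z) \<partial>M)"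
  using fin(1) X fin(2) disj A char
proof (induction K arbitrary: L t rule: finite_induct)
  case empty
  then show ?case by simp
next
  case (insert k K)
  let ?p = "\<lambda>i. complex_of_real (prob (X i -` A i \<inter> space M))" and ?e = "\<lambda>t i. \<integral>z. iexp (t i * X i z) \<partial>M"
  note X = insert.prems(1) and A = insert.prems(4)
  have [measurable]: "X k \<in> borel_measurable M" "A k \<in> sets borel"
    "\<And>i. i \<in> K \<Longrightarrow> X i \<in> borel_measurable M" "\<And>i. i \<in> K \<Longrightarrow> A i \<in> sets borel"
    "\<And>i. i \<in> L \<Longrightarrow> X i \<in> borel_measurable M"
    using X A by auto
  define Y where "Y = (\<lambda>z. (\<Prod>i\<in>K. indicator (A i) (X i z)) * iexp (\<Sum>i\<in>L. t i * X i z))"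
  have [measurable]: "Y \<in> borel_measurable M" unfolding Y_def by measurable
  have "norm (\<Prod>i\<in>K. indicator (A i) (X i z) :: complex) \<le> 1" for z
    unfolding prod_norm[symmetric] by (intro prod_le_1) (auto simp: indicator_def)
  then have YB: "norm (Y z) \<le> 1" for z by (simp add: Y_def norm_mult)
  have kL: "k \<notin> L" "finite L" using insert.prems by auto
  have charK: "(\<integral>z. iexp (\<Sum>i\<in>J. t i * X i z) \<partial>M) = (\<Prod>i\<in>J. ?e t i)"
    if "J \<subseteq> K \<union> L" for J t
    using insert.prems(5)[of J t] that by auto
  have EY: "(\<integral>z. Y z \<partial>M) = (\<Prod>i\<in>K. ?p i) * (\<Prod>i\<in>L. ?e t i)"
    unfolding Y_def
    by (rule insert.IH) (use insert.prems(1-4) charK in auto)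
  have "(\<integral>z. Y z * indicator (A k) (X k z) \<partial>M) = (\<integral>z. Y z \<partial>M) * prob (X k -` A k \<inter> space M)"
  proof (rule complex_weight_char_factor[OF _ _ _ YB])
    fix s
    \<comment> \<open>With \<open>k\<close> put among the exponentials with parameter
      \<open>s\<close>, the induction hypothesis for \<open>insert k L\<close> is exactly the
      factorization required to convert \<open>k\<close>.\<close>
    define t' where "t' = t(k := s)"
    have st: "(\<Sum>i\<in>L. t' i * X i z) = (\<Sum>i\<in>L. t i * X i z)" for z
      using kL by (intro sum.cong) (auto simp: t'_def)
    have pt: "(\<Prod>i\<in>L. ?e t' i) = (\<Prod>i\<in>L. ?e t i)"
      using kL by (intro prod.cong) (auto simp: t'_def)
    have "(\<integral>z. Y z * iexp (s * X k z) \<partial>M)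
        = (\<integral>z. (\<Prod>i\<in>K. indicator (A i) (X i z)) * iexp (\<Sum>i\<in>insert k L. t' i * X i z) \<partial>M)"
      using kL by (simp add: Y_def st) (simp add: t'_def exp_add distrib_left mult_ac)
    also have "... = (\<Prod>i\<in>K. ?p i) * (\<Prod>i\<in>insert k L. ?e t' i)"
      by (rule insert.IH) (use insert in auto)
    also have "... = (\<integral>z. Y z \<partial>M) * (\<integral>z. iexp (s * X k z) \<partial>M)"
      unfolding EY prod.insert[OF kL(2,1)] pt by (simp add: t'_def)
    finally show "(\<integral>z. Y z * iexp (s * X k z) \<partial>M) = (\<integral>z. Y z \<partial>M) * (\<integral>z. iexp (s * X k z) \<partial>M)" .
  qed auto
  then show ?case
    using insert.hyps unfolding EY by (simp add: Y_def mult_ac)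
qed

text \<open>Kac's theorem: once no exponentials are left (\<open>L = {}\<close>), the preceding
  lemma is the product rule for preimages of Borel sets.\<close>

lemma indep_vars_if_char_product:
  fixes X :: "'i \<Rightarrow> 'a \<Rightarrow> real"
  assumes X: "\<And>i. i \<in> I \<Longrightarrow> X i \<in> borel_measurable M"
    and char: "\<And>J t. finite J \<Longrightarrow> J \<subseteq> I \<Longrightarrow>
      (\<integral>z. iexp (\<Sum>i\<in>J. t i * X i z) \<partial>M) = (\<Prod>i\<in>J. \<integral>z. iexp (t i * X i z) \<partial>M)"
  shows "indep_vars (\<lambda>_. borel) X I"
proof -
  have "prob (\<Inter>j\<in>J. B j) = (\<Prod>j\<in>J. prob (B j))"
    if J: "J \<subseteq> I" "J \<noteq> {}" "finite J" and B: "B \<in> Pi J (\<lambda>i. {X i -` A \<inter> space M |A. A \<in> sets borel})" for J B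
  proof -
    have "\<forall>i\<in>J. \<exists>A. A \<in> sets borel \<and> B i = X i -` A \<inter> space M"
    proof
      fix i assume "i \<in> J"
      from Pi_mem[OF B this] show "\<exists>A. A \<in> sets borel \<and> B i = X i -` A \<inter> space M" by auto
    qed
    then obtain A where A: "\<And>i. i \<in> J \<Longrightarrow> A i \<in> sets borel" "\<And>i. i \<in> J \<Longrightarrow> B i = X i -` A i \<inter> space M"
      by metis
    have Bm: "(\<Inter>j\<in>J. B j) \<in> events"
    proof (rule sets.finite_INT)
      fix i assume "i \<in> J"
      then show "B i \<in> events" using J A X measurable_sets[of "X i" M borel "A i"] by auto
    qed (use J in auto)
    have charJ: "(\<integral>z. iexp (\<Sum>i\<in>J'. t i * X i z) \<partial>M) = (\<Prod>i\<in>J'. \<integral>z. iexp (t i * X i z) \<partial>M)"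
      if "J' \<subseteq> J" for J' t
      using char[of J' t] that J by (meson finite_subset order_trans)
    have "complex_of_real (prob (\<Inter>j\<in>J. B j)) = (\<integral>z. complex_of_real (indicator (\<Inter>j\<in>J. B j) z) \<partial>M)"
      using Bm by (subst integral_complex_of_real) (auto simp: Int_absorb2 sets.sets_into_space)
    also have "... = (\<integral>z. (\<Prod>i\<in>J. indicator (A i) (X i z)) * iexp (\<Sum>i\<in>{}. 0 * X i z) \<partial>M)"
    proof (intro Bochner_Integration.integral_cong refl)
      fix z assume "z \<in> space M"
      then show "complex_of_real (indicator (\<Inter>j\<in>J. B j) z) = (\<Prod>i\<in>J. indicator (A i) (X i z)) * iexp (\<Sum>i\<in>{}. 0 * X i z)"
        using J A(2) by (cases "\<forall>i\<in>J. X i z \<in> A i") (auto simp: indicator_def intro!: prod_zero[symmetric])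
    qed
    also have "... = (\<Prod>i\<in>J. complex_of_real (prob (X i -` A i \<inter> space M))) * (\<Prod>i\<in>{}. \<integral>z. iexp (0 * X i z) \<partial>M)"
      by (rule indicator_char_product[where t="\<lambda>_. 0"]) (use J X A charJ in auto)
    also have "... = complex_of_real (\<Prod>j\<in>J. prob (B j))"
      using A(2) by simp
    finally show ?thesis using of_real_eq_iff by blast
  qed
  then show ?thesis
    unfolding indep_vars_def2 indep_sets_def using X
    by (auto intro!: measurable_sets)
qed

end

section \<open>White noise\<close>

locale white_noise_space =
  fixes M :: "'a measure" and W :: "(real \<Rightarrow> real) \<Rightarrow> 'a \<Rightarrow> real"
  assumes white_noise: "white_noise M W"

sublocale white_noise_space \<subseteq> prob_space M
  using white_noise by (simp add: white_noise_def)

context white_noise_space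
begin

lemma W_measurable [measurable (raw)]: "g \<in> unit_L2 \<Longrightarrow> W g \<in> borel_measurable M"
  using white_noise by (simp add: white_noise_def)

lemma W_null: "g \<in> unit_L2 \<Longrightarrow> L2_norm1 g = 0 \<Longrightarrow> AE z in M. W g z = 0"
  using white_noise by (auto simp: white_noise_def split: if_splits)

lemma W_distributed:
  "g \<in> unit_L2 \<Longrightarrow> L2_norm1 g \<noteq> 0 \<Longrightarrow> distributed M lborel (W g) (normal_density 0 (L2_norm1 g))"
  using white_noise by (auto simp: white_noise_def split: if_splits)

lemma W_linear:
  "g \<in> unit_L2 \<Longrightarrow> k \<in> unit_L2 \<Longrightarrow> AE z in M. W (\<lambda>u. a * g u + b * k u) z = a * W g z + b * W k z"
  using white_noise by (simp add: white_noise_def)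

lemma W_diff:
  "g \<in> unit_L2 \<Longrightarrow> k \<in> unit_L2 \<Longrightarrow> AE z in M. W (\<lambda>u. g u - k u) z = W g z - W k z"
  using W_linear[of g k 1 "-1"] by simp

lemma W_sum:
  assumes "finite I" "\<And>i. i \<in> I \<Longrightarrow> e i \<in> unit_L2"
  shows "AE z in M. W (\<lambda>u. \<Sum>i\<in>I. a i * e i u) z = (\<Sum>i\<in>I. a i * W (e i) z)"
  using assms
proof (induction I rule: finite_induct)
  case empty
  then show ?case using W_null[OF unit_L2_zero] by (simp add: L2_norm1_def set_lebesgue_integral_def)
next
  case (insert x F)
  have "AE z in M. W (\<lambda>u. a x * e x u + 1 * (\<Sum>i\<in>F. a i * e i u)) z
      = a x * W (e x) z + 1 * W (\<lambda>u. \<Sum>i\<in>F. a i * e i u) z"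
    by (rule W_linear) (use insert in \<open>auto intro!: unit_L2_sum unit_L2_scale\<close>)
  moreover have "AE z in M. W (\<lambda>u. \<Sum>i\<in>F. a i * e i u) z = (\<Sum>i\<in>F. a i * W (e i) z)"
    using insert by auto
  ultimately show ?case by eventually_elim (use insert.hyps in simp)
qed

lemma W_square:
  assumes g: "g \<in> unit_L2"
  shows "integrable M (\<lambda>z. (W g z)^2)" "(\<integral>z. (W g z)^2 \<partial>M) = ip g g"
proof -
  note [measurable] = W_measurable[OF g]
  have "integrable M (\<lambda>z. (W g z)^2) \<and> (\<integral>z. (W g z)^2 \<partial>M) = ip g g"
  proof (cases "L2_norm1 g = 0")
    case True
    then have ae: "AE z in M. (W g z)^2 = 0" using W_null[OF g True] by auto
    have "ip g g = 0" using L2_norm1_sq[of g] True by simp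
    moreover have "integrable M (\<lambda>z. (W g z)^2)"
      by (subst integrable_cong_AE[OF _ _ ae]) auto
    moreover have "(\<integral>z. (W g z)^2 \<partial>M) = 0"
      by (subst integral_cong_AE[OF _ _ ae]) auto
    ultimately show ?thesis by simp
  next
    case False
    then have pos: "0 < L2_norm1 g" using L2_norm1_nonneg[of g] by linarith
    note D = W_distributed[OF g False]
    have "integrable lborel (\<lambda>x. normal_density 0 (L2_norm1 g) x * (x - 0)^2)"
      by (rule integrable_normal_moment[OF pos])
    then have i: "integrable M (\<lambda>z. (W g z)^2)"
      by (subst distributed_integrable[OF D, symmetric]) auto
    have "variance (W g) = (L2_norm1 g)^2"
      by (rule normal_distributed_variance[OF pos D])
    then show ?thesis
      using i normal_distributed_expectation[OF pos D] by (simp add: L2_norm1_sq)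
  qed
  then show "integrable M (\<lambda>z. (W g z)^2)" "(\<integral>z. (W g z)^2 \<partial>M) = ip g g" by auto
qed

lemma W_char:
  assumes g: "g \<in> unit_L2"
  shows "(\<integral>z. iexp (t * W g z) \<partial>M) = of_real (exp (- (t^2 * ip g g) / 2))"
proof (cases "L2_norm1 g = 0")
  note [measurable] = W_measurable[OF g]
  case True
  have "ip g g = 0" using L2_norm1_sq[of g] True by simp
  moreover have "(\<integral>z. iexp (t * W g z) \<partial>M) = (\<integral>z. 1 \<partial>M)"
    using W_null[OF g True] by (intro integral_cong_AE) (auto elim!: eventually_mono)
  ultimately show ?thesis by (simp add: prob_space)
next
  note [measurable] = W_measurable[OF g]
  case False
  then have pos: "0 < L2_norm1 g" using L2_norm1_nonneg[of g] by linarith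
  let ?Z = "\<lambda>z. (W g z - 0) / L2_norm1 g"
  have D: "distributed M lborel ?Z std_normal_density"
    using W_distributed[OF g False] normal_standard_normal_convert[OF pos] by blast
  have "distr M borel ?Z = std_normal_distribution"
    using distributed_distr_eq_density[OF D] by (simp cong: distr_cong)
  then have "char (distr M borel ?Z) (t * L2_norm1 g) = exp (- ((t * L2_norm1 g)^2) / 2)"
    by (simp add: char_std_normal_distribution)
  moreover have "char (distr M borel ?Z) (t * L2_norm1 g) = (\<integral>z. iexp (t * W g z) \<partial>M)"
    unfolding char_def using pos by (subst integral_distr) auto
  ultimately show ?thesis by (simp add: power_mult_distrib L2_norm1_sq exp_of_real[symmetric])
qed

text \<open>A linear combination of the \<open>W (cas i)\<close> is almost surely the noise of a
  single function, hence Gaussian, and by orthonormality its variance is the sum of the squared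
  weights. So the joint characteristic function factors.\<close>

lemma indep_W_cas: "indep_vars (\<lambda>_. borel) (\<lambda>j. W (cas j)) I"
proof (rule indep_vars_if_char_product)
  show "W (cas i) \<in> borel_measurable M" for i by (rule W_measurable[OF cas_unit_L2])
  note [measurable] = this
  fix J :: "int set" and t :: "int \<Rightarrow> real"
  assume J: "finite J"
  have [measurable]: "W (\<lambda>u. \<Sum>i\<in>J. t i * cas i u) \<in> borel_measurable M"
    by (rule W_measurable[OF cas_sum_unit_L2])
  have "(\<integral>z. iexp (\<Sum>i\<in>J. t i * W (cas i) z) \<partial>M) = (\<integral>z. iexp (1 * W (\<lambda>u. \<Sum>i\<in>J. t i * cas i u) z) \<partial>M)"
    using W_sum[OF J, of cas t, OF cas_unit_L2] by (intro integral_cong_AE) (auto elim!: eventually_mono)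
  also have "... = of_real (exp (- (\<Sum>i\<in>J. (t i)^2) / 2))"
    unfolding W_char[OF cas_sum_unit_L2] by (simp add: ip_cas_sums J power2_eq_square)
  also have "... = of_real (\<Prod>i\<in>J. exp (- ((t i)^2 * ip (cas i) (cas i)) / 2))"
    by (simp add: exp_sum[OF J, symmetric] ip_cas sum_negf sum_divide_distrib)
  also have "... = (\<Prod>i\<in>J. \<integral>z. iexp (t i * W (cas i) z) \<partial>M)"
    by (simp only: W_char[OF cas_unit_L2] of_real_prod)
  finally show "(\<integral>z. iexp (\<Sum>i\<in>J. t i * W (cas i) z) \<partial>M) = (\<Prod>i\<in>J. \<integral>z. iexp (t i * W (cas i) z) \<partial>M)" .
qed

lemma distr_W_cas: "distr M borel (W (cas j)) = std_normal_distribution"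
proof -
  have n: "L2_norm1 (cas j) = 1"
    using L2_norm1_sq[of "cas j"] L2_norm1_nonneg[of "cas j"] by (simp add: ip_cas power2_eq_1_iff)
  have D: "distributed M lborel (W (cas j)) std_normal_density"
    using W_distributed[OF cas_unit_L2, of j] n by simp
  show ?thesis using distributed_distr_eq_density[OF D] by (simp cong: distr_cong)
qed

end

section \<open>Anti-concentration of Gaussian quadratic forms\<close>

lemma std_normal_density_mult_shift:
  "std_normal_density y * std_normal_density (y + w) = exp (- (y + w / 2)\<^sup>2) * exp (- w\<^sup>2 / 4) / (2 * pi)"
proof -
  have "- y\<^sup>2 / 2 + - (y + w)\<^sup>2 / 2 = - (y + w / 2)\<^sup>2 + - w\<^sup>2 / 4"
    by (simp add: power2_eq_square field_simps)
  then show ?thesis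
    by (simp add: std_normal_density_def mult_exp_exp power2_eq_square[symmetric])
qed

lemma std_normal_char_lborel:
  "(LBINT x. std_normal_density x * iexp (t * x)) = complex_of_real (exp (- t\<^sup>2 / 2))"
proof -
  have "char std_normal_distribution t = (LBINT x. std_normal_density x *\<^sub>R iexp (t * x))"
    unfolding char_def by (subst integral_density) auto
  then show ?thesis by (simp add: char_std_normal_distribution scaleR_conv_of_real)
qed

text \<open>The square of the modulus is a double integral in \<open>y\<close> and \<open>w = x - y\<close>; integrating out \<open>y\<close> first
  leaves a Gaussian integral in \<open>w\<close>.\<close>

lemma norm_std_normal_quadratic:
  "(cmod (LBINT x. std_normal_density x * iexp (\<tau> * (m + x)^2)))^2 \<le> (1 + 4 * \<tau>^2) powr (- 1 / 2)"
proof -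
  let ?H = "\<lambda>w. exp (- w\<^sup>2 / 4) / (2 * sqrt pi) * iexp (2 * \<tau> * w * m) * exp (- (\<tau> * w)\<^sup>2)"
  let ?n = "std_normal_density"
  define \<phi> where "\<phi> = (LBINT x. ?n x * iexp (\<tau> * (m + x)^2))"
  define F where "F = (\<lambda>y w. complex_of_real (?n y * ?n (y + w)) * iexp (\<tau> * w * (2 * m + 2 * y + w)))"
  have meas_pair [measurable]: "(\<lambda>(y, w). F y w) \<in> borel_measurable (lborel \<Otimes>\<^sub>M lborel)"
    unfolding F_def by measurable
  have nF: "norm (F y w) = ?n y * ?n (y + w)" for y w
    by (simp add: F_def norm_mult)
  have shift: "(LBINT w. f (y + w)) = (LBINT x. f x)" for f :: "real \<Rightarrow> complex" and y
    using lborel_integral_real_affine[of 1 f y] by simp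
  have shiftr: "(LBINT w. f (y + w)) = (LBINT x. f x)" for f :: "real \<Rightarrow> real" and y
    using lborel_integral_real_affine[of 1 f y] by simp
  have int_shift: "integrable lborel (\<lambda>w. ?n (y + w))" for y
    using lborel_integrable_real_affine[of ?n 1 y] by simp
  have intF: "complex_integrable lborel (\<lambda>w. F y w)" for y
  proof (rule Bochner_Integration.integrable_bound[of _ "\<lambda>w. ?n y * ?n (y + w)"])
    show "AE w in lborel. norm (F y w) \<le> norm (?n y * ?n (y + w))"
      unfolding nF by simp
  qed (use int_shift in \<open>auto simp: F_def\<close>)
  have "complex_integrable (lborel \<Otimes>\<^sub>M lborel) (\<lambda>(y, w). F y w)"
  proof (rule lborel_pair.Fubini_integrable)
    have "(LBINT w. norm (F y w)) = ?n y" for y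
      unfolding nF by (simp add: shiftr)
    then show "integrable lborel (\<lambda>y. LBINT w. norm (case (y, w) of (y, w) \<Rightarrow> F y w))" by simp
  qed (use intF in auto)
  then have swap: "(LBINT y. LBINT w. F y w) = (LBINT w. LBINT y. F y w)"
    by (rule lborel_pair.Fubini_integral[symmetric])
  have inner_w: "(LBINT w. F y w) = cnj (?n y * iexp (\<tau> * (m + y)^2)) * \<phi>" for y
  proof -
    have "F y w = cnj (?n y * iexp (\<tau> * (m + y)^2)) * (?n (y + w) * iexp (\<tau> * (m + (y + w))^2))" for w
    proof -
      have "\<tau> * w * (2 * m + 2 * y + w) = - (\<tau> * (m + y)^2) + \<tau> * (m + (y + w))^2"
        by (simp add: power2_eq_square algebra_simps)
      then have "iexp (\<tau> * w * (2 * m + 2 * y + w)) = iexp (- (\<tau> * (m + y)^2)) * iexp (\<tau> * (m + (y + w))^2)"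
        by (simp only: of_real_add distrib_left exp_add)
      then show ?thesis by (simp add: F_def exp_cnj)
    qed
    then have "(LBINT w. F y w) = cnj (?n y * iexp (\<tau> * (m + y)^2)) * (LBINT w. ?n (y + w) * iexp (\<tau> * (m + (y + w))^2))"
      by (simp only: integral_mult_right_zero)
    also have "(LBINT w. ?n (y + w) * iexp (\<tau> * (m + (y + w))^2)) = \<phi>"
      unfolding \<phi>_def by (rule shift)
    finally show ?thesis .
  qed
  have inner_y: "(LBINT y. F y w) = ?H w" for w
  proof -
    \<comment> \<open>The substitution recentres \<open>y\<close> at \<open>- w / 2\<close> and
      rescales it, so that the product of the two densities becomes a multiple of the standard
      normal density in \<open>z\<close>; what remains is a normal characteristic function.\<close>
    have "(LBINT y. F y w) = (1 / sqrt 2) *\<^sub>R (LBINT z. F (- w / 2 + 1 / sqrt 2 * z) w)"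
      using lborel_integral_real_affine[of "1 / sqrt 2" "\<lambda>y. F y w" "- w / 2"] by simp
    also have "(\<lambda>z. F (- w / 2 + 1 / sqrt 2 * z) w)
       = (\<lambda>z. complex_of_real (exp (- w\<^sup>2 / 4) / sqrt (2 * pi)) * iexp (2 * \<tau> * w * m) * (?n z * iexp ((sqrt 2 * \<tau> * w) * z)))"
    proof
      fix z
      have "\<tau> * w * (2 * m + 2 * (- w / 2 + 1 / sqrt 2 * z) + w) = 2 * \<tau> * w * m + (sqrt 2 * \<tau> * w) * z"
        by (simp add: field_simps) (simp add: real_sqrt_mult_self flip: mult.assoc)?
      then have 1: "iexp (\<tau> * w * (2 * m + 2 * (- w / 2 + 1 / sqrt 2 * z) + w)) = iexp (2 * \<tau> * w * m) * iexp ((sqrt 2 * \<tau> * w) * z)"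
        by (simp only: of_real_add distrib_left exp_add)
      have "(- w / 2 + 1 / sqrt 2 * z + w / 2)^2 = z^2 / 2"
        by (simp add: power_divide)
      then have "?n (- w / 2 + 1 / sqrt 2 * z) * ?n (- w / 2 + 1 / sqrt 2 * z + w) = exp (- w\<^sup>2 / 4) / sqrt (2 * pi) * ?n z"
        unfolding std_normal_density_mult_shift by (simp add: std_normal_density_def)
      then show "F (- w / 2 + 1 / sqrt 2 * z) w = complex_of_real (exp (- w\<^sup>2 / 4) / sqrt (2 * pi)) * iexp (2 * \<tau> * w * m) * (?n z * iexp ((sqrt 2 * \<tau> * w) * z))"
        unfolding F_def 1 by (simp only: of_real_mult mult_ac)
    qed
    also have "(LBINT z. complex_of_real (exp (- w\<^sup>2 / 4) / sqrt (2 * pi)) * iexp (2 * \<tau> * w * m) * (?n z * iexp ((sqrt 2 * \<tau> * w) * z)))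
       = complex_of_real (exp (- w\<^sup>2 / 4) / sqrt (2 * pi)) * iexp (2 * \<tau> * w * m) * complex_of_real (exp (- ((sqrt 2 * \<tau> * w)\<^sup>2 / 2)))"
      unfolding integral_mult_right_zero std_normal_char_lborel minus_divide_left ..
    also have "(sqrt 2 * \<tau> * w)^2 / 2 = (\<tau> * w)^2" by (simp add: power_mult_distrib)
    finally have "(LBINT y. F y w) = complex_of_real (1 / sqrt 2 * (1 / sqrt (2 * pi))) * (complex_of_real (exp (- w\<^sup>2 / 4)) * iexp (2 * \<tau> * w * m) * complex_of_real (exp (- (\<tau> * w)\<^sup>2)))"
      by (simp add: scaleR_conv_of_real)
    also have "1 / sqrt 2 * (1 / sqrt (2 * pi)) = 1 / (2 * sqrt pi)"
      by (simp add: real_sqrt_mult)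
    finally show ?thesis by simp
  qed
  have "complex_of_real ((cmod \<phi>)^2) = cnj \<phi> * \<phi>"
    by (subst complex_norm_square) (rule mult.commute)
  also have "cnj \<phi> * \<phi> = (LBINT y. cnj (?n y * iexp (\<tau> * (m + y)^2))) * \<phi>"
    unfolding \<phi>_def by (simp only: Bochner_Integration.integral_cnj)
  also have "... = (LBINT y. LBINT w. F y w)"
    unfolding inner_w by (rule integral_mult_left_zero[symmetric])
  also have "... = (LBINT w. ?H w)"
    unfolding swap inner_y ..
  finally have eq: "complex_of_real ((cmod \<phi>)\<^sup>2) = (LBINT w. ?H w)" .
  \<comment> \<open>The deviation for which \<open>exp (- w^2 / 4 - (\<tau> * w)^2)\<close> is a
    Gaussian in \<open>w\<close>; integrating it leaves \<open>s / sqrt 2\<close>, which is the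
    asserted bound.\<close>
  define s where "s = sqrt (2 / (1 + 4 * \<tau>^2))"
  have p: "0 < 1 + 4 * \<tau>^2" by (simp add: add_pos_nonneg)
  have s: "0 < s" "s^2 = 2 / (1 + 4 * \<tau>^2)" using p by (auto simp: s_def)
  have "(cmod \<phi>)^2 = cmod (complex_of_real ((cmod \<phi>)^2))" by (simp add: norm_power)
  also have "... \<le> (LBINT w. norm (?H w))"
    unfolding eq by (rule integral_norm_bound)
  also have "... = (LBINT w. s / sqrt 2 * normal_density 0 s w)"
  proof (rule Bochner_Integration.integral_cong[OF refl])
    fix w
    have "norm (?H w)
        = exp (- w\<^sup>2 / 4) / (2 * sqrt pi) * exp (- (\<tau> * w)\<^sup>2)"
      by (simp add: norm_mult norm_divide)
    also have "... = exp (- w\<^sup>2 / 4 + - (\<tau> * w)\<^sup>2) / (2 * sqrt pi)"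
      by (simp add: exp_add[symmetric])
    also have "- w\<^sup>2 / 4 + - (\<tau> * w)\<^sup>2 = - (w - 0)\<^sup>2 / (2 * s\<^sup>2)"
      using p unfolding s(2) by (simp add: power_mult_distrib field_simps)
    also have "exp (- (w - 0)\<^sup>2 / (2 * s\<^sup>2)) / (2 * sqrt pi) = s / sqrt 2 * normal_density 0 s w"
      using s(1) by (simp add: normal_density_def real_sqrt_mult field_simps)
    finally show "norm (?H w) = s / sqrt 2 * normal_density 0 s w" .
  qed
  also have "... = s / sqrt 2" using s(1) by simp
  also have "... = (1 + 4 * \<tau>^2) powr (- 1 / 2)"
    using p by (simp add: s_def real_sqrt_divide powr_minus_divide powr_half_sqrt)
  finally show ?thesis unfolding \<phi>_def .
qed

lemma one_plus_sum_le_prod: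
  fixes x :: "'i \<Rightarrow> real"
  assumes "\<And>i. i \<in> I \<Longrightarrow> 0 \<le> x i"
  shows "1 + (\<Sum>i\<in>I. x i) \<le> (\<Prod>i\<in>I. 1 + x i)"
  using assms
proof (induction I rule: infinite_finite_induct)
  case (insert k I)
  have "1 + (\<Sum>i\<in>insert k I. x i) \<le> (1 + x k) * (1 + (\<Sum>i\<in>I. x i))"
    using insert by (simp add: algebra_simps sum_nonneg)
  also have "... \<le> (1 + x k) * (\<Prod>i\<in>I. 1 + x i)"
    using insert by (intro mult_left_mono) (auto simp: add_nonneg_nonneg)
  finally show ?case using insert by simp
qed auto

section \<open>Small-ball probabilities of weighted sums of shifted normal squares\<close>

context prob_space
begin

text \<open>Each factor is bounded without reference to its shift \<open>m j\<close>, and the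
  product is bounded below by its first-order expansion, so only the sum of squared weights
  survives. That the shifts drop out is what makes all later estimates uniform in the
  signal.\<close>

lemma char_quadratic_form_le:
  fixes \<xi> :: "'i \<Rightarrow> 'a \<Rightarrow> real"
  assumes fin: "finite J" and ind: "indep_vars (\<lambda>_. borel) \<xi> J"
    and dist: "\<And>j. j \<in> J \<Longrightarrow> distr M borel (\<xi> j) = std_normal_distribution"
  shows "cmod (\<integral>z. iexp (t * (\<Sum>j\<in>J. c j * (m j + \<xi> j z)^2)) \<partial>M) \<le> (1 + 4 * t^2 * (\<Sum>j\<in>J. (c j)^2)) powr (- 1 / 4)"
proof -
  have [measurable]: "\<xi> j \<in> borel_measurable M" if "j \<in> J" for j
    using ind that by (auto simp: indep_vars_def2)
  define X where "X = (\<lambda>j z. c j * (m j + \<xi> j z)^2)"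
  have X [measurable]: "X j \<in> borel_measurable M" if "j \<in> J" for j
    using that unfolding X_def by measurable
  have indX: "indep_vars (\<lambda>_. borel) X J"
    unfolding X_def by (rule indep_vars_compose2[OF ind, of "\<lambda>j x. c j * (m j + x)^2"]) auto
  have one: "cmod (char (distr M borel (X j)) t) \<le> (1 + 4 * t^2 * (c j)^2) powr (- 1 / 4)" if j: "j \<in> J" for j
  proof -
    have "char (distr M borel (X j)) t = (\<integral>z. iexp (t * X j z) \<partial>M)"
      unfolding char_def using X[OF j] by (subst integral_distr) auto
    also have "... = (\<integral>x. iexp (t * (c j * (m j + x)^2)) \<partial>distr M borel (\<xi> j))"
      unfolding X_def using j by (subst integral_distr) auto
    also have "... = (LBINT x. std_normal_density x *\<^sub>R iexp (t * (c j * (m j + x)^2)))"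
      unfolding dist[OF j] by (subst integral_density) auto
    also have "... = (LBINT x. std_normal_density x * iexp (t * c j * (m j + x)^2))"
      by (simp add: scaleR_conv_of_real mult.assoc)
    finally have "(cmod (char (distr M borel (X j)) t))^2 \<le> (1 + 4 * (t * c j)^2) powr (- 1 / 2)"
      using norm_std_normal_quadratic[of "t * c j" "m j"] by simp
    also have "... = ((1 + 4 * t^2 * (c j)^2) powr (- 1 / 4))^2"
      by (simp add: power2_eq_square powr_add[symmetric] mult_ac)
    finally show ?thesis by (rule power2_le_imp_le) simp
  qed
  have "(\<integral>z. iexp (t * (\<Sum>j\<in>J. c j * (m j + \<xi> j z)^2)) \<partial>M) = char (distr M borel (\<lambda>z. \<Sum>j\<in>J. X j z)) t"
    unfolding char_def by (subst integral_distr) (auto simp: X_def)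
  also have "... = (\<Prod>j\<in>J. char (distr M borel (X j)) t)"
    by (rule char_distr_sum[OF indX])
  finally have "cmod (\<integral>z. iexp (t * (\<Sum>j\<in>J. c j * (m j + \<xi> j z)^2)) \<partial>M) = (\<Prod>j\<in>J. cmod (char (distr M borel (X j)) t))"
    by (simp add: prod_norm)
  also have "... \<le> (\<Prod>j\<in>J. (1 + 4 * t^2 * (c j)^2) powr (- 1 / 4))"
    by (intro prod_mono conjI one norm_ge_zero)
  also have "... = (\<Prod>j\<in>J. 1 + 4 * t^2 * (c j)^2) powr (- 1 / 4)"
    by (rule prod_powr_distrib[symmetric])
  also have "... \<le> (1 + (\<Sum>j\<in>J. 4 * t^2 * (c j)^2)) powr (- 1 / 4)"
    by (intro powr_mono2' one_plus_sum_le_prod) (auto intro!: add_pos_nonneg sum_nonneg)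
  finally show ?thesis by (simp add: sum_distrib_left)
qed

text \<open>Gaussian smoothing: the indicator is dominated by a multiple of \<open>exp (- ((X - x) / \<delta>)\<^sup>2 / 2)\<close>, the
  average of \<open>exp (i\<eta> (X - x) / \<delta>)\<close> over a standard normal \<open>\<eta>\<close>.\<close>

lemma concentration_le_char:
  fixes X :: "'a \<Rightarrow> real"
  assumes [measurable]: "X \<in> borel_measurable M" "\<psi> \<in> borel_measurable borel"
    and "0 < \<delta>" and \<psi>: "\<And>t. cmod (\<integral>z. iexp (t * X z) \<partial>M) \<le> \<psi> t" "\<And>t. \<psi> t \<le> 1"
  shows "prob {z \<in> space M. \<bar>X z - x\<bar> \<le> \<delta>} \<le> exp (1 / 2) * (\<integral>\<eta>. \<psi> (\<eta> / \<delta>) \<partial>std_normal_distribution)"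
proof -
  let ?N = "std_normal_distribution"
  interpret N: real_distribution ?N by (rule real_dist_normal_dist)
  interpret MN: pair_prob_space M ?N ..
  define G where "G = (\<lambda>z \<eta>. iexp (\<eta> * ((X z - x) / \<delta>)))"
  have [measurable]: "(\<lambda>(z, \<eta>). G z \<eta>) \<in> borel_measurable (M \<Otimes>\<^sub>M ?N)" unfolding G_def by measurable
  have "complex_integrable (M \<Otimes>\<^sub>M ?N) (\<lambda>(z, \<eta>). G z \<eta>)"
    by (rule MN.P.integrable_const_bound[of _ 1]) (auto simp: G_def)
  then have swap: "(\<integral>\<eta>. \<integral>z. G z \<eta> \<partial>M \<partial>?N) = (\<integral>z. \<integral>\<eta>. G z \<eta> \<partial>?N \<partial>M)"
    by (rule MN.Fubini_integral)
  have \<psi>0: "0 \<le> \<psi> t" for t using \<psi>(1)[of t] norm_ge_zero order_trans by blast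
  have Gchar: "(\<integral>\<eta>. G z \<eta> \<partial>?N) = complex_of_real (exp (- ((X z - x) / \<delta>)\<^sup>2 / 2))" for z
  proof -
    have "(\<integral>\<eta>. G z \<eta> \<partial>?N) = char ?N ((X z - x) / \<delta>)"
      unfolding char_def G_def by (simp add: mult.commute)
    then show ?thesis by (simp add: char_std_normal_distribution)
  qed
  have Gx: "cmod (\<integral>z. G z \<eta> \<partial>M) \<le> \<psi> (\<eta> / \<delta>)" for \<eta>
  proof -
    have "G z \<eta> = iexp (- (\<eta> / \<delta> * x)) * iexp (\<eta> / \<delta> * X z)" for z
    proof -
      have "\<eta> * ((X z - x) / \<delta>) = - (\<eta> / \<delta> * x) + \<eta> / \<delta> * X z" using \<open>0 < \<delta>\<close> by (simp add: field_simps)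
      then show ?thesis unfolding G_def by (simp only: of_real_add distrib_left exp_add)
    qed
    then have "(\<integral>z. G z \<eta> \<partial>M) = iexp (- (\<eta> / \<delta> * x)) * (\<integral>z. iexp (\<eta> / \<delta> * X z) \<partial>M)"
      by (simp only: integral_mult_right_zero)
    then have "cmod (\<integral>z. G z \<eta> \<partial>M) = cmod (\<integral>z. iexp (\<eta> / \<delta> * X z) \<partial>M)"
      by (simp add: norm_mult)
    then show ?thesis using \<psi>(1)[of "\<eta> / \<delta>"] by (rule ord_eq_le_trans)
  qed
  define e where "e = (\<lambda>z. exp (- ((X z - x) / \<delta>)\<^sup>2 / 2))"
  have [measurable]: "e \<in> borel_measurable M" unfolding e_def by measurable
  have ie: "integrable M e"
    by (rule integrable_const_bound[of _ 1]) (auto simp: e_def)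
  have "(\<integral>z. e z \<partial>M) = cmod (complex_of_real (\<integral>z. e z \<partial>M))"
    by (simp add: e_def)
  also have "complex_of_real (\<integral>z. e z \<partial>M) = (\<integral>z. \<integral>\<eta>. G z \<eta> \<partial>?N \<partial>M)"
    unfolding Gchar e_def by simp
  also have "... = (\<integral>\<eta>. \<integral>z. G z \<eta> \<partial>M \<partial>?N)" by (rule swap[symmetric])
  also have "cmod ... \<le> (\<integral>\<eta>. cmod (\<integral>z. G z \<eta> \<partial>M) \<partial>?N)" by (rule integral_norm_bound)
  also have "... \<le> (\<integral>\<eta>. \<psi> (\<eta> / \<delta>) \<partial>?N)"
  proof (rule integral_mono)
    show "integrable ?N (\<lambda>\<eta>. \<psi> (\<eta> / \<delta>))"
      by (rule N.integrable_const_bound[of _ 1]) (auto simp: \<psi>0 \<psi>(2))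
    show "integrable ?N (\<lambda>\<eta>. cmod (\<integral>z. G z \<eta> \<partial>M))"
      by (rule N.integrable_const_bound[of _ 1]) (auto intro: order_trans[OF Gx \<psi>(2)])
  qed (rule Gx)
  finally have E: "(\<integral>z. e z \<partial>M) \<le> (\<integral>\<eta>. \<psi> (\<eta> / \<delta>) \<partial>?N)" .
  have "prob {z \<in> space M. \<bar>X z - x\<bar> \<le> \<delta>} = (\<integral>z. indicator {z \<in> space M. \<bar>X z - x\<bar> \<le> \<delta>} z \<partial>M)"
    by (simp add: Int_absorb2)
  \<comment> \<open>Where \<open>\<bar>X z - x\<bar> \<le> \<delta>\<close> the Gaussian weight is
    at least \<open>exp (- 1 / 2)\<close>, whence the factor.\<close>
  also have "... \<le> (\<integral>z. exp (1 / 2) * e z \<partial>M)"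
  proof (rule integral_mono)
    fix z assume "z \<in> space M"
    show "indicator {z \<in> space M. \<bar>X z - x\<bar> \<le> \<delta>} z \<le> exp (1 / 2) * e z"
    proof (cases "\<bar>X z - x\<bar> \<le> \<delta>")
      case True
      then have "\<bar>(X z - x) / \<delta>\<bar> \<le> 1" using \<open>0 < \<delta>\<close> by (simp add: abs_divide)
      then have "((X z - x) / \<delta>)^2 \<le> 1" using abs_square_le_1 by blast
      then have "1 \<le> exp (1 / 2 + - ((X z - x) / \<delta>)\<^sup>2 / 2)" by simp
      then show ?thesis unfolding e_def exp_add by (simp add: indicator_def)
    qed (simp add: e_def)
  qed (use ie in \<open>auto simp: integrable_real_indicator emeasure_eq_measure\<close>)
  also have "... = exp (1 / 2) * (\<integral>z. e z \<partial>M)" by simp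
  also have "... \<le> exp (1 / 2) * (\<integral>\<eta>. \<psi> (\<eta> / \<delta>) \<partial>?N)"
    using E by (intro mult_left_mono) auto
  finally show ?thesis .
qed

end

text \<open>\<open>Suc k\<close> stands for \<open>1 / \<delta>\<close> in the concentration bound.
  The integrand never exceeds 1 and tends to 0 except at \<open>\<eta> = 0\<close>, a null
  set.\<close>

lemma smoothing_bound_tendsto_0:
  assumes "0 < b"
  shows "(\<lambda>k. \<integral>\<eta>. (1 + b * (\<eta> * real (Suc k))^2) powr (- 1 / 4) \<partial>std_normal_distribution) \<longlonglongrightarrow> 0"
proof -
  let ?N = "std_normal_distribution"
  interpret N: real_distribution ?N by (rule real_dist_normal_dist)
  have "AE \<eta> in ?N. \<eta> \<noteq> 0"
  proof -
    have "AE \<eta> in lborel. \<eta> \<noteq> (0::real)" by (rule AE_lborel_singleton)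
    then show ?thesis by (subst AE_density) auto
  qed
  then have lim: "AE \<eta> in ?N. (\<lambda>k. (1 + b * (\<eta> * real (Suc k))^2) powr (- 1 / 4)) \<longlonglongrightarrow> 0"
  proof eventually_elim
    case (elim \<eta>)
    have "filterlim (\<lambda>k. 1 + b * \<eta>^2 * (real (Suc k))^2) at_top sequentially"
      using assms elim
      by (intro filterlim_tendsto_add_at_top[OF tendsto_const] filterlim_tendsto_pos_mult_at_top[OF tendsto_const]
          filterlim_pow_at_top filterlim_compose[OF filterlim_real_sequentially filterlim_Suc]) auto
    then have "(\<lambda>k. (1 + b * \<eta>^2 * (real (Suc k))^2) powr (- 1 / 4)) \<longlonglongrightarrow> 0"
      by (intro tendsto_neg_powr) auto
    then show ?case by (simp add: power_mult_distrib mult.assoc)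
  qed
  have "(\<lambda>k. \<integral>\<eta>. (1 + b * (\<eta> * real (Suc k))^2) powr (- 1 / 4) \<partial>?N) \<longlonglongrightarrow> (\<integral>\<eta>. 0 \<partial>?N)"
  proof (rule integral_dominated_convergence[where w="\<lambda>_. 1"])
    fix k
    have "(1 + b * (\<eta> * real (Suc k))^2) powr (- 1 / 4) \<le> 1 powr (- 1 / 4)" for \<eta>
      using assms by (intro powr_mono2') auto
    then show "AE \<eta> in ?N. norm ((1 + b * (\<eta> * real (Suc k))^2) powr (- 1 / 4)) \<le> 1" by simp
  qed (use lim in auto)
  then show ?thesis by simp
qed

text \<open>\<delta> is fixed before the index set, the weights, the shifts and the level
  \<open>x\<close>. This is possible because the characteristic function bound decreases in the sum
  of squared weights, so the value \<open>b\<close> is its worst case.\<close>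

lemma (in prob_space) quadratic_form_anti_concentration:
  assumes "0 < b" "0 < \<epsilon>"
  obtains \<delta> where "0 < \<delta>"
    "\<And>J (\<xi> :: 'i \<Rightarrow> 'a \<Rightarrow> real) c m x. finite J \<Longrightarrow> indep_vars (\<lambda>_. borel) \<xi> J \<Longrightarrow>
       (\<And>j. j \<in> J \<Longrightarrow> distr M borel (\<xi> j) = std_normal_distribution) \<Longrightarrow> b \<le> (\<Sum>j\<in>J. (c j)^2) \<Longrightarrow>
       prob {z \<in> space M. \<bar>(\<Sum>j\<in>J. c j * (m j + \<xi> j z)^2) - x\<bar> \<le> \<delta>} \<le> \<epsilon>"
proof -
  have "(\<lambda>k. exp (1 / 2) * (\<integral>\<eta>. (1 + (4 * b) * (\<eta> * real (Suc k))^2) powr (- 1 / 4) \<partial>std_normal_distribution)) \<longlonglongrightarrow> exp (1 / 2) * 0"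
    using assms by (intro tendsto_mult smoothing_bound_tendsto_0 tendsto_const) auto
  then have "\<forall>\<^sub>F k in sequentially. exp (1 / 2) * (\<integral>\<eta>. (1 + (4 * b) * (\<eta> * real (Suc k))^2) powr (- 1 / 4) \<partial>std_normal_distribution) < \<epsilon>"
    using assms by (intro order_tendstoD) auto
  then obtain k where k: "exp (1 / 2) * (\<integral>\<eta>. (1 + (4 * b) * (\<eta> * real (Suc k))^2) powr (- 1 / 4) \<partial>std_normal_distribution) < \<epsilon>"
    by (auto simp: eventually_sequentially)
  define \<delta> where "\<delta> = 1 / real (Suc k)"
  show ?thesis
  proof
    show "0 < \<delta>" by (simp add: \<delta>_def)
    fix J and \<xi> :: "'i \<Rightarrow> 'a \<Rightarrow> real" and c m x
    assume J: "finite J" and ind: "indep_vars (\<lambda>_. borel) \<xi> J"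
      and dist: "\<And>j. j \<in> J \<Longrightarrow> distr M borel (\<xi> j) = std_normal_distribution" and b: "b \<le> (\<Sum>j\<in>J. (c j)^2)"
    have [measurable]: "\<xi> j \<in> borel_measurable M" if "j \<in> J" for j
      using ind that by (auto simp: indep_vars_def2)
    have "prob {z \<in> space M. \<bar>(\<Sum>j\<in>J. c j * (m j + \<xi> j z)^2) - x\<bar> \<le> \<delta>}
        \<le> exp (1 / 2) * (\<integral>\<eta>. (1 + 4 * (\<eta> / \<delta>)^2 * b) powr (- 1 / 4) \<partial>std_normal_distribution)"
    proof (rule concentration_le_char)
      fix t
      have "cmod (\<integral>z. iexp (t * (\<Sum>j\<in>J. c j * (m j + \<xi> j z)^2)) \<partial>M) \<le> (1 + 4 * t^2 * (\<Sum>j\<in>J. (c j)^2)) powr (- 1 / 4)"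
        by (rule char_quadratic_form_le[OF J ind dist])
      also have "... \<le> (1 + 4 * t^2 * b) powr (- 1 / 4)"
        using b \<open>0 < b\<close> by (intro powr_mono2') (auto intro!: add_pos_nonneg mult_left_mono)
      finally show "cmod (\<integral>z. iexp (t * (\<Sum>j\<in>J. c j * (m j + \<xi> j z)^2)) \<partial>M) \<le> (1 + 4 * t^2 * b) powr (- 1 / 4)" .
      have "(1 + 4 * t^2 * b) powr (- 1 / 4) \<le> 1 powr (- 1 / 4)"
        using \<open>0 < b\<close> by (intro powr_mono2') auto
      then show "(1 + 4 * t^2 * b) powr (- 1 / 4) \<le> 1" by simp
    qed (auto simp: \<delta>_def)
    also have "... < \<epsilon>" using k by (simp add: \<delta>_def mult_ac)
    finally show "prob {z \<in> space M. \<bar>(\<Sum>j\<in>J. c j * (m j + \<xi> j z)^2) - x\<bar> \<le> \<delta>} \<le> \<epsilon>" by simp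
  qed
qed

section \<open>Periodized kernels\<close>

lemma periodize_add_int: "periodize G (u + of_int k) = periodize G u"
proof -
  have "bij (\<lambda>i. i + k)" by (rule bij_plus_right)
  then have "(\<Sum>\<^sub>\<infinity>i\<in>UNIV. G (u + of_int (i + k))) = (\<Sum>\<^sub>\<infinity>i\<in>(UNIV::int set). G (u + of_int i))"
    using infsum_reindex_bij_betw[of "\<lambda>i. i + k" UNIV UNIV "\<lambda>i. G (u + of_int i)"] by simp
  then show ?thesis by (simp add: periodize_def add_ac)
qed

lemma periodize_mult_periodic:
  assumes "\<And>u k. q (u + of_int k) = q u"
  shows "periodize (\<lambda>u. G u * q u) u = periodize G u * q u"
  unfolding periodize_def assms by (rule infsum_cmult_left')

locale bounded_support =
  fixes G :: "real \<Rightarrow> real" and m :: nat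
  assumes support: "\<And>u. real m < \<bar>u\<bar> \<Longrightarrow> G u = 0"
begin

lemma periodize_eq_sum:
  assumes "u \<in> {0..<1}"
  shows "periodize G u = (\<Sum>k\<in>{- int m - 1..int m}. G (u + of_int k))"
proof -
  have "periodize G u = (\<Sum>\<^sub>\<infinity>k\<in>{- int m - 1..int m}. G (u + of_int k))"
    unfolding periodize_def
  proof (rule infsum_cong_neutral)
    fix k assume "k \<in> UNIV - {- int m - 1..int m}"
    then consider "k < - int m - 1" | "int m < k" by fastforce
    then have "real m < \<bar>u + of_int k\<bar>" using assms by cases auto
    then show "G (u + of_int k) = 0" by (rule support)
  qed auto
  then show ?thesis by simp
qed

lemma periodize_frac: "periodize G u = (\<Sum>k\<in>{- int m - 1..int m}. G (frac u + of_int k))"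
proof -
  have "periodize G u = periodize G (frac u)"
    using periodize_add_int[of G "frac u" "\<lfloor>u\<rfloor>"] by (simp add: frac_def)
  also have "... = (\<Sum>k\<in>{- int m - 1..int m}. G (frac u + of_int k))"
    by (rule periodize_eq_sum) (simp add: frac_lt_1)
  finally show ?thesis .
qed

lemma periodize_measurable:
  assumes [measurable]: "G \<in> borel_measurable borel"
  shows "periodize G \<in> borel_measurable borel"
proof -
  have [measurable]: "(\<lambda>u::real. frac u) \<in> borel_measurable borel"
    unfolding frac_def by measurable
  have "(\<lambda>u. \<Sum>k\<in>{- int m - 1..int m}. G (frac u + of_int k)) \<in> borel_measurable borel"
    by measurable
  then show ?thesis by (simp add: periodize_frac[symmetric])
qed

lemma periodize_bound:
  assumes "\<And>u. \<bar>G u\<bar> \<le> B"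
  shows "\<bar>periodize G u\<bar> \<le> of_nat (card {- int m - 1..int m}) * B"
  unfolding periodize_frac
  by (intro order_trans[OF sum_abs] sum_bounded_above assms)

lemma integral_periodize:
  assumes [measurable]: "G \<in> borel_measurable borel" and B: "\<And>u. \<bar>G u\<bar> \<le> B"
  shows "(LBINT u:{0..<1}. periodize G u) = (LBINT u. G u)"
proof -
  let ?I = "\<lambda>k. indicator {real_of_int k..<of_int k + 1} :: real \<Rightarrow> real"
  let ?L = "{- int m - 1..int m}"
  have i1: "set_integrable lborel {0..<1} (\<lambda>u. G (u + of_int k))" for k :: int
    by (rule set_integrable_bounded[of _ B]) (auto simp: B)
  have shift: "(LBINT u:{0..<1}. G (u + of_int k)) = (LBINT v. ?I k v * G v)" for k :: int
  proof -
    have "(LBINT v. ?I k v * G v)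
       = (LBINT u. ?I k (of_int k + 1 * u) * G (of_int k + 1 * u))"
      using lborel_integral_real_affine[of 1 "\<lambda>v. ?I k v * G v" "of_int k"] by simp
    also have "... = (LBINT u:{0..<1}. G (u + of_int k))"
      unfolding set_lebesgue_integral_def
      by (intro Bochner_Integration.integral_cong) (auto simp: indicator_def add.commute)
    finally show ?thesis by simp
  qed
  have i2: "integrable lborel (\<lambda>v. ?I k v * G v)" for k :: int
  proof -
    have "integrable lborel (\<lambda>v::real. ?I k v * B)"
      by (intro integrable_mult_left integrable_real_indicator) auto
    then show ?thesis
      by (rule Bochner_Integration.integrable_bound)
        (use B in \<open>auto simp: indicator_def intro: order_trans[OF B abs_ge_self]\<close>)
  qed
  have cover: "(\<Sum>k\<in>?L. ?I k v * G v) = G v" for v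
  proof (cases "G v = 0")
    case False
    then have "\<bar>v\<bar> \<le> real m" using support[of v] by force
    then have mem: "\<lfloor>v\<rfloor> \<in> ?L" by (auto simp: le_floor_iff floor_le_iff)
    have "?I k v * G v = (if k = \<lfloor>v\<rfloor> then G v else 0)" for k
      using floor_eq_iff[of v k] by (auto simp: indicator_def)
    then show ?thesis using mem by simp
  qed simp
  have "(LBINT u:{0..<1}. periodize G u) = (LBINT u:{0..<1}. \<Sum>k\<in>?L. G (u + of_int k))"
    by (intro set_lebesgue_integral_cong) (auto simp: periodize_eq_sum)
  also have "... = (\<Sum>k\<in>?L. LBINT u:{0..<1}. G (u + of_int k))"
    using i1 unfolding set_lebesgue_integral_def set_integrable_def scaleR_sum_right
    by (intro Bochner_Integration.integral_sum) auto
  also have "... = (LBINT v. \<Sum>k\<in>?L. ?I k v * G v)"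
    unfolding shift by (rule Bochner_Integration.integral_sum[symmetric]) (rule i2)
  finally show ?thesis unfolding cover .
qed

end

text \<open>A 1-periodic factor passes under the periodization, after which integration over the
  circle unfolds to integration over the line.\<close>

lemma integral_periodize_mult:
  assumes G: "bounded_support G m" "G \<in> borel_measurable borel" "\<And>u. \<bar>G u\<bar> \<le> B"
    and q: "q \<in> borel_measurable borel" "\<And>u. \<bar>q u\<bar> \<le> C" "\<And>u k. q (u + of_int k) = q u"
  shows "ip (periodize G) q = (LBINT u. G u * q u)"
proof -
  interpret bounded_support "\<lambda>u. G u * q u" m
    using G(1) by (auto simp: bounded_support_def)
  have "\<bar>G u * q u\<bar> \<le> B * C" for u
    unfolding abs_mult using G(3)[of u] q(2)[of u] by (intro mult_mono) auto
  then show ?thesis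
    using integral_periodize[of "B * C"] G q by (simp add: ip_def periodize_mult_periodic)
qed

lemma cas_add_int: "cas j (u + of_int k) = cas j u"
proof -
  have "2 * pi * of_int j * (u + of_int k) = 2 * pi * of_int j * u + 2 * pi * of_int (j * k)"
    by (simp add: algebra_simps)
  then show ?thesis unfolding cas_def by (simp only: cos_add sin_add cos_2pi_int sin_2pi_int)
qed

section \<open>Convolution with the rescaled kernel on the circle\<close>

definition kernel_ft :: "(real \<Rightarrow> real) \<Rightarrow> real \<Rightarrow> real" where
  "kernel_ft K z = (LBINT v. K v * cos (2 * pi * z * v))"

definition per_kernel :: "(real \<Rightarrow> real) \<Rightarrow> real \<Rightarrow> real \<Rightarrow> real \<Rightarrow> real" where
  "per_kernel K h t u = 1 / h * periodize (\<lambda>u. K ((t - u) / h)) u"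

locale kernel =
  fixes K :: "real \<Rightarrow> real" and B :: real
  assumes K_measurable [measurable]: "K \<in> borel_measurable borel"
    and K_bound: "\<And>t. \<bar>K t\<bar> \<le> B"
    and K_support: "\<And>t. t \<notin> {-1..1} \<Longrightarrow> K t = 0"
    and K_even: "\<And>t. K (- t) = K t"
    and K_integral: "(LBINT t. K t) = 1"
begin

lemma B_nonneg: "0 \<le> B" using K_bound[of 0] by (meson abs_ge_zero order_trans)

lemma
  fixes f :: "real \<Rightarrow> real"
  assumes [measurable]: "f \<in> borel_measurable borel" and C: "\<And>v. v \<in> {-1..1} \<Longrightarrow> \<bar>f v\<bar> \<le> C"
  shows K_mult_integrable: "integrable lborel (\<lambda>v. K v * f v)"
    and K_mult_integral_bound: "\<bar>LBINT v. K v * f v\<bar> \<le> 2 * B * C"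
proof -
  have le: "\<bar>K v * f v\<bar> \<le> indicator {-1..1} v * (B * C)" for v
  proof (cases "v \<in> {-1..1}")
    case True
    have "\<bar>K v\<bar> * \<bar>f v\<bar> \<le> B * C" using C[OF True] K_bound[of v] by (intro mult_mono) auto
    then show ?thesis using True by (simp add: abs_mult[symmetric] indicator_def)
  qed (simp add: K_support)
  have i: "integrable lborel (\<lambda>v::real. indicator {-1..1} v * (B * C))"
    by (intro integrable_mult_left integrable_real_indicator) auto
  show int: "integrable lborel (\<lambda>v. K v * f v)"
    by (rule Bochner_Integration.integrable_bound[OF i]) (auto intro!: AE_I2 order_trans[OF le] simp del: abs_mult)
  have "\<bar>LBINT v. K v * f v\<bar> \<le> (LBINT v. \<bar>K v * f v\<bar>)"
    using integral_norm_bound[of lborel "\<lambda>v. K v * f v"] by simp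
  also have "... \<le> (LBINT v::real. indicator {-1..1} v * (B * C))"
    by (rule integral_mono[OF _ i le]) (use int in simp)
  also have "... = 2 * B * C" by simp
  finally show "\<bar>LBINT v. K v * f v\<bar> \<le> 2 * B * C" .
qed

lemma integral_K_sin: "(LBINT v. K v * sin (a * v)) = 0"
proof -
  have "(LBINT v. K v * sin (a * v)) = (LBINT v. K (- v) * sin (a * (- v)))"
    using lborel_integral_real_affine[of "-1" "\<lambda>v. K v * sin (a * v)" 0] by simp
  then show ?thesis by (simp add: K_even)
qed

definition multiplier :: "real \<Rightarrow> int \<Rightarrow> real" where
  "multiplier h j = kernel_ft K (of_int j * h)"

lemma kernel_ft_minus: "kernel_ft K (- z) = kernel_ft K z"
  by (simp add: kernel_ft_def)

lemma kernel_ft_0: "kernel_ft K 0 = 1"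
  by (simp add: kernel_ft_def K_integral)

lemma kernel_ft_bound: "\<bar>kernel_ft K z\<bar> \<le> 2 * B"
  unfolding kernel_ft_def using K_mult_integral_bound[of "\<lambda>v. cos (2 * pi * z * v)" 1] by simp

lemma kernel_ft_Lipschitz:
  "\<bar>kernel_ft K z - kernel_ft K z'\<bar> \<le> 4 * pi * B * \<bar>z - z'\<bar>"
proof -
  have i: "integrable lborel (\<lambda>v. K v * cos (2 * pi * z * v))" for z
    by (rule K_mult_integrable[of _ 1]) auto
  have "kernel_ft K z - kernel_ft K z' = (LBINT v. K v * (cos (2 * pi * z * v) - cos (2 * pi * z' * v)))"
    unfolding kernel_ft_def using i[of z] i[of z'] by (simp add: right_diff_distrib)
  also have "\<bar>...\<bar> \<le> 2 * B * (2 * pi * \<bar>z - z'\<bar>)"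
  proof (rule K_mult_integral_bound)
    fix v :: real assume v: "v \<in> {-1..1}"
    have "\<bar>cos (2 * pi * z * v) - cos (2 * pi * z' * v)\<bar> \<le> \<bar>2 * pi * z * v - 2 * pi * z' * v\<bar>"
    proof -
      have "norm (cos (2 * pi * z * v) - cos (2 * pi * z' * v)) \<le> 1 * norm (2 * pi * z * v - 2 * pi * z' * v)"
        by (rule field_differentiable_bound[of UNIV cos "\<lambda>x. - sin x"])
          (auto intro!: derivative_eq_intros)
      then show ?thesis by simp
    qed
    also have "2 * pi * z * v - 2 * pi * z' * v = 2 * pi * (z - z') * v" by (simp add: algebra_simps)
    also have "\<bar>2 * pi * (z - z') * v\<bar> \<le> 2 * pi * \<bar>z - z'\<bar>"
      using v by (auto simp: abs_mult intro!: mult_left_le)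
    finally show "\<bar>cos (2 * pi * z * v) - cos (2 * pi * z' * v)\<bar> \<le> 2 * pi * \<bar>z - z'\<bar>" .
  qed simp
  finally show ?thesis by (simp add: mult_ac)
qed

lemma kernel_shift_support:
  assumes "0 < h"
  obtains m where "bounded_support (\<lambda>u. K ((t - u) / h)) m"
proof -
  obtain m where m: "\<bar>t\<bar> + h \<le> real m" using real_arch_simple by blast
  have "bounded_support (\<lambda>u. K ((t - u) / h)) m"
  proof
    fix u assume "real m < \<bar>u\<bar>"
    then have "h < \<bar>t - u\<bar>" using m by linarith
    then have "(t - u) / h \<notin> {-1..1}" using assms by (auto simp: field_simps)
    then show "K ((t - u) / h) = 0" by (rule K_support)
  qed
  then show ?thesis by (rule that)
qed

lemma
  assumes "0 < h"
  shows per_kernel_measurable: "per_kernel K h t \<in> borel_measurable borel"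
    and per_kernel_bounded: "\<exists>C. \<forall>u. \<bar>per_kernel K h t u\<bar> \<le> C"
proof -
  obtain m where "bounded_support (\<lambda>u. K ((t - u) / h)) m" by (rule kernel_shift_support[OF assms])
  then interpret bounded_support "\<lambda>u. K ((t - u) / h)" m .
  have [measurable]: "periodize (\<lambda>u. K ((t - u) / h)) \<in> borel_measurable borel"
    by (rule periodize_measurable) measurable
  show "per_kernel K h t \<in> borel_measurable borel"
    unfolding per_kernel_def[abs_def] by measurable
  show "\<exists>C. \<forall>u. \<bar>per_kernel K h t u\<bar> \<le> C"
  proof (intro exI allI)
    fix u
    have "\<bar>periodize (\<lambda>u. K ((t - u) / h)) u\<bar> \<le> of_nat (card {- int m - 1..int m}) * B"
      by (rule periodize_bound) (rule K_bound)
    then show "\<bar>per_kernel K h t u\<bar> \<le> \<bar>1 / h\<bar> * (of_nat (card {- int m - 1..int m}) * B)"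
      unfolding per_kernel_def abs_mult by (intro mult_left_mono) auto
  qed
qed

lemma per_kernel_unit_L2: "0 < h \<Longrightarrow> per_kernel K h t \<in> unit_L2"
  using per_kernel_bounded[of h t] per_kernel_measurable[of h t]
  by (auto intro: unit_L2_bounded)

lemma per_kernel_add_int: "per_kernel K h t (u + of_int k) = per_kernel K h t u"
  by (simp add: per_kernel_def periodize_add_int)

lemma ip_per_kernel:
  assumes h: "0 < h" and q: "q \<in> borel_measurable borel" "\<And>u. \<bar>q u\<bar> \<le> C" "\<And>u k. q (u + of_int k) = q u"
  shows "ip (per_kernel K h t) q = (LBINT v. K v * q (t - h * v))"
proof -
  obtain m where m: "bounded_support (\<lambda>u. K ((t - u) / h)) m" by (rule kernel_shift_support[OF h])
  have "ip (per_kernel K h t) q = 1 / h * ip (periodize (\<lambda>u. K ((t - u) / h))) q"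
    unfolding per_kernel_def[abs_def] ip_scale_left ..
  also have "ip (periodize (\<lambda>u. K ((t - u) / h))) q = (LBINT u. K ((t - u) / h) * q u)"
    by (rule integral_periodize_mult[OF m _ K_bound q]) auto
  also have "... = h * (LBINT v. K v * q (t - h * v))"
    using h lborel_integral_real_affine[of "- h" "\<lambda>u. K ((t - u) / h) * q u" t] by simp
  finally show ?thesis using h by simp
qed

text \<open>Expanding \<open>cas j (t - h * v)\<close> in \<open>v\<close> gives a cosine term
  proportional to \<open>cas j t\<close> and a sine term with another function of \<open>t\<close>.
  Evenness of \<open>K\<close> removes the latter, so \<open>cas j\<close> is an eigenfunction of
  the smoothing.\<close>

lemma ip_per_kernel_cas:
  assumes h: "0 < h"
  shows "ip (per_kernel K h t) (cas j) = kernel_ft K (of_int j * h) * cas j t"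
proof -
  define x where "x = 2 * pi * of_int j * t"
  define a where "a = 2 * pi * (of_int j * h)"
  have i: "integrable lborel (\<lambda>v. K v * cos (a * v))" "integrable lborel (\<lambda>v. K v * sin (a * v))"
    by (rule K_mult_integrable[of _ 1]; auto)+
  have "ip (per_kernel K h t) (cas j) = (LBINT v. K v * cas j (t - h * v))"
    by (rule ip_per_kernel[OF h _ abs_cas_le cas_add_int]) simp
  also have "... = (LBINT v. cas j t * (K v * cos (a * v)) + (sin x - cos x) * (K v * sin (a * v)))"
  proof (rule Bochner_Integration.integral_cong[OF refl])
    fix v
    have "2 * pi * of_int j * (t - h * v) = x - a * v" by (simp add: x_def a_def algebra_simps)
    then have "cas j (t - h * v) = cos (x - a * v) + sin (x - a * v)" by (simp add: cas_def)
    also have "... = cas j t * cos (a * v) + (sin x - cos x) * sin (a * v)"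
      unfolding cos_diff sin_diff by (simp add: cas_def x_def algebra_simps)
    finally have "cas j (t - h * v) = cas j t * cos (a * v) + (sin x - cos x) * sin (a * v)" .
    then show "K v * cas j (t - h * v) = cas j t * (K v * cos (a * v)) + (sin x - cos x) * (K v * sin (a * v))"
      by (simp only: distrib_left mult_ac)
  qed
  also have "... = cas j t * (LBINT v. K v * cos (a * v)) + (sin x - cos x) * (LBINT v. K v * sin (a * v))"
    using i by simp
  also have "... = kernel_ft K (of_int j * h) * cas j t"
    by (simp add: integral_K_sin kernel_ft_def a_def)
  finally show ?thesis .
qed

text \<open>Unfolding one factor to the line leaves only differences of arguments, in which
  \<open>t\<close> cancels.\<close>

lemma ip_per_kernel_self:
  assumes h: "0 < h"
  shows "ip (per_kernel K h t) (per_kernel K h t) = ip (per_kernel K h 0) (per_kernel K h 0)"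
proof -
  have eq: "ip (per_kernel K h t) (per_kernel K h t)
      = (LBINT v. K v * (1 / h * (\<Sum>\<^sub>\<infinity>k\<in>UNIV. K (v - of_int k / h))))" for t
  proof -
    obtain C where C: "\<And>u. \<bar>per_kernel K h t u\<bar> \<le> C" using per_kernel_bounded[OF h] by blast
    have "ip (per_kernel K h t) (per_kernel K h t) = (LBINT v. K v * per_kernel K h t (t - h * v))"
      by (rule ip_per_kernel[OF h per_kernel_measurable[OF h] C per_kernel_add_int])
    also have "(\<lambda>v. K v * per_kernel K h t (t - h * v)) = (\<lambda>v. K v * (1 / h * (\<Sum>\<^sub>\<infinity>k\<in>UNIV. K (v - of_int k / h))))"
    proof
      fix v
      have "(t - (t - h * v + of_int k)) / h = v - of_int k / h" for k using h by (simp add: field_simps)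
      then show "K v * per_kernel K h t (t - h * v) = K v * (1 / h * (\<Sum>\<^sub>\<infinity>k\<in>UNIV. K (v - of_int k / h)))"
        by (simp add: per_kernel_def periodize_def)
    qed
    finally show ?thesis .
  qed
  show ?thesis by (rule trans[OF eq[of t] eq[of 0, symmetric]])
qed

text \<open>Frequencies \<open>j\<close> and \<open>- j\<close> carry the same multiplier, and the
  squares of \<open>cas j t\<close> and \<open>cas (- j) t\<close> add up to 2. Together with
  \<open>ip_per_kernel_self\<close> this makes the truncation error of the kernel the same at every
  \<open>t\<close>.\<close>

lemma sum_kernel_cas_sq:
  "(\<Sum>j\<in>freqs N. (kernel_ft K (of_int j * h) * cas j t)^2) = (\<Sum>j\<in>freqs N. (kernel_ft K (of_int j * h))^2)"
proof -
  let ?\<mu> = "\<lambda>j. kernel_ft K (of_int j * h)"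
  have "(\<Sum>j\<in>freqs N. (?\<mu> j * cas j t)^2) + (\<Sum>j\<in>freqs N. (?\<mu> (- j) * cas (- j) t)^2)
      = (\<Sum>j\<in>freqs N. 2 * (?\<mu> j)^2)"
    unfolding sum.distrib[symmetric]
  proof (rule sum.cong[OF refl])
    fix j
    have "(cas j t)^2 + (cas (- j) t)^2 = 2 * ((sin (2 * pi * of_int j * t))^2 + (cos (2 * pi * of_int j * t))^2)"
      unfolding cas_def by (simp add: power2_eq_square algebra_simps)
    then have "(cas j t)^2 + (cas (- j) t)^2 = 2" by simp
    then show "(?\<mu> j * cas j t)^2 + (?\<mu> (- j) * cas (- j) t)^2 = 2 * (?\<mu> j)^2"
      using kernel_ft_minus[of "of_int j * h"]
      by (simp add: power_mult_distrib distrib_left[symmetric])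
  qed
  then show ?thesis
    unfolding sum_flip[of "\<lambda>j. (?\<mu> j * cas j t)^2"] by (simp add: sum_distrib_left[symmetric])
qed

end

section \<open>Approximation by trigonometric polynomials\<close>

text \<open>The closure properties reduce multiplication by \<open>cos (2 * pi * t)\<close> to the
  generators; this yields all polynomials in the cosine, the form in which Weierstrass approximation
  delivers its approximants.\<close>

inductive trig_poly :: "(real \<Rightarrow> real) \<Rightarrow> bool" where
  cas: "trig_poly (cas j)"
| add: "trig_poly p \<Longrightarrow> trig_poly q \<Longrightarrow> trig_poly (\<lambda>t. p t + q t)"
| scale: "trig_poly p \<Longrightarrow> trig_poly (\<lambda>t. a * p t)"

lemma trig_poly_cos_mult: "trig_poly p \<Longrightarrow> trig_poly (\<lambda>t. cos (2 * pi * t) * p t)"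
proof (induction rule: trig_poly.induct)
  case (cas j)
  have "cos (2 * pi * t) * cas j t = 1 / 2 * cas (j + 1) t + 1 / 2 * cas (j - 1) t" for t
  proof -
    have "2 * pi * of_int (j + 1) * t = 2 * pi * of_int j * t + 2 * pi * t"
      "2 * pi * of_int (j - 1) * t = 2 * pi * of_int j * t - 2 * pi * t"
      by (simp_all add: algebra_simps)
    then show ?thesis
      unfolding cas_def by (simp only: cos_add sin_add cos_diff sin_diff) (simp add: algebra_simps)
  qed
  then show ?case
    using trig_poly.add[OF trig_poly.scale[OF trig_poly.cas[of "j + 1"], of "1/2"] trig_poly.scale[OF trig_poly.cas[of "j - 1"], of "1/2"]]
    by simp
next
  case (add p q)
  then show ?case using trig_poly.add[OF add.IH] by (simp add: distrib_left)
next
  case (scale p a)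
  then show ?case using trig_poly.scale[OF scale.IH, of a] by (simp add: mult.left_commute)
qed

lemma trig_poly_cos_power: "trig_poly (\<lambda>t. cos (2 * pi * t) ^ i)"
proof (induction i)
  case 0
  have "cas 0 = (\<lambda>t. 1)" by (auto simp: cas_def)
  then show ?case using trig_poly.cas[of 0] by simp
qed (simp add: trig_poly_cos_mult)

lemma trig_poly_cos_sum: "trig_poly (\<lambda>t. \<Sum>i\<le>(n::nat). a i * cos (2 * pi * t) ^ i)"
proof (induction n)
  case 0
  show ?case using trig_poly.scale[OF trig_poly_cos_power[of 0], of "a 0"] by simp
next
  case (Suc n)
  show ?case using trig_poly.add[OF Suc trig_poly.scale[OF trig_poly_cos_power[of "Suc n"], of "a (Suc n)"]] by simp
qed

lemma trig_poly_eq_sum: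
  assumes "trig_poly p"
  shows "\<exists>N a. p = (\<lambda>t. \<Sum>j\<in>freqs N. a j * cas j t)"
  using assms
proof (induction rule: trig_poly.induct)
  case (cas j)
  have "(\<Sum>i\<in>{- int (nat \<bar>j\<bar>)..int (nat \<bar>j\<bar>)}. (if i = j then 1 else 0) * cas i t) = cas j t" for t
  proof -
    have "(\<Sum>i\<in>{- int (nat \<bar>j\<bar>)..int (nat \<bar>j\<bar>)}. (if i = j then 1 else 0) * cas i t)
        = (\<Sum>i\<in>{- int (nat \<bar>j\<bar>)..int (nat \<bar>j\<bar>)}. if i = j then cas i t else 0)"
      by (intro sum.cong) auto
    then show ?thesis by (simp add: abs_if)
  qed
  then show ?case by metis
next
  case (add p q)
  then obtain N a M b where p: "p = (\<lambda>t. \<Sum>j\<in>freqs N. a j * cas j t)"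
    and q: "q = (\<lambda>t. \<Sum>j\<in>freqs M. b j * cas j t)" by blast
  let ?L = "freqs (max N M)"
  have ext: "(\<Sum>j\<in>freqs N. a j * cas j t) = (\<Sum>j\<in>?L. (if j \<in> freqs N then a j else 0) * cas j t)"
    if "N \<le> max N' M'" "?L = {- int (max N' M')..int (max N' M')}" for N N' M' a t
    unfolding that(2) by (rule sum.mono_neutral_cong_left) (use that in auto)
  have "p t + q t = (\<Sum>j\<in>?L. ((if j \<in> freqs N then a j else 0) + (if j \<in> freqs M then b j else 0)) * cas j t)" for t
    unfolding p q distrib_right sum.distrib
    by (intro arg_cong2[where f="(+)"] ext[of _ N M]) auto
  then show ?case by (intro exI) (rule HOL.ext)
next
  case (scale p a)
  then obtain N b where "p = (\<lambda>t. \<Sum>j\<in>freqs N. b j * cas j t)" by blast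
  then have "(\<lambda>t. a * p t) = (\<lambda>t. \<Sum>j\<in>freqs N. (a * b j) * cas j t)"
    by (auto simp: sum_distrib_left mult.assoc)
  then show ?case by (intro exI[of _ N] exI[of _ "\<lambda>j. a * b j"])
qed

text \<open>A measurable function is an almost everywhere limit of continuous ones; clamping these
  to \<open>[- B, B]\<close> does not disturb the limit and provides the dominating function. Half
  the circle suffices because the functions to be approximated are even.\<close>

lemma bounded_approx_continuous:
  fixes g :: "real \<Rightarrow> real"
  assumes g [measurable]: "g \<in> borel_measurable borel" and B: "\<And>u. \<bar>g u\<bar> \<le> B" and "0 < \<epsilon>"
  obtains c where "continuous_on UNIV c" "\<And>u. \<bar>c u\<bar> \<le> B" "(LBINT u:{0..1/2}. (g u - c u)^2) < \<epsilon>"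
proof -
  have B0: "0 \<le> B" using B[of 0] by linarith
  have "g \<in> borel_measurable lebesgue" using g by (simp add: measurable_completion)
  then have "g measurable_on UNIV" by (rule lebesgue_measurable_imp_measurable_on_real) simp
  then obtain N G where N: "negligible N" and G: "\<And>n. continuous_on UNIV (G n)"
    and lim: "\<And>x. x \<notin> N \<Longrightarrow> (\<lambda>n. G n x) \<longlonglongrightarrow> g x"
    unfolding measurable_on_def by auto
  have "AE x in lebesgue. x \<notin> N" using N by (intro AE_not_in) (simp add: negligible_iff_null_sets)
  then have aeN: "AE x in lborel. x \<notin> N" by (simp add: AE_completion_iff)
  define c where "c = (\<lambda>n u. max (- B) (min B (G n u)))"
  let ?D = "\<lambda>n u. indicator {0..1/2} u *\<^sub>R (g u - c n u)^2"
  have cont: "continuous_on UNIV (c n)" for n unfolding c_def by (intro continuous_intros G)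
  then have [measurable]: "c n \<in> borel_measurable borel" for n by (rule borel_measurable_continuous_onI)
  have cB: "\<bar>c n u\<bar> \<le> B" for n u using B0 by (auto simp: c_def)
  have "(\<lambda>n. LBINT u. ?D n u) \<longlonglongrightarrow> (LBINT u::real. 0 :: real)"
  proof (rule integral_dominated_convergence[where w="\<lambda>u. indicator {0..1/2} u * (4 * B^2)"])
    show "integrable lborel (\<lambda>u::real. indicator {0..1/2} u * (4 * B^2))"
      by (intro integrable_mult_left integrable_real_indicator emeasure_bounded_finite) auto
    show "AE u in lborel. (\<lambda>n. ?D n u) \<longlonglongrightarrow> 0"
      using aeN
    proof eventually_elim
      case (elim u)
      have "(\<lambda>n. c n u) \<longlonglongrightarrow> max (- B) (min B (g u))"
        unfolding c_def by (intro tendsto_intros lim elim)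
      also have "max (- B) (min B (g u)) = g u" using B[of u] by auto
      finally have "(\<lambda>n. ?D n u) \<longlonglongrightarrow> indicator {0..1/2} u *\<^sub>R (g u - g u)^2"
        by (intro tendsto_intros)
      then show ?case by simp
    qed
    fix n
    show "AE u in lborel. norm (?D n u) \<le> indicator {0..1/2} u * (4 * B^2)"
    proof (rule AE_I2)
      fix u
      have "\<bar>g u - c n u\<bar> \<le> 2 * B" using B[of u] cB[of n u] by linarith
      then have "\<bar>g u - c n u\<bar>^2 \<le> (2 * B)^2" by (rule power_mono) simp
      then show "norm (?D n u) \<le> indicator {0..1/2} u * (4 * B^2)"
        by (auto simp: indicator_def power_mult_distrib)
    qed
  qed auto
  then have "\<forall>\<^sub>F n in sequentially. (LBINT u. ?D n u) < \<epsilon>"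
    using \<open>0 < \<epsilon>\<close> by (intro order_tendstoD) auto
  then obtain n where "(LBINT u. ?D n u) < \<epsilon>"
    by (auto simp: eventually_sequentially)
  then show ?thesis
    by (intro that[OF cont cB]) (simp add: set_lebesgue_integral_def)
qed

lemma set_integral_reflect:
  fixes F :: "real \<Rightarrow> real"
  assumes [measurable]: "F \<in> borel_measurable borel" and sym: "\<And>u. F (1 - u) = F u"
    and int: "set_integrable lborel {0..1} F"
  shows "(LBINT u:{0..<1}. F u) = 2 * (LBINT u:{0..1/2}. F u)"
proof -
  have i: "set_integrable lborel {0..1/2} F" "set_integrable lborel {1/2..1} F"
    by (rule set_integrable_subset[OF int]; auto)+
  have r: "(LBINT u:{1/2..1}. F u) = (LBINT u:{0..1/2}. F u)"
  proof -
    have "(LBINT u:{1/2..1}. F u) = (LBINT u. indicator {1/2..1} (1 + (-1) * u) *\<^sub>R F (1 + (-1) * u))"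
      unfolding set_lebesgue_integral_def
      using lborel_integral_real_affine[of "-1" "\<lambda>u. indicator {1/2..1} u *\<^sub>R F u" 1] by simp
    also have "... = (LBINT u:{0..1/2}. F u)"
      unfolding set_lebesgue_integral_def
      by (intro Bochner_Integration.integral_cong) (auto simp: indicator_def sym)
    finally show ?thesis .
  qed
  have "(LBINT u:{0..<1}. F u) = (LBINT u. indicator {0..1/2} u *\<^sub>R F u + indicator {1/2..1} u *\<^sub>R F u)"
    unfolding set_lebesgue_integral_def
    by (rule integral_discrete_difference[of "{1/2, 1}"]) (auto simp: indicator_def)
  also have "... = (LBINT u:{0..1/2}. F u) + (LBINT u:{1/2..1}. F u)"
    using i unfolding set_integrable_def set_lebesgue_integral_def by simp
  finally show ?thesis using r by simp
qed

text \<open>The substitution \<open>t = arccos y / (2\<pi>)\<close> turns an even function on the circle into a function on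
  \<open>[-1, 1]\<close>, to which the Weierstrass theorem applies.\<close>

lemma even_trig_approx:
  fixes g :: "real \<Rightarrow> real"
  assumes [measurable]: "g \<in> borel_measurable borel" and B: "\<And>u. \<bar>g u\<bar> \<le> B" and sym: "\<And>u. g (1 - u) = g u"
    and "0 < \<epsilon>"
  obtains N a where "(L2_norm1 (\<lambda>u. g u - (\<Sum>j\<in>freqs N. a j * cas j u)))^2 < \<epsilon>"
proof -
  \<comment> \<open>Two errors enter: the squared mean error of \<open>c\<close> on the half
    interval and the squared uniform error \<open>e^2\<close> of the polynomial. Doubled to the full
    circle they contribute \<open>2 * (2 * ?I + e^2)\<close>, which is below \<epsilon> if both are
    at most \<open>\<epsilon> / 8\<close>.\<close>
  obtain c where c: "continuous_on UNIV c" "\<And>u. \<bar>c u\<bar> \<le> B" and gc: "(LBINT u:{0..1/2}. (g u - c u)^2) < \<epsilon> / 8"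
    using bounded_approx_continuous[of g B "\<epsilon> / 8"] B \<open>0 < \<epsilon>\<close> by auto
  have [measurable]: "c \<in> borel_measurable borel" using c(1) by (rule borel_measurable_continuous_onI)
  let ?I = "LBINT u:{0..1/2}. (g u - c u)^2"
  define e where "e = sqrt (\<epsilon> / 8)"
  have e: "0 < e" "e^2 = \<epsilon> / 8" using \<open>0 < \<epsilon>\<close> by (auto simp: e_def)
  have "continuous_on {-1..1} (\<lambda>y. c (arccos y / (2 * pi)))"
    by (intro continuous_on_compose2[OF c(1)] continuous_intros) auto
  from Stone_Weierstrass_real_polynomial_function[OF compact_Icc this e(1)]
  obtain P where P: "real_polynomial_function P" "\<And>y. y \<in> {-1..1} \<Longrightarrow> \<bar>c (arccos y / (2 * pi)) - P y\<bar> < e" by blast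
  from P(1) obtain b n where Pb: "P = (\<lambda>x. \<Sum>i\<le>n. b i * x ^ i)" by (auto simp: real_polynomial_function_iff_sum)
  define q where "q = (\<lambda>t. P (cos (2 * pi * t)))"
  have "trig_poly q" unfolding q_def Pb by (rule trig_poly_cos_sum)
  then obtain N a where q: "q = (\<lambda>t. \<Sum>j\<in>freqs N. a j * cas j t)" using trig_poly_eq_sum by blast
  have [measurable]: "q \<in> borel_measurable borel" unfolding q by measurable
  have qsym: "q (1 - u) = q u" for u
    by (simp add: q_def right_diff_distrib cos_diff)
  have qc: "\<bar>c t - q t\<bar> \<le> e" if "t \<in> {0..1/2}" for t
  proof -
    have "arccos (cos (2 * pi * t)) = 2 * pi * t"
      by (rule arccos_cos) (use that in \<open>auto simp: field_simps\<close>)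
    then show ?thesis using P(2)[of "cos (2 * pi * t)"] by (simp add: q_def)
  qed
  have qB: "\<exists>C. \<forall>u. \<bar>q u\<bar> \<le> C"
    unfolding q
    by (intro exI allI, rule order_trans[OF sum_abs])
      (rule sum_mono[of _ _ "\<lambda>j. \<bar>a j\<bar> * 2"], auto simp: abs_mult intro!: mult_left_mono abs_cas_le)
  then obtain C where C: "\<And>u. \<bar>q u\<bar> \<le> C" by blast
  have bnd: "set_integrable lborel A F" if "F \<in> borel_measurable borel" "\<And>u. \<bar>F u\<bar> \<le> D" "A \<subseteq> {0..1}" "A \<in> sets lborel" for F :: "real \<Rightarrow> real" and D A
  proof -
    have "set_integrable lborel {0..1::real} (\<lambda>u. D)" by (auto simp: set_integrable_def)
    then have "set_integrable lborel A (\<lambda>u. D)" using that by (auto intro: set_integrable_subset)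
    then show ?thesis using that(1,4)
      by (elim set_integrable_bound) (auto simp: set_borel_measurable_def intro!: AE_I2 order_trans[OF that(2)])
  qed
  have sqb: "\<bar>(x - y)^2\<bar> \<le> (X + Y)^2" if "\<bar>x\<bar> \<le> X" "\<bar>y\<bar> \<le> Y" for x y X Y :: real
    using power_mono[of "\<bar>x - y\<bar>" "X + Y" 2] that by simp
  have i1: "set_integrable lborel A (\<lambda>u. (g u - q u)^2)" if "A \<subseteq> {0..1}" "A \<in> sets lborel" for A
    by (rule bnd[OF _ sqb[OF B C] that]) measurable
  have i2: "set_integrable lborel {0..1/2} (\<lambda>u. (g u - c u)^2)"
    by (rule bnd[OF _ sqb[OF B c(2)]]) auto
  have ihalf: "set_integrable lborel {0..1/2} (\<lambda>u::real. 2 * e^2)"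
    by (rule bnd[of _ "2 * e^2"]) auto
  have "ip (\<lambda>u. g u - q u) (\<lambda>u. g u - q u) = (LBINT u:{0..<1}. (g u - q u)^2)"
    by (simp add: ip_def power2_eq_square)
  also have "... = 2 * (LBINT u:{0..1/2}. (g u - q u)^2)"
    by (rule set_integral_reflect) (auto simp: sym qsym intro: i1)
  also have "(LBINT u:{0..1/2}. (g u - q u)^2) \<le> (LBINT u:{0..1/2}. 2 * (g u - c u)^2 + 2 * e^2)"
  proof (rule set_integral_mono)
    show "set_integrable lborel {0..1/2} (\<lambda>u. 2 * (g u - c u)^2 + 2 * e^2)"
      by (rule set_integral_add(1)[OF set_integrable_mult_right[OF i2] ihalf])
    fix u :: real assume "u \<in> {0..1/2}"
    then have "(c u - q u)^2 \<le> e^2" using qc[of u] power_mono[of "\<bar>c u - q u\<bar>" e 2] by simp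
    moreover have "(g u - q u)^2 \<le> 2 * (g u - c u)^2 + 2 * (c u - q u)^2"
      using zero_le_power2[of "(g u - c u) - (c u - q u)"] by (simp add: power2_eq_square algebra_simps)
    ultimately show "(g u - q u)^2 \<le> 2 * (g u - c u)^2 + 2 * e^2" by linarith
  qed (auto intro: i1)
  also have "(LBINT u:{0..1/2}. 2 * (g u - c u)^2 + 2 * e^2) = 2 * ?I + e^2"
  proof -
    have "(LBINT u:{0..1/2}. 2 * (g u - c u)^2 + 2 * e^2) = (LBINT u:{0..1/2}. 2 * (g u - c u)^2) + (LBINT u:{0..1/2::real}. 2 * e^2)"
      by (rule set_integral_add(2)[OF set_integrable_mult_right[OF i2] ihalf])
    also have "(LBINT u:{0..1/2::real}. 2 * e^2) = e^2" by (simp add: set_lebesgue_integral_def)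
    finally show ?thesis by simp
  qed
  also have "2 * (2 * ?I + e^2) < \<epsilon>"
  proof -
    have "2 * (2 * I + y) < \<epsilon>" if "I < \<epsilon> / 8" "y = \<epsilon> / 8" for I y :: real
      using that \<open>0 < \<epsilon>\<close> by simp
    from this[OF gc e(2)] show ?thesis .
  qed
  finally have "ip (\<lambda>u. g u - q u) (\<lambda>u. g u - q u) < \<epsilon>" by linarith
  then show ?thesis using that unfolding q L2_norm1_sq by blast
qed

section \<open>Parseval tails and decay of the kernel transform\<close>

context kernel
begin

definition kernel_energy :: "real \<Rightarrow> real" where
  "kernel_energy h = ip (per_kernel K h 0) (per_kernel K h 0)"

definition kernel_tail :: "real \<Rightarrow> nat \<Rightarrow> real" where
  "kernel_tail h N = kernel_energy h - (\<Sum>j\<in>freqs N. (kernel_ft K (of_int j * h))^2)"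

definition kernel_partial :: "real \<Rightarrow> nat \<Rightarrow> real \<Rightarrow> real \<Rightarrow> real" where
  "kernel_partial h N t u = (\<Sum>j\<in>freqs N. (kernel_ft K (of_int j * h) * cas j t) * cas j u)"

lemma kernel_partial_unit_L2: "kernel_partial h N t \<in> unit_L2"
  unfolding kernel_partial_def[abs_def] by (rule cas_sum_unit_L2)

text \<open>Neither the energy of the kernel nor the sum of its squared coefficients depends on
  \<open>t\<close>, so a single number controls the truncation error at all points of the
  circle.\<close>

lemma ip_kernel_remainder:
  assumes "0 < h"
  shows "ip (\<lambda>u. per_kernel K h t u - kernel_partial h N t u) (\<lambda>u. per_kernel K h t u - kernel_partial h N t u) = kernel_tail h N"
  unfolding kernel_partial_def
  by (subst ip_minus_cas_sum)
    (simp_all add: assms per_kernel_unit_L2 ip_per_kernel_cas sum_kernel_cas_sq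
      kernel_tail_def kernel_energy_def ip_per_kernel_self[OF assms, of t])

lemma kernel_tail_nonneg: "0 < h \<Longrightarrow> 0 \<le> kernel_tail h N"
  using ip_kernel_remainder[of h 0 N] ip_self_nonneg by metis

lemma kernel_tail_antimono: "N \<le> N' \<Longrightarrow> kernel_tail h N' \<le> kernel_tail h N"
  unfolding kernel_tail_def by (intro diff_left_mono sum_mono2) auto

lemma per_kernel_0_reflect: "per_kernel K h 0 (1 - u) = per_kernel K h 0 u"
proof -
  have "per_kernel K h 0 (1 - u) = per_kernel K h 0 (- u)"
    using per_kernel_add_int[of h 0 "- u" 1] by (simp add: add.commute)
  also have "... = per_kernel K h 0 u"
  proof -
    have "(\<Sum>\<^sub>\<infinity>k\<in>UNIV. K ((0 - (- u + of_int k)) / h)) = (\<Sum>\<^sub>\<infinity>k\<in>(UNIV::int set). K ((0 - (u + of_int k)) / h))"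
    proof -
      have "(\<Sum>\<^sub>\<infinity>k\<in>UNIV. K ((0 - (- u + of_int k)) / h)) = (\<Sum>\<^sub>\<infinity>k\<in>(UNIV::int set). K ((0 - (- u + of_int (- k))) / h))"
        by (rule infsum_reindex_bij_betw[symmetric]) (auto simp: bij_uminus)
      also have "(\<lambda>k::int. K ((0 - (- u + of_int (- k))) / h)) = (\<lambda>k. K ((0 - (u + of_int k)) / h))"
      proof
        fix k :: int
        have "(0 - (- u + of_int (- k))) / h = - ((0 - (u + of_int k)) / h)" by (simp add: minus_divide_left)
        then show "K ((0 - (- u + of_int (- k))) / h) = K ((0 - (u + of_int k)) / h)" by (simp only: K_even)
      qed
      finally show ?thesis .
    qed
    then show ?thesis by (simp only: per_kernel_def periodize_def)
  qed
  finally show ?thesis .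
qed

text \<open>The Fourier coefficients give the best approximation, so the tail lies below the error
  of whatever trigonometric polynomial approximates the kernel at \<open>t = 0\<close>. There the
  kernel is even, which is the case that \<open>even_trig_approx\<close> covers.\<close>

lemma kernel_tail_tendsto_0:
  assumes "0 < h"
  shows "kernel_tail h \<longlonglongrightarrow> 0"
proof (rule LIMSEQ_I)
  fix r :: real assume "0 < r"
  obtain C where C: "\<And>u. \<bar>per_kernel K h 0 u\<bar> \<le> C" using per_kernel_bounded[OF assms] by blast
  obtain N a where N: "(L2_norm1 (\<lambda>u. per_kernel K h 0 u - (\<Sum>j\<in>freqs N. a j * cas j u)))^2 < r"
    by (rule even_trig_approx[OF per_kernel_measurable[OF assms] C per_kernel_0_reflect \<open>0 < r\<close>])
  have "kernel_tail h N \<le> (L2_norm1 (\<lambda>u. per_kernel K h 0 u - (\<Sum>j\<in>freqs N. a j * cas j u)))^2"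
    unfolding L2_norm1_sq by (subst ip_minus_cas_sum)
      (simp_all add: assms per_kernel_unit_L2 ip_per_kernel_cas sum_kernel_cas_sq
        kernel_tail_def kernel_energy_def sum_nonneg)
  then have "kernel_tail h N < r" using N by linarith
  then have "norm (kernel_tail h M - 0) < r" if "N \<le> M" for M
    using kernel_tail_antimono[OF that, of h] kernel_tail_nonneg[OF assms, of M] by simp
  then show "\<exists>N. \<forall>M\<ge>N. norm (kernel_tail h M - 0) < r" by blast
qed

text \<open>Bessel on a fine grid of frequencies, together with the Lipschitz bound between grid points.\<close>

lemma kernel_ft_vanishes:
  assumes "0 < \<eta>"
  obtains \<Lambda> where "0 < \<Lambda>" "\<And>z. \<Lambda> \<le> \<bar>z\<bar> \<Longrightarrow> \<bar>kernel_ft K z\<bar> \<le> \<eta>"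
proof -
  obtain q :: nat where "8 * pi * B / \<eta> < real q" using reals_Archimedean2 by blast
  then have q: "8 * pi * B / \<eta> \<le> real (Suc q)" by simp
  \<comment> \<open>Here \<open>h\<close> is a grid spacing, so fine that the Lipschitz bound allows
    a change of at most \<open>\<eta> / 2\<close> between neighbouring grid points.\<close>
  define h where "h = 1 / real (Suc q)"
  have h: "0 < h" by (simp add: h_def)
  have hB: "4 * pi * B * h \<le> \<eta> / 2"
    using q assms by (simp add: h_def field_simps)
  have "\<forall>\<^sub>F N in sequentially. kernel_tail h N < (\<eta> / 2)^2"
    by (rule order_tendstoD[OF kernel_tail_tendsto_0[OF h]]) (use assms in auto)
  then obtain N where N: "kernel_tail h N < (\<eta> / 2)^2" by (auto simp: eventually_sequentially)
  have tail: "\<bar>kernel_ft K (of_int j * h)\<bar> \<le> \<eta> / 2" if "int N < \<bar>j\<bar>" for j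
  proof -
    define N' where "N' = nat \<bar>j\<bar>"
    have "(\<Sum>i\<in>freqs N. (kernel_ft K (of_int i * h))^2) + (kernel_ft K (of_int j * h))^2
        = (\<Sum>i\<in>insert j (freqs N). (kernel_ft K (of_int i * h))^2)"
      using that by (subst sum.insert) auto
    also have "... \<le> (\<Sum>i\<in>freqs N'. (kernel_ft K (of_int i * h))^2)"
      using that by (intro sum_mono2) (auto simp: N'_def)
    also have "... \<le> kernel_energy h" using kernel_tail_nonneg[OF h, of N'] by (simp add: kernel_tail_def)
    finally have "(kernel_ft K (of_int j * h))^2 \<le> (\<eta> / 2)^2" using N by (simp add: kernel_tail_def)
    then show ?thesis using abs_le_square_iff[of "kernel_ft K (of_int j * h)" "\<eta> / 2"] assms by simp
  qed
  show ?thesis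
  proof
    \<comment> \<open>Rounding \<open>z / h\<close> down to the grid costs one spacing; the second
      one puts the index strictly beyond \<open>N\<close>, where the Bessel estimate holds.\<close>
    show "0 < (real N + 2) * h" using h by simp
    fix z assume z: "(real N + 2) * h \<le> \<bar>z\<bar>"
    define j where "j = \<lfloor>z / h\<rfloor>"
    have "of_int j \<le> z / h" "z / h < of_int j + 1" by (auto simp: j_def)
    then have j: "of_int j * h \<le> z" "z \<le> of_int j * h + h" using h by (auto simp: field_simps)
    have "(real N + 2) * h - h \<le> \<bar>of_int j * h\<bar>" using z j h by linarith
    then have "(real N + 1) * h \<le> \<bar>of_int j\<bar> * h" using h by (simp add: abs_mult algebra_simps)
    then have "real N + 1 \<le> \<bar>of_int j\<bar>" using h by simp
    then have "int N < \<bar>j\<bar>" by linarith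
    from tail[OF this] have "\<bar>kernel_ft K (of_int j * h)\<bar> \<le> \<eta> / 2" .
    moreover have "\<bar>kernel_ft K z - kernel_ft K (of_int j * h)\<bar> \<le> \<eta> / 2"
    proof -
      have "\<bar>kernel_ft K z - kernel_ft K (of_int j * h)\<bar> \<le> 4 * pi * B * \<bar>z - of_int j * h\<bar>"
        by (rule kernel_ft_Lipschitz)
      also have "... \<le> 4 * pi * B * h" using j B_nonneg by (intro mult_left_mono) auto
      finally show ?thesis using hB by linarith
    qed
    ultimately show "\<bar>kernel_ft K z\<bar> \<le> \<eta>" by linarith
  qed
qed

text \<open>On this range the Lipschitz constant \<open>4 * pi * B\<close> moves the transform by at
  most 1/2 from its value 1 at 0. These are the frequencies that keep the statistic from
  concentrating.\<close>

lemma kernel_ft_near_0: "\<bar>z\<bar> \<le> 1 / (8 * pi * (B + 1)) \<Longrightarrow> 1 / 2 \<le> kernel_ft K z"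
proof -
  assume z: "\<bar>z\<bar> \<le> 1 / (8 * pi * (B + 1))"
  have "\<bar>kernel_ft K z - kernel_ft K 0\<bar> \<le> 4 * pi * B * \<bar>z\<bar>"
    using kernel_ft_Lipschitz[of z 0] by simp
  also have "... \<le> 4 * pi * (B + 1) * (1 / (8 * pi * (B + 1)))"
    using z B_nonneg by (intro mult_mono) auto
  also have "... = 4 * (pi * (B + 1)) / (8 * (pi * (B + 1)))" by (simp add: mult.assoc)
  also have "... = 1 / 2" using B_nonneg pi_gt_zero by (subst mult_divide_mult_cancel_right) auto
  finally show ?thesis using kernel_ft_0 by linarith
qed

end

section \<open>The kernel estimator\<close>

locale kernel_model = white_noise_space M W + kernel K B
  for M :: "'a measure" and W K B
begin

definition obs_coeff :: "real \<Rightarrow> nat \<Rightarrow> (real \<Rightarrow> real) \<Rightarrow> int \<Rightarrow> 'a \<Rightarrow> real" where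
  "obs_coeff \<sigma> n f j z = ip f (cas j) + \<sigma> / sqrt (real n) * W (cas j) z"

definition partial_estimator :: "real \<Rightarrow> nat \<Rightarrow> real \<Rightarrow> (real \<Rightarrow> real) \<Rightarrow> nat \<Rightarrow> real \<Rightarrow> 'a \<Rightarrow> real" where
  "partial_estimator \<sigma> n h f N t z = (\<Sum>j\<in>freqs N. (multiplier h j * obs_coeff \<sigma> n f j z) * cas j t)"

definition partial_energy :: "real \<Rightarrow> nat \<Rightarrow> real \<Rightarrow> (real \<Rightarrow> real) \<Rightarrow> nat \<Rightarrow> 'a \<Rightarrow> real" where
  "partial_energy \<sigma> n h f N z = (\<Sum>j\<in>freqs N. (multiplier h j)^2 * (obs_coeff \<sigma> n f j z)^2)"

lemma W_cas_measurable [measurable]: "W (cas j) \<in> borel_measurable M"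
  by (rule W_measurable[OF cas_unit_L2])

lemma obs_coeff_measurable [measurable]: "obs_coeff \<sigma> n f j \<in> borel_measurable M"
  unfolding obs_coeff_def by measurable

lemma partial_estimator_measurable [measurable]:
  "(\<lambda>(t, z). partial_estimator \<sigma> n h f N t z) \<in> borel_measurable (lborel \<Otimes>\<^sub>M M)"
  unfolding partial_estimator_def by measurable

lemma partial_estimator_measurable2 [measurable]: "partial_estimator \<sigma> n h f N t \<in> borel_measurable M"
  unfolding partial_estimator_def by measurable

lemma partial_energy_measurable [measurable]: "partial_energy \<sigma> n h f N \<in> borel_measurable M"
  unfolding partial_energy_def by measurable

lemma partial_estimator_unit_L2: "(\<lambda>t. partial_estimator \<sigma> n h f N t z) \<in> unit_L2"
  unfolding partial_estimator_def by (rule cas_sum_unit_L2)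

lemma ip_partial_estimator:
  "ip (\<lambda>t. partial_estimator \<sigma> n h f N t z) (\<lambda>t. partial_estimator \<sigma> n h f N t z) = partial_energy \<sigma> n h f N z"
  unfolding partial_estimator_def partial_energy_def
  by (subst ip_cas_sums) (simp_all add: power2_eq_square mult_ac)

lemma partial_energy_nonneg: "0 \<le> partial_energy \<sigma> n h f N z"
  unfolding partial_energy_def by (intro sum_nonneg) auto

lemma observation_eq: "observation W \<sigma> n f g z = ip g f + \<sigma> / sqrt (real n) * W g z"
  by (simp add: observation_def ip_def)

lemma shifted_kernel_unit_L2:
  assumes "0 < h"
  shows "periodize (\<lambda>u. K ((t - u) / h)) \<in> unit_L2"
proof -
  have "(\<lambda>u. h * per_kernel K h t u) \<in> unit_L2"
    by (rule unit_L2_scale[OF per_kernel_unit_L2[OF assms]])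
  also have "(\<lambda>u. h * per_kernel K h t u) = periodize (\<lambda>u. K ((t - u) / h))"
    using assms by (auto simp: per_kernel_def)
  finally show ?thesis .
qed

text \<open>At fixed \<open>t\<close> the truncation error is itself an observation, namely of the
  remainder of the kernel. Linearity of \<open>W\<close> holds almost surely only, with an
  exceptional set that depends on \<open>t\<close>, so the errors are first estimated pointwise in
  \<open>t\<close>.\<close>

lemma observation_kernel_minus_partial:
  assumes h: "0 < h" and f: "f \<in> unit_L2"
  shows "AE z in M. 1 / h * observation W \<sigma> n f (periodize (\<lambda>u. K ((t - u) / h))) z - partial_estimator \<sigma> n h f N t z
    = ip (\<lambda>u. per_kernel K h t u - kernel_partial h N t u) f
      + \<sigma> / sqrt (real n) * W (\<lambda>u. per_kernel K h t u - kernel_partial h N t u) z"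
proof -
  let ?p = "periodize (\<lambda>u. K ((t - u) / h))" and ?k = "per_kernel K h t" and ?P = "kernel_partial h N t"
  have p: "?p \<in> unit_L2" by (rule shifted_kernel_unit_L2[OF h])
  have kp: "?k = (\<lambda>u. 1 / h * ?p u)" by (auto simp: per_kernel_def)
  have k: "?k \<in> unit_L2" by (rule per_kernel_unit_L2[OF h])
  have P: "?P \<in> unit_L2" by (rule kernel_partial_unit_L2)
  have 1: "AE z in M. W ?k z = 1 / h * W ?p z"
    using W_linear[OF p p, of "1 / h" 0] unfolding kp by simp
  have 2: "AE z in M. W (\<lambda>u. ?k u - ?P u) z = W ?k z - W ?P z"
    by (rule W_diff[OF k P])
  have 3: "AE z in M. W ?P z = (\<Sum>j\<in>freqs N. (multiplier h j * cas j t) * W (cas j) z)"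
    unfolding kernel_partial_def[abs_def] multiplier_def by (rule W_sum) (auto simp: cas_unit_L2)
  have kf: "ip ?k f = 1 / h * ip ?p f" unfolding kp ip_scale_left ..
  have Pf: "ip ?P f = (\<Sum>j\<in>freqs N. (multiplier h j * cas j t) * ip f (cas j))"
    unfolding kernel_partial_def[abs_def] multiplier_def
    by (simp add: ip_sum_left unit_L2_scale cas_unit_L2 f ip_scale_left ip_commute[of f])
  have df: "ip (\<lambda>u. ?k u - ?P u) f = ip ?k f - ip ?P f" by (rule ip_diff_left[OF k P f])
  have split: "(\<Sum>j\<in>freqs N. (multiplier h j * obs_coeff \<sigma> n f j z) * cas j t)
      = (\<Sum>j\<in>freqs N. (multiplier h j * cas j t) * ip f (cas j)) + \<sigma> / sqrt (real n) * (\<Sum>j\<in>freqs N. (multiplier h j * cas j t) * W (cas j) z)" for z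
    unfolding obs_coeff_def sum_distrib_left sum.distrib[symmetric]
    by (intro sum.cong) (auto simp: algebra_simps)
  from 1 2 3 show ?thesis
  proof eventually_elim
    case (elim z)
    have "partial_estimator \<sigma> n h f N t z = ip ?P f + \<sigma> / sqrt (real n) * W ?P z"
      unfolding partial_estimator_def split Pf elim(3) ..
    moreover have "1 / h * observation W \<sigma> n f ?p z = ip ?k f + \<sigma> / sqrt (real n) * W ?k z"
      unfolding observation_eq elim(1) kf by (simp add: distrib_left)
    ultimately show ?case
      unfolding df elim(2) by (simp only: right_diff_distrib)
  qed
qed

text \<open>Bounds the second moment of an observation per unit of squared norm of the test
  function; the 2 comes from separating signal and noise by
  \<open>(x + y)^2 \<le> 2 * x^2 + 2 * y^2\<close>.\<close>

definition noise_const :: "real \<Rightarrow> nat \<Rightarrow> (real \<Rightarrow> real) \<Rightarrow> real" where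
  "noise_const \<sigma> n f = 2 * (ip f f + (\<sigma> / sqrt (real n))^2)"

lemma noise_const_nonneg: "0 \<le> noise_const \<sigma> n f"
  by (simp add: noise_const_def ip_self_nonneg)

lemma nn_integral_affine_W_sq:
  assumes d: "d \<in> unit_L2" and f: "f \<in> unit_L2"
  shows "(\<integral>\<^sup>+z. ennreal ((ip d f + \<sigma> / sqrt (real n) * W d z)^2) \<partial>M) \<le> ennreal (noise_const \<sigma> n f * ip d d)"
proof -
  let ?a = "\<sigma> / sqrt (real n)"
  note [measurable] = W_measurable[OF d]
  have i: "integrable M (\<lambda>z. 2 * (ip d f)^2 + 2 * ?a^2 * (W d z)^2)"
    using W_square(1)[OF d] by simp
  have "(\<integral>\<^sup>+z. ennreal ((ip d f + ?a * W d z)^2) \<partial>M) \<le> (\<integral>\<^sup>+z. ennreal (2 * (ip d f)^2 + 2 * ?a^2 * (W d z)^2) \<partial>M)"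
  proof (intro nn_integral_mono ennreal_leI)
    fix z
    have "(x + y)^2 \<le> 2 * x^2 + 2 * y^2" for x y :: real
      using zero_le_power2[of "x - y"] by (simp add: power2_eq_square algebra_simps)
    from this[of "ip d f" "?a * W d z"] show "(ip d f + ?a * W d z)^2 \<le> 2 * (ip d f)^2 + 2 * ?a^2 * (W d z)^2"
      by (simp only: power_mult_distrib mult.assoc)
  qed
  also have "... = ennreal (\<integral>z. 2 * (ip d f)^2 + 2 * ?a^2 * (W d z)^2 \<partial>M)"
    by (rule nn_integral_eq_integral[OF i]) auto
  also have "(\<integral>z. 2 * (ip d f)^2 + 2 * ?a^2 * (W d z)^2 \<partial>M) = 2 * (ip d f)^2 + 2 * ?a^2 * ip d d"
    using W_square[OF d] by (simp add: prob_space)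
  also have "ennreal ... \<le> ennreal (noise_const \<sigma> n f * ip d d)"
    using ip_Cauchy_Schwarz[OF d f] by (intro ennreal_leI) (simp add: noise_const_def algebra_simps)
  finally show ?thesis .
qed

text \<open>\<open>Z\<close> is any version of the estimator at \<open>t\<close>, so the bound
  serves both the construction of a jointly measurable version and the version selected by
  \<open>kernel_estimator\<close>.\<close>

lemma estimator_error:
  assumes h: "0 < h" and f: "f \<in> unit_L2" and [measurable]: "Z \<in> borel_measurable M"
    and Z: "AE z in M. Z z = 1 / h * observation W \<sigma> n f (periodize (\<lambda>u. K ((t - u) / h))) z"
  shows "(\<integral>\<^sup>+z. ennreal ((Z z - partial_estimator \<sigma> n h f N t z)^2) \<partial>M) \<le> ennreal (noise_const \<sigma> n f * kernel_tail h N)"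
proof -
  let ?d = "\<lambda>u. per_kernel K h t u - kernel_partial h N t u"
  have d: "?d \<in> unit_L2" by (intro unit_L2_diff per_kernel_unit_L2 h kernel_partial_unit_L2)
  have "(\<integral>\<^sup>+z. ennreal ((Z z - partial_estimator \<sigma> n h f N t z)^2) \<partial>M) = (\<integral>\<^sup>+z. ennreal ((ip ?d f + \<sigma> / sqrt (real n) * W ?d z)^2) \<partial>M)"
  proof (rule nn_integral_cong_AE)
    show "AE z in M. ennreal ((Z z - partial_estimator \<sigma> n h f N t z)^2) = ennreal ((ip ?d f + \<sigma> / sqrt (real n) * W ?d z)^2)"
      using observation_kernel_minus_partial[OF h f, of \<sigma> n t N] Z by eventually_elim simp
  qed
  also have "... \<le> ennreal (noise_const \<sigma> n f * ip ?d ?d)" by (rule nn_integral_affine_W_sq[OF d f])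
  finally show ?thesis unfolding ip_kernel_remainder[OF h] .
qed

text \<open>The summed squared errors have finite expectation, hence are almost surely finite, so
  their terms tend to 0.\<close>

lemma summable_L2_imp_AE_tendsto:
  fixes X :: "nat \<Rightarrow> 'a \<Rightarrow> real"
  assumes [measurable]: "\<And>k. X k \<in> borel_measurable M" "Z \<in> borel_measurable M"
    and le: "\<And>k. (\<integral>\<^sup>+z. ennreal ((Z z - X k z)^2) \<partial>M) \<le> ennreal (c k)" and c: "\<And>k. 0 \<le> c k" "summable c"
  shows "AE z in M. (\<lambda>k. X k z) \<longlonglongrightarrow> Z z"
proof -
  have "(\<integral>\<^sup>+z. (\<Sum>k. ennreal ((Z z - X k z)^2)) \<partial>M) = (\<Sum>k. \<integral>\<^sup>+z. ennreal ((Z z - X k z)^2) \<partial>M)"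
    by (rule nn_integral_suminf) auto
  also have "... \<le> (\<Sum>k. ennreal (c k))" by (intro suminf_le le) auto
  also have "... = ennreal (\<Sum>k. c k)" by (rule suminf_ennreal2[OF c])
  finally have "(\<integral>\<^sup>+z. (\<Sum>k. ennreal ((Z z - X k z)^2)) \<partial>M) < \<infinity>"
    using order_le_less_trans by fastforce
  then have "AE z in M. (\<Sum>k. ennreal ((Z z - X k z)^2)) \<noteq> \<infinity>"
    by (intro nn_integral_PInf_AE) auto
  then show ?thesis
  proof eventually_elim
    case (elim z)
    then have "summable (\<lambda>k. (Z z - X k z)^2)" by (intro summable_suminf_not_top) auto
    then have "(\<lambda>k. (Z z - X k z)^2) \<longlonglongrightarrow> 0" by (rule summable_LIMSEQ_zero)
    then have "(\<lambda>k. sqrt ((Z z - X k z)^2)) \<longlonglongrightarrow> sqrt 0" by (rule tendsto_real_sqrt)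
    then have "(\<lambda>k. \<bar>Z z - X k z\<bar>) \<longlonglongrightarrow> 0" by simp
    then have "(\<lambda>k. Z z - X k z) \<longlonglongrightarrow> 0" by (rule tendsto_rabs_zero_cancel)
    then have "(\<lambda>k. Z z - (Z z - X k z)) \<longlonglongrightarrow> Z z - 0" by (intro tendsto_diff tendsto_const)
    then show ?case by simp
  qed
qed

text \<open>Partial sums along a subsequence with summable squared errors converge almost surely for
  every single \<open>t\<close>, which gives a jointly measurable version.\<close>

lemma kernel_estimator_version:
  fixes \<sigma> :: real and n :: nat
  assumes h: "0 < h" and f: "f \<in> unit_L2"
  defines "F \<equiv> kernel_estimator M K h (observation W \<sigma> n f)"
  shows "(\<lambda>(t, z). F t z) \<in> borel_measurable (lborel \<Otimes>\<^sub>M M)"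
    and "t \<in> {0<..<1} \<Longrightarrow> AE z in M. F t z = 1 / h * observation W \<sigma> n f (periodize (\<lambda>u. K ((t - u) / h))) z"
proof -
  let ?Z = "\<lambda>t z. 1 / h * observation W \<sigma> n f (periodize (\<lambda>u. K ((t - u) / h))) z"
  have Zm [measurable]: "?Z t \<in> borel_measurable M" for t
  proof -
    have [measurable]: "W (periodize (\<lambda>u. K ((t - u) / h))) \<in> borel_measurable M"
      by (rule W_measurable[OF shifted_kernel_unit_L2[OF h]])
    show ?thesis unfolding observation_eq by measurable
  qed
  have "\<exists>N. kernel_tail h N \<le> (1 / 2) ^ k" for k
  proof -
    have "\<forall>\<^sub>F N in sequentially. kernel_tail h N < (1 / 2) ^ k"
      by (rule order_tendstoD[OF kernel_tail_tendsto_0[OF h]]) simp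
    then show ?thesis by (auto simp: eventually_sequentially intro: less_imp_le)
  qed
  then obtain N where N: "\<And>k. kernel_tail h (N k) \<le> (1 / 2) ^ k" by metis
  define X where "X = (\<lambda>t z. lim (\<lambda>k. partial_estimator \<sigma> n h f (N k) t z))"
  have "(\<lambda>x. lim (\<lambda>k. (\<lambda>(t, z). partial_estimator \<sigma> n h f (N k) t z) x)) \<in> borel_measurable (lborel \<Otimes>\<^sub>M M)"
    by (rule borel_measurable_lim_metric) (rule partial_estimator_measurable)
  then have Xm: "(\<lambda>(t, z). X t z) \<in> borel_measurable (lborel \<Otimes>\<^sub>M M)"
    by (simp add: X_def case_prod_beta')
  have XZ: "AE z in M. X t z = ?Z t z" for t
  proof -
    have "AE z in M. (\<lambda>k. partial_estimator \<sigma> n h f (N k) t z) \<longlonglongrightarrow> ?Z t z"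
    proof (rule summable_L2_imp_AE_tendsto)
      fix k
      have "(\<integral>\<^sup>+z. ennreal ((?Z t z - partial_estimator \<sigma> n h f (N k) t z)^2) \<partial>M) \<le> ennreal (noise_const \<sigma> n f * kernel_tail h (N k))"
        by (rule estimator_error[OF h f Zm]) simp
      also have "... \<le> ennreal (noise_const \<sigma> n f * (1 / 2) ^ k)"
        by (intro ennreal_leI mult_left_mono N noise_const_nonneg)
      finally show "(\<integral>\<^sup>+z. ennreal ((?Z t z - partial_estimator \<sigma> n h f (N k) t z)^2) \<partial>M) \<le> ennreal (noise_const \<sigma> n f * (1 / 2) ^ k)" .
      show "?Z t \<in> borel_measurable M" by (rule Zm)
    qed (auto simp: noise_const_nonneg intro!: summable_mult summable_geometric)
    then show ?thesis by eventually_elim (simp add: X_def limI)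
  qed
  have "(\<lambda>(t, z). F t z) \<in> borel_measurable (lborel \<Otimes>\<^sub>M M) \<and> (\<forall>t\<in>{0<..<1}. AE z in M. F t z = ?Z t z)"
    unfolding F_def kernel_estimator_def
    by (rule someI[of _ X]) (use Xm XZ in blast)
  then show "(\<lambda>(t, z). F t z) \<in> borel_measurable (lborel \<Otimes>\<^sub>M M)"
    and "t \<in> {0<..<1} \<Longrightarrow> AE z in M. F t z = ?Z t z" by auto
qed

lemma L2_norm1_section_measurable:
  assumes "(\<lambda>(t, z). F t z) \<in> borel_measurable (lborel \<Otimes>\<^sub>M M)"
  shows "(\<lambda>z. L2_norm1 (\<lambda>t. F t z)) \<in> borel_measurable M"
proof -
  have [measurable]: "(\<lambda>(z, t). F t z) \<in> borel_measurable (M \<Otimes>\<^sub>M lborel)"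
    using measurable_pair_swap[OF assms] by simp
  have "(\<lambda>z. LBINT t. indicator {0..<1} t *\<^sub>R (F t z)^2) \<in> borel_measurable M"
    by (rule lborel.borel_measurable_lebesgue_integral) measurable
  then show ?thesis unfolding L2_norm1_def set_lebesgue_integral_def by measurable
qed

text \<open>The distance is an extended integral because square integrability of a path
  \<open>F\<close> is not known in advance. If it is infinite there is nothing to show; otherwise
  Young's inequality with weight \<tau> bounds the cross term.\<close>

lemma energy_difference_bound:
  assumes F: "F \<in> borel_measurable borel" and g: "g \<in> unit_L2" and \<tau>: "0 < \<tau>"
  shows "ennreal \<bar>ip F F - ip g g\<bar> \<le> ennreal (1 + 1 / \<tau>) * (\<integral>\<^sup>+t. ennreal (indicator {0..<1} t * (F t - g t)^2) \<partial>lborel) + ennreal (\<tau> * ip g g)"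
proof (cases "(\<integral>\<^sup>+t. ennreal (indicator {0..<1} t * (F t - g t)^2) \<partial>lborel) = \<infinity>")
  case True
  then show ?thesis using \<tau> by (simp add: ennreal_mult_top add_pos_pos)
next
  case False
  have [measurable]: "F \<in> borel_measurable borel" "g \<in> borel_measurable borel" using F g by (auto simp: unit_L2_def)
  define G where "G = (\<lambda>t. F t - g t)"
  have i: "integrable lborel (\<lambda>t. indicator {0..<1} t * (G t)^2)"
    unfolding G_def
  proof (rule integrableI_nonneg)
    show "(\<integral>\<^sup>+t. ennreal (indicator {0..<1} t * (F t - g t)^2) \<partial>lborel) < \<infinity>"
      using False by (simp add: less_top)
  qed auto
  then have G: "G \<in> unit_L2" unfolding unit_L2_def set_integrable_def by (auto simp: G_def)
  have D: "(\<integral>\<^sup>+t. ennreal (indicator {0..<1} t * (F t - g t)^2) \<partial>lborel) = ennreal (ip G G)"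
  proof -
    have "ip G G = (LBINT t. indicator {0..<1} t * (G t)^2)"
      by (simp add: ip_def set_lebesgue_integral_def power2_eq_square)
    then show ?thesis using nn_integral_eq_integral[OF i] by (simp add: G_def)
  qed
  have FG: "F = (\<lambda>t. G t + g t)" by (auto simp: G_def)
  have "ip F F - ip g g = ip G G + 2 * ip G g"
    unfolding FG using G g by (simp add: ip_add_left ip_add_right unit_L2_add ip_commute[of g G])
  moreover have "\<bar>2 * ip G g\<bar> \<le> 1 / \<tau> * ip G G + \<tau> * ip g g"
  proof -
    have "0 \<le> ip (\<lambda>t. x * G t + y * g t) (\<lambda>t. x * G t + y * g t)" for x y by (rule ip_self_nonneg)
    then have "0 \<le> x^2 * ip G G + 2 * x * y * ip G g + y^2 * ip g g" for x y
      using G g by (simp add: ip_add_left ip_add_right unit_L2_add unit_L2_scale ip_scale_left ip_scale_right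
          ip_commute[of g G] power2_eq_square algebra_simps)
    \<comment> \<open>The two signs of the second weight bound the cross term from below and from
      above.\<close>
    from this[of "1 / sqrt \<tau>" "sqrt \<tau>"] this[of "1 / sqrt \<tau>" "- sqrt \<tau>"]
    show ?thesis using \<tau> by (auto simp: abs_le_iff power_divide)
  qed
  ultimately have "\<bar>ip F F - ip g g\<bar> \<le> (1 + 1 / \<tau>) * ip G G + \<tau> * ip g g"
    using ip_self_nonneg[of G] by (simp add: distrib_right)
  then have "ennreal \<bar>ip F F - ip g g\<bar> \<le> ennreal ((1 + 1 / \<tau>) * ip G G + \<tau> * ip g g)" by (rule ennreal_leI)
  also have "... = ennreal (1 + 1 / \<tau>) * ennreal (ip G G) + ennreal (\<tau> * ip g g)"
    using \<tau> by (simp add: ennreal_plus ennreal_mult ip_self_nonneg)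
  finally show ?thesis unfolding D .
qed

text \<open>The bound is free of \<open>N\<close>, so it can be multiplied by a small fixed \<tau>
  while \<open>N\<close> grows. The signal is controlled by the bound \<open>2 * B\<close> on the
  multiplier and Bessel, the noise by \<open>kernel_energy\<close>.\<close>

lemma partial_energy_expectation:
  assumes h: "0 < h" and f: "f \<in> unit_L2"
  shows "(\<integral>\<^sup>+z. ennreal (partial_energy \<sigma> n h f N z) \<partial>M) \<le> ennreal (noise_const \<sigma> n f * ((2 * B)^2 + kernel_energy h))"
proof -
  let ?m = "\<lambda>j. (multiplier h j)^2" and ?f = "\<lambda>j. (ip f (cas j))^2"
  let ?a = "\<sigma> / sqrt (real n)"
  have "(\<integral>\<^sup>+z. ennreal (partial_energy \<sigma> n h f N z) \<partial>M)
      \<le> (\<integral>\<^sup>+z. ennreal (\<Sum>j\<in>freqs N. ?m j * (2 * ?f j + 2 * ?a^2 * (W (cas j) z)^2)) \<partial>M)"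
    unfolding partial_energy_def obs_coeff_def
  proof (intro nn_integral_mono ennreal_leI sum_mono mult_left_mono)
    fix j z
    have "(x + y)^2 \<le> 2 * x^2 + 2 * y^2" for x y :: real
      using zero_le_power2[of "x - y"] by (simp add: power2_eq_square algebra_simps)
    from this[of "ip f (cas j)" "?a * W (cas j) z"]
    show "(ip f (cas j) + ?a * W (cas j) z)^2 \<le> 2 * ?f j + 2 * ?a^2 * (W (cas j) z)^2"
      by (simp only: power_mult_distrib mult.assoc)
  qed auto
  also have "... = ennreal (\<integral>z. (\<Sum>j\<in>freqs N. ?m j * (2 * ?f j + 2 * ?a^2 * (W (cas j) z)^2)) \<partial>M)"
    using W_square(1)[OF cas_unit_L2]
    by (intro nn_integral_eq_integral AE_I2 sum_nonneg Bochner_Integration.integrable_sum) auto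
  also have "(\<integral>z. (\<Sum>j\<in>freqs N. ?m j * (2 * ?f j + 2 * ?a^2 * (W (cas j) z)^2)) \<partial>M)
     = (\<Sum>j\<in>freqs N. ?m j * (2 * ?f j + 2 * ?a^2))"
    using W_square[OF cas_unit_L2] by (simp add: Bochner_Integration.integral_sum prob_space ip_cas)
  also have "... = 2 * (\<Sum>j\<in>freqs N. ?m j * ?f j) + 2 * ?a^2 * (\<Sum>j\<in>freqs N. ?m j)"
    by (simp add: sum_distrib_left sum.distrib algebra_simps)
  also have "ennreal ... \<le> ennreal (noise_const \<sigma> n f * ((2 * B)^2 + kernel_energy h))"
  proof (rule ennreal_leI)
    have "(\<Sum>j\<in>freqs N. ?m j * ?f j) \<le> (\<Sum>j\<in>freqs N. (2 * B)^2 * ?f j)"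
    proof (intro sum_mono mult_right_mono)
      fix j
      have "\<bar>multiplier h j\<bar> \<le> \<bar>2 * B\<bar>"
        using kernel_ft_bound[of "of_int j * h"] B_nonneg by (simp add: multiplier_def)
      then show "?m j \<le> (2 * B)^2" by (simp only: abs_le_square_iff)
    qed auto
    also have "... \<le> (2 * B)^2 * ip f f"
      unfolding sum_distrib_left[symmetric] by (intro mult_left_mono Bessel f) auto
    finally have 1: "(\<Sum>j\<in>freqs N. ?m j * ?f j) \<le> (2 * B)^2 * ip f f" .
    have 2: "(\<Sum>j\<in>freqs N. ?m j) \<le> kernel_energy h"
      using kernel_tail_nonneg[OF h, of N] by (simp add: kernel_tail_def multiplier_def)
    have E0: "0 \<le> kernel_energy h" by (simp add: kernel_energy_def ip_self_nonneg)
    have 3: "?a^2 * (\<Sum>j\<in>freqs N. ?m j) \<le> ?a^2 * kernel_energy h"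
      by (intro mult_left_mono 2) auto
    have "0 \<le> ip f f * kernel_energy h" "0 \<le> ?a^2 * (2 * B)^2" using E0 ip_self_nonneg[of f] by auto
    moreover have "noise_const \<sigma> n f * ((2 * B)^2 + kernel_energy h)
        = 2 * ((2 * B)^2 * ip f f) + 2 * (?a^2 * (2 * B)^2) + 2 * (ip f f * kernel_energy h) + 2 * (?a^2 * kernel_energy h)"
      unfolding noise_const_def by (simp only: distrib_left distrib_right mult_ac)
    ultimately show "2 * (\<Sum>j\<in>freqs N. ?m j * ?f j) + 2 * ?a^2 * (\<Sum>j\<in>freqs N. ?m j)
        \<le> noise_const \<sigma> n f * ((2 * B)^2 + kernel_energy h)"
      using 1 3 unfolding mult.assoc by linarith
  qed
  finally show ?thesis .
qed

section \<open>The energy of the estimator as a limit of finite quadratic forms\<close>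

definition estimator_energy :: "real \<Rightarrow> nat \<Rightarrow> real \<Rightarrow> (real \<Rightarrow> real) \<Rightarrow> 'a \<Rightarrow> real" where
  "estimator_energy \<sigma> n h f z = (L2_norm1 (\<lambda>t. kernel_estimator M K h (observation W \<sigma> n f) t z))^2"

lemma estimator_energy_measurable:
  "0 < h \<Longrightarrow> f \<in> unit_L2 \<Longrightarrow> estimator_energy \<sigma> n h f \<in> borel_measurable M"
  unfolding estimator_energy_def[abs_def]
  by (intro borel_measurable_power L2_norm1_section_measurable kernel_estimator_version)

text \<open>Fubini turns the mean square errors at the single \<open>t\<close> into an expected
  squared distance of paths, which \<open>energy_difference_bound\<close> converts into a difference
  of energies.\<close>

lemma estimator_energy_L1_error:
  assumes h: "0 < h" and f: "f \<in> unit_L2" and \<tau>: "0 < \<tau>"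
  shows "(\<integral>\<^sup>+z. ennreal \<bar>estimator_energy \<sigma> n h f z - partial_energy \<sigma> n h f N z\<bar> \<partial>M)
    \<le> ennreal ((1 + 1 / \<tau>) * (noise_const \<sigma> n f * kernel_tail h N) + \<tau> * (noise_const \<sigma> n f * ((2 * B)^2 + kernel_energy h)))"
proof -
  define F where "F = kernel_estimator M K h (observation W \<sigma> n f)"
  note Fm [measurable] = kernel_estimator_version(1)[OF h f, of \<sigma> n, folded F_def]
  note FZ = kernel_estimator_version(2)[OF h f, of _ \<sigma> n, folded F_def]
  let ?P = "partial_estimator \<sigma> n h f N"
  let ?I = "\<lambda>t z. ennreal (indicator {0..<1} t * (F t z - ?P t z)^2)" and ?c = "noise_const \<sigma> n f * kernel_tail h N" and ?E = "partial_energy \<sigma> n h f N"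
  interpret LM: pair_sigma_finite lborel M ..
  have Dm: "(\<lambda>(t, z). ?I t z) \<in> borel_measurable (lborel \<Otimes>\<^sub>M M)"
    by measurable
  have Ft [measurable]: "F t \<in> borel_measurable M" for t
    using measurable_compose[OF measurable_Pair1' Fm, of t] by simp
  have Fw [measurable]: "(\<lambda>t. F t z) \<in> borel_measurable borel" if "z \<in> space M" for z
    using measurable_compose[OF measurable_Pair2'[OF that] Fm] by simp
  have Dm2: "(\<lambda>z. \<integral>\<^sup>+t. ?I t z \<partial>lborel) \<in> borel_measurable M"
    using lborel.borel_measurable_nn_integral_fst[OF measurable_pair_swap[OF Dm]] by simp
  have "(\<integral>\<^sup>+z. (\<integral>\<^sup>+t. ?I t z \<partial>lborel) \<partial>M)
      = (\<integral>\<^sup>+t. (\<integral>\<^sup>+z. ?I t z \<partial>M) \<partial>lborel)"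
    by (rule LM.Fubini'[OF Dm])
  also have "... \<le> (\<integral>\<^sup>+t. ennreal (?c) * indicator {0..<1::real} t \<partial>lborel)"
  proof (rule nn_integral_mono_AE)
    \<comment> \<open>The estimator is prescribed on the open interval only, while the norm includes
      the point 0.\<close>
    have "AE t in lborel. t \<noteq> (0::real)" by (rule AE_lborel_singleton)
    then show "AE t in lborel. (\<integral>\<^sup>+z. ?I t z \<partial>M)
        \<le> ennreal (?c) * indicator {0..<1} t"
    proof eventually_elim
      case (elim t)
      show ?case
      proof (cases "t \<in> {0<..<1}")
        case True
        then show ?thesis using estimator_error[OF h f Ft FZ[OF True], of N] by simp
      qed (use elim in \<open>auto simp: indicator_def\<close>)
    qed
  qed
  also have "... = ennreal (?c)"
    by (subst nn_integral_cmult_indicator) auto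
  finally have D: "(\<integral>\<^sup>+z. (\<integral>\<^sup>+t. ?I t z \<partial>lborel) \<partial>M)
      \<le> ennreal (?c)" .
  have "(\<integral>\<^sup>+z. ennreal \<bar>estimator_energy \<sigma> n h f z - ?E z\<bar> \<partial>M)
     \<le> (\<integral>\<^sup>+z. ennreal (1 + 1 / \<tau>) * (\<integral>\<^sup>+t. ?I t z \<partial>lborel)
            + ennreal \<tau> * ennreal (?E z) \<partial>M)"
  proof (rule nn_integral_mono)
    fix z assume z: "z \<in> space M"
    show "ennreal \<bar>estimator_energy \<sigma> n h f z - ?E z\<bar>
      \<le> ennreal (1 + 1 / \<tau>) * (\<integral>\<^sup>+t. ?I t z \<partial>lborel)
            + ennreal \<tau> * ennreal (?E z)"
      using energy_difference_bound[OF Fw[OF z] partial_estimator_unit_L2 \<tau>, of \<sigma> n h f N z] \<tau>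
      by (simp add: estimator_energy_def F_def L2_norm1_sq ip_partial_estimator ennreal_mult partial_energy_nonneg)
  qed
  also have "... = ennreal (1 + 1 / \<tau>) * (\<integral>\<^sup>+z. (\<integral>\<^sup>+t. ?I t z \<partial>lborel) \<partial>M)
       + ennreal \<tau> * (\<integral>\<^sup>+z. ennreal (?E z) \<partial>M)"
    using Dm2 by (simp add: nn_integral_add nn_integral_cmult)
  also have "... \<le> ennreal (1 + 1 / \<tau>) * ennreal (?c)
       + ennreal \<tau> * ennreal (noise_const \<sigma> n f * ((2 * B)^2 + kernel_energy h))"
    by (intro add_mono mult_left_mono D partial_energy_expectation h f) auto
  also have "... = ennreal ((1 + 1 / \<tau>) * (?c) + \<tau> * (noise_const \<sigma> n f * ((2 * B)^2 + kernel_energy h)))"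
    using \<tau> by (simp add: ennreal_mult[symmetric] ennreal_plus[symmetric] noise_const_nonneg kernel_tail_nonneg[OF h]
        kernel_energy_def ip_self_nonneg del: ennreal_plus)
  finally show ?thesis .
qed

lemma prob_le_nn_expectation:
  fixes X :: "'a \<Rightarrow> real"
  assumes [measurable]: "X \<in> borel_measurable M" and "0 < \<delta>" "0 \<le> c"
    and le: "(\<integral>\<^sup>+z. ennreal \<bar>X z\<bar> \<partial>M) \<le> ennreal c"
  shows "prob {z \<in> space M. \<delta> < \<bar>X z\<bar>} \<le> c / \<delta>"
proof -
  have "emeasure M {z \<in> space M. 1 \<le> ennreal (1 / \<delta>) * ennreal \<bar>X z\<bar>} \<le> ennreal (1 / \<delta>) * (\<integral>\<^sup>+z. ennreal \<bar>X z\<bar> * indicator (space M) z \<partial>M)"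
    using nn_integral_Markov_inequality[where u="\<lambda>z. ennreal \<bar>X z\<bar>" and M=M and A="space M" and c="ennreal (1 / \<delta>)"] by simp
  also have "(\<integral>\<^sup>+z. ennreal \<bar>X z\<bar> * indicator (space M) z \<partial>M) = (\<integral>\<^sup>+z. ennreal \<bar>X z\<bar> \<partial>M)"
    by (intro nn_integral_cong) simp
  also have "ennreal (1 / \<delta>) * ... \<le> ennreal (1 / \<delta>) * ennreal c" by (intro mult_left_mono le) simp
  also have "... = ennreal (c / \<delta>)" using assms by (subst ennreal_mult[symmetric]) auto
  finally have "emeasure M {z \<in> space M. 1 \<le> ennreal (1 / \<delta>) * ennreal \<bar>X z\<bar>} \<le> ennreal (c / \<delta>)" .
  moreover have "emeasure M {z \<in> space M. \<delta> < \<bar>X z\<bar>} \<le> emeasure M {z \<in> space M. 1 \<le> ennreal (1 / \<delta>) * ennreal \<bar>X z\<bar>}"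
  proof (intro emeasure_mono subsetI)
    fix z assume "z \<in> {z \<in> space M. \<delta> < \<bar>X z\<bar>}"
    then have "z \<in> space M" "1 \<le> 1 / \<delta> * \<bar>X z\<bar>" using \<open>0 < \<delta>\<close> by (auto simp: field_simps)
    then have "ennreal 1 \<le> ennreal (1 / \<delta> * \<bar>X z\<bar>)" by (intro ennreal_leI)
    also have "... = ennreal (1 / \<delta>) * ennreal \<bar>X z\<bar>" using \<open>0 < \<delta>\<close> by (intro ennreal_mult) auto
    finally show "z \<in> {z \<in> space M. 1 \<le> ennreal (1 / \<delta>) * ennreal \<bar>X z\<bar>}" using \<open>z \<in> space M\<close> by simp
  qed measurable
  ultimately have "emeasure M {z \<in> space M. \<delta> < \<bar>X z\<bar>} \<le> ennreal (c / \<delta>)" by (rule order_trans[rotated])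
  then show ?thesis using assms by (simp add: emeasure_eq_measure)
qed

lemma estimator_energy_approx:
  assumes h: "0 < h" and f: "f \<in> unit_L2" and \<delta>: "0 < \<delta>" and \<epsilon>: "0 < \<epsilon>"
  shows "\<forall>\<^sub>F N in sequentially. prob {z \<in> space M. \<delta> < \<bar>estimator_energy \<sigma> n h f z - partial_energy \<sigma> n h f N z\<bar>} \<le> \<epsilon>"
proof -
  define c where "c = noise_const \<sigma> n f"
  define Q where "Q = c * ((2 * B)^2 + kernel_energy h)"
  have c0: "0 \<le> c" by (simp add: c_def noise_const_nonneg)
  have Q0: "0 \<le> Q" unfolding Q_def using c0 by (intro mult_nonneg_nonneg) (auto simp: kernel_energy_def ip_self_nonneg)
  \<comment> \<open>\<tau> is fixed first, so that the term that does not vanish with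
    \<open>N\<close> takes at most half of \<open>\<delta> * \<epsilon>\<close>; large
    \<open>N\<close> then makes the tail term small. The \<open>+ 1\<close> keeps the denominator
    positive.\<close>
  define \<tau> where "\<tau> = \<delta> * \<epsilon> / 2 / (Q + 1)"
  have \<tau>: "0 < \<tau>" using \<delta> \<epsilon> Q0 by (simp add: \<tau>_def)
  have "\<tau> * Q \<le> \<tau> * (Q + 1)" using \<tau> by simp
  also have "... = \<delta> * \<epsilon> / 2"
    unfolding \<tau>_def using Q0 by (intro nonzero_eq_divide_eq[THEN iffD1, OF _ HOL.refl]) linarith
  finally have \<tau>Q: "\<tau> * Q \<le> \<delta> * \<epsilon> / 2" .
  have "(\<lambda>N. (1 + 1 / \<tau>) * (c * kernel_tail h N)) \<longlonglongrightarrow> (1 + 1 / \<tau>) * (c * 0)"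
    by (intro tendsto_intros kernel_tail_tendsto_0 h)
  then have "\<forall>\<^sub>F N in sequentially. (1 + 1 / \<tau>) * (c * kernel_tail h N) < \<delta> * \<epsilon> / 2"
    using \<delta> \<epsilon> by (intro order_tendstoD) auto
  then show ?thesis
  proof eventually_elim
    case (elim N)
    note [measurable] = estimator_energy_measurable[OF h f]
    let ?c = "(1 + 1 / \<tau>) * (c * kernel_tail h N) + \<tau> * Q"
    have "prob {z \<in> space M. \<delta> < \<bar>estimator_energy \<sigma> n h f z - partial_energy \<sigma> n h f N z\<bar>} \<le> ?c / \<delta>"
    proof (rule prob_le_nn_expectation[OF _ \<delta>])
      show "0 \<le> ?c" using \<tau> c0 Q0 kernel_tail_nonneg[OF h, of N] by (intro add_nonneg_nonneg mult_nonneg_nonneg) auto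
      show "(\<integral>\<^sup>+z. ennreal \<bar>estimator_energy \<sigma> n h f z - partial_energy \<sigma> n h f N z\<bar> \<partial>M) \<le> ennreal ?c"
        using estimator_energy_L1_error[OF h f \<tau>] unfolding c_def Q_def .
    qed measurable
    also have "... \<le> \<epsilon>"
    proof -
      have "?c \<le> \<delta> * \<epsilon>" using elim \<tau>Q by linarith
      then show ?thesis using \<delta> by (metis mult.commute pos_divide_le_eq)
    qed
    finally show ?case .
  qed
qed

end

section \<open>Nearest points of Besov balls\<close>

text \<open>The coefficient of \<open>\<phi>\<^sub>j\<close> of a real function with coefficients \<open>a\<^sub>j\<close> with respect to \<open>cas\<close>.\<close>

definition cas_to_fourier :: "(int \<Rightarrow> real) \<Rightarrow> int \<Rightarrow> complex" where
  "cas_to_fourier a j = Complex ((a j + a (- j)) / 2) ((a (- j) - a j) / 2)"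

lemma fourier_basis_eq:
  "fourier_basis j t = Complex (cos (2 * pi * of_int j * t)) (sin (2 * pi * of_int j * t))"
proof -
  have "2 * of_real pi * \<i> * of_int j * complex_of_real t = \<i> * complex_of_real (2 * pi * of_int j * t)"
    by simp
  then show ?thesis unfolding fourier_basis_def by (simp only: cis_conv_exp[symmetric]) (simp add: complex_eq_iff)
qed

lemma cas_minus: "cas (- j) t = cos (2 * pi * of_int j * t) - sin (2 * pi * of_int j * t)"
  by (simp add: cas_def)

lemma Re_fourier_sum:
  "Re (\<Sum>j\<in>freqs N. \<theta> j * fourier_basis j t)
   = (\<Sum>j\<in>freqs N. ((Re (\<theta> j) + Re (\<theta> (- j))) / 2 + (Im (\<theta> (- j)) - Im (\<theta> j)) / 2) * cas j t)"
proof -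
  have "Re (\<Sum>j\<in>freqs N. \<theta> j * fourier_basis j t)
      = (\<Sum>j\<in>freqs N. (Re (\<theta> j) - Im (\<theta> j)) / 2 * cas j t) + (\<Sum>j\<in>freqs N. (Re (\<theta> j) + Im (\<theta> j)) / 2 * cas (- j) t)"
    unfolding Re_sum sum.distrib[symmetric]
    by (intro sum.cong) (auto simp: fourier_basis_eq cas_minus cas_def field_simps)
  also have "(\<Sum>j\<in>freqs N. (Re (\<theta> j) + Im (\<theta> j)) / 2 * cas (- j) t)
      = (\<Sum>j\<in>freqs N. (Re (\<theta> (- j)) + Im (\<theta> (- j))) / 2 * cas j t)"
    using sum_flip[of "\<lambda>j. (Re (\<theta> (- j)) + Im (\<theta> (- j))) / 2 * cas j t" N] by simp
  finally show ?thesis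
    unfolding sum.distrib[symmetric] by (simp add: add_divide_distrib diff_divide_distrib algebra_simps)
qed

lemma Im_fourier_sum:
  "Im (\<Sum>j\<in>freqs N. \<theta> j * fourier_basis j t)
   = (\<Sum>j\<in>freqs N. ((Re (\<theta> j) - Re (\<theta> (- j))) / 2 + (Im (\<theta> j) + Im (\<theta> (- j))) / 2) * cas j t)"
proof -
  have "Im (\<Sum>j\<in>freqs N. \<theta> j * fourier_basis j t) = Re (\<Sum>j\<in>freqs N. (- \<i> * \<theta> j) * fourier_basis j t)"
    by (simp add: algebra_simps)
  then show ?thesis unfolding Re_fourier_sum by (simp add: algebra_simps)
qed

lemma cas_to_fourier_sum:
  "(\<Sum>j\<in>freqs N. cas_to_fourier a j * fourier_basis j t) = of_real (\<Sum>j\<in>freqs N. a j * cas j t)"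
proof (rule complex_eqI)
  show "Re (\<Sum>j\<in>freqs N. cas_to_fourier a j * fourier_basis j t) = Re (of_real (\<Sum>j\<in>freqs N. a j * cas j t))"
    unfolding Re_fourier_sum by (simp add: cas_to_fourier_def field_simps)
  show "Im (\<Sum>j\<in>freqs N. cas_to_fourier a j * fourier_basis j t) = Im (of_real (\<Sum>j\<in>freqs N. a j * cas j t))"
    unfolding Im_fourier_sum by (simp add: cas_to_fourier_def field_simps)
qed

text \<open>Real and imaginary parts of a partial sum are sums in \<open>cas\<close> with
  coefficients \<open>b\<close> and \<open>e\<close>. Bessel at the single index \<open>k\<close>
  bounds the squared deviation of \<open>b k\<close> from the coefficient of \<open>f\<close>,
  together with the square of \<open>e k\<close>, by the approximation error, which tends to 0.
  Hence the expansion in a Besov ball is determined by the function.\<close>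

lemma fourier_expansion_coeff:
  assumes f: "f \<in> unit_L2" and exp: "fourier_expansion f \<theta>"
  shows "\<theta> k = cas_to_fourier (\<lambda>j. ip f (cas j)) k"
proof -
  define b where "b = (\<lambda>j. (Re (\<theta> j) + Re (\<theta> (- j))) / 2 + (Im (\<theta> (- j)) - Im (\<theta> j)) / 2)"
  define e where "e = (\<lambda>j. (Re (\<theta> j) - Re (\<theta> (- j))) / 2 + (Im (\<theta> j) + Im (\<theta> (- j))) / 2)"
  define g where "g = (\<lambda>N t. f t - (\<Sum>j\<in>freqs N. b j * cas j t))"
  define r where "r = (\<lambda>N t. \<Sum>j\<in>freqs N. e j * cas j t)"
  define D where "D = (\<lambda>N. LBINT t:{0..<1}. (cmod (of_real (f t) - (\<Sum>j\<in>freqs N. \<theta> j * fourier_basis j t)))^2)"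
  have lim: "D \<longlonglongrightarrow> 0" using exp by (simp add: fourier_expansion_def D_def)
  have gL: "g N \<in> unit_L2" and rL: "r N \<in> unit_L2" for N
    unfolding g_def r_def by (intro unit_L2_diff f cas_sum_unit_L2)+
  have D: "D N = ip (g N) (g N) + ip (r N) (r N)" for N
  proof -
    have "(cmod (of_real (f t) - (\<Sum>j\<in>freqs N. \<theta> j * fourier_basis j t)))^2 = g N t * g N t + r N t * r N t" for t
      unfolding cmod_power2 minus_complex.sel Re_fourier_sum Im_fourier_sum g_def r_def b_def e_def
      by (simp add: power2_eq_square)
    then show ?thesis
      unfolding D_def ip_def by (simp add: unit_L2_mult_integrable gL rL)
  qed
  have bound: "(ip f (cas k) - b k)^2 + (e k)^2 \<le> D N" if "nat \<bar>k\<bar> \<le> N" for N k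
  proof -
    have k: "k \<in> freqs N" using that by auto
    have "(ip f (cas k) - b k)^2 = (ip (g N) (cas k))^2"
      unfolding g_def using k by (simp add: ip_diff_left f cas_sum_unit_L2 cas_unit_L2 ip_cas_sum)
    also have "... \<le> ip (g N) (g N)" using Bessel[of "{k}" "g N"] gL by simp
    finally have 1: "(ip f (cas k) - b k)^2 \<le> ip (g N) (g N)" .
    have "(e k)^2 = (ip (r N) (cas k))^2" unfolding r_def using k by (simp add: ip_cas_sum)
    also have "... \<le> ip (r N) (r N)" using Bessel[of "{k}" "r N"] rL by simp
    finally show ?thesis using 1 unfolding D by simp
  qed
  have "(ip f (cas k) - b k)^2 + (e k)^2 \<le> 0" for k
    by (rule LIMSEQ_le_const[OF lim]) (use bound in blast)
  then have "ip f (cas k) - b k = 0 \<and> e k = 0" for k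
    by (metis add_nonneg_eq_0_iff antisym_conv power2_eq_iff_nonneg sum_power2_le_zero_iff zero_le_power2)
  then have "ip f (cas k) = b k" "e k = 0" "ip f (cas (- k)) = b (- k)" "e (- k) = 0" by auto
  then show ?thesis
    by (simp add: cas_to_fourier_def b_def e_def complex_eq_iff field_simps)
qed

text \<open>An identity for symmetric ranges, not for single terms: each term on the left is the
  mean of the squares of \<open>a j\<close> and \<open>a (- j)\<close>.\<close>

lemma cmod_cas_to_fourier_sum:
  "(\<Sum>j\<in>freqs N. (cmod (cas_to_fourier a j))^2) = (\<Sum>j\<in>freqs N. (a j)^2)"
proof -
  have "(cmod (cas_to_fourier a j))^2 = (a j)^2 / 2 + (a (- j))^2 / 2" for j
    unfolding cas_to_fourier_def cmod_power2 by (simp add: power2_eq_square field_simps)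
  then have "(\<Sum>j\<in>freqs N. (cmod (cas_to_fourier a j))^2)
     = (\<Sum>j\<in>freqs N. (a j)^2 / 2) + (\<Sum>j\<in>freqs N. (a (- j))^2 / 2)"
    by (simp add: sum.distrib)
  then show ?thesis
    unfolding sum_flip[of "\<lambda>j. (a j)^2 / 2"] by (simp add: sum_divide_distrib[symmetric])
qed

text \<open>Every finite set of frequencies lies in a symmetric range, where Bessel applies. A
  family that is not summable has \<open>infsum\<close> zero by convention.\<close>

lemma infsum_fourier_le:
  assumes f: "f \<in> unit_L2" and exp: "fourier_expansion f \<theta>"
  shows "(\<Sum>\<^sub>\<infinity>j\<in>A. (cmod (\<theta> j))^2) \<le> ip f f"
proof (cases "(\<lambda>j. (cmod (\<theta> j))^2) summable_on A")
  case True
  then show ?thesis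
  proof (rule infsum_le_finite_sums)
    fix F assume F: "finite F" "F \<subseteq> A"
    define m where "m = (\<Sum>j\<in>F. \<bar>j\<bar>)"
    have m: "\<bar>j\<bar> \<le> m" if "j \<in> F" for j
      unfolding m_def by (rule member_le_sum[OF that]) (auto intro: F)
    have "F \<subseteq> freqs (nat m)" using m by fastforce
    then have "(\<Sum>j\<in>F. (cmod (\<theta> j))^2) \<le> (\<Sum>j\<in>freqs (nat m). (cmod (\<theta> j))^2)"
      by (intro sum_mono2) auto
    also have "... \<le> ip f f"
      unfolding fourier_expansion_coeff[OF f exp] cmod_cas_to_fourier_sum by (rule Bessel) (auto intro: f)
    finally show "(\<Sum>j\<in>F. (cmod (\<theta> j))^2) \<le> ip f f" .
  qed
qed (simp add: infsum_not_exists ip_self_nonneg)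

text \<open>Tails beyond \<open>\<Lambda> \<ge> J\<close> do not see the added terms. For
  \<open>\<Lambda> < J\<close> the weight is at most \<open>real J powr (2 * s)\<close> and the tail
  at most the whole squared norm, which is what \<open>small\<close> controls.\<close>

lemma besov_ball_add_low_frequencies:
  assumes g: "g \<in> besov_ball s P\<^sub>0" and "0 < s"
    and small: "real J powr (2 * s) * (L2_norm1 (\<lambda>t. g t + (\<Sum>j\<in>freqs J. b j * cas j t)))^2 \<le> P\<^sub>0"
  shows "(\<lambda>t. g t + (\<Sum>j\<in>freqs J. b j * cas j t)) \<in> besov_ball s P\<^sub>0"
proof -
  define g' where "g' = (\<lambda>t. g t + (\<Sum>j\<in>freqs J. b j * cas j t))"
  obtain \<theta> where gper: "g \<in> L2_per" and exp: "fourier_expansion g \<theta>"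
    and ball: "\<And>\<Lambda>. 0 < \<Lambda> \<Longrightarrow> \<Lambda> powr (2 * s) * (\<Sum>\<^sub>\<infinity>j\<in>{j. \<Lambda> < \<bar>real_of_int j\<bar>}. (cmod (\<theta> j))^2) \<le> P\<^sub>0"
    using g unfolding besov_ball_def by blast
  have gL: "g \<in> unit_L2" using gper by (simp add: L2_per_def)
  then have g'L: "g' \<in> unit_L2" unfolding g'_def by (intro unit_L2_add cas_sum_unit_L2)
  have "cas j (t + 1) = cas j t" for j t using cas_add_int[of j t 1] by simp
  then have g'per: "g' \<in> L2_per" using gper g'L by (simp add: L2_per_def g'_def)
  define b' where "b' = (\<lambda>j. if j \<in> freqs J then b j else 0)"
  define \<theta>' where "\<theta>' = (\<lambda>j. \<theta> j + cas_to_fourier b' j)"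
  have eq: "of_real (g' t) - (\<Sum>j\<in>freqs N. \<theta>' j * fourier_basis j t)
      = of_real (g t) - (\<Sum>j\<in>freqs N. \<theta> j * fourier_basis j t)" if "J \<le> N" for N t
  proof -
    have "(\<Sum>j\<in>freqs N. b' j * cas j t) = (\<Sum>j\<in>freqs J. b j * cas j t)"
      by (rule sum.mono_neutral_cong_right) (use that in \<open>auto simp: b'_def\<close>)
    then show ?thesis
      by (simp add: \<theta>'_def distrib_right sum.distrib cas_to_fourier_sum g'_def)
  qed
  have exp': "fourier_expansion g' \<theta>'"
    unfolding fourier_expansion_def
  proof (rule Lim_transform_eventually)
    show "(\<lambda>N. LBINT t:{0..<1}. (cmod (of_real (g t) - (\<Sum>j\<in>freqs N. \<theta> j * fourier_basis j t)))^2) \<longlonglongrightarrow> 0"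
      using exp by (simp add: fourier_expansion_def)
    show "\<forall>\<^sub>F N in sequentially. (LBINT t:{0..<1}. (cmod (of_real (g t) - (\<Sum>j\<in>freqs N. \<theta> j * fourier_basis j t)))^2)
       = (LBINT t:{0..<1}. (cmod (of_real (g' t) - (\<Sum>j\<in>freqs N. \<theta>' j * fourier_basis j t)))^2)"
      using eventually_ge_at_top[of J] by eventually_elim (simp add: eq)
  qed
  have "\<Lambda> powr (2 * s) * (\<Sum>\<^sub>\<infinity>j\<in>{j. \<Lambda> < \<bar>real_of_int j\<bar>}. (cmod (\<theta>' j))^2) \<le> P\<^sub>0" if \<Lambda>: "0 < \<Lambda>" for \<Lambda>
  proof (cases "\<Lambda> < real J")
    case True
    have "\<Lambda> powr (2 * s) * (\<Sum>\<^sub>\<infinity>j\<in>{j. \<Lambda> < \<bar>real_of_int j\<bar>}. (cmod (\<theta>' j))^2) \<le> real J powr (2 * s) * ip g' g'"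
      using True \<Lambda> \<open>0 < s\<close>
      by (intro mult_mono powr_mono2 infsum_fourier_le[OF g'L exp']) (auto intro: infsum_nonneg)
    then show ?thesis using small unfolding g'_def L2_norm1_sq by linarith
  next
    case False
    have "(\<Sum>\<^sub>\<infinity>j\<in>{j. \<Lambda> < \<bar>real_of_int j\<bar>}. (cmod (\<theta>' j))^2) = (\<Sum>\<^sub>\<infinity>j\<in>{j. \<Lambda> < \<bar>real_of_int j\<bar>}. (cmod (\<theta> j))^2)"
    proof (rule infsum_cong)
      fix j assume "j \<in> {j. \<Lambda> < \<bar>real_of_int j\<bar>}"
      then have "b' j = 0" "b' (- j) = 0" using False by (auto simp: b'_def)
      then have "cas_to_fourier b' j = 0" by (simp add: cas_to_fourier_def complex_eq_iff)
      then show "(cmod (\<theta>' j))^2 = (cmod (\<theta> j))^2" by (simp add: \<theta>'_def)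
    qed
    then show ?thesis using ball[OF \<Lambda>] by simp
  qed
  then show ?thesis
    using g'per exp' unfolding besov_ball_def g'_def[symmetric] by blast
qed

lemma zero_in_besov_ball: "0 \<le> P\<^sub>0 \<Longrightarrow> (\<lambda>t. 0) \<in> besov_ball s P\<^sub>0"
  unfolding besov_ball_def L2_per_def fourier_expansion_def
  by (auto simp: unit_L2_zero set_lebesgue_integral_def intro!: exI[of _ "\<lambda>_. 0"])

text \<open>Let \<open>d\<close> be the difference and \<open>p\<close> its projection to the
  frequencies up to \<open>J\<close>. Since 0 is in the ball, \<open>d\<close> and \<open>p\<close>
  have norm at most that of \<open>f\<close> and \<open>g\<close> at most twice that, so
  \<open>g + p\<close> has norm at most three times that of \<open>f\<close>; this is the 9 in
  \<open>small\<close>, and it keeps \<open>g + p\<close> in the ball. Minimality of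
  \<open>d\<close> against \<open>d - p\<close> then forces \<open>p\<close> to vanish.\<close>

lemma nearest_point_low_frequencies:
  assumes f: "f \<in> unit_L2" and near: "nearest_point (dilate \<gamma> (besov_ball s P\<^sub>0)) f g"
    and "0 < \<gamma>" "0 < s" "0 < P\<^sub>0"
    and small: "real J powr (2 * s) * (9 * ip f f) \<le> \<gamma>^2 * P\<^sub>0"
  shows "g \<in> unit_L2" "L2_norm1 (\<lambda>t. f t - g t) \<le> L2_norm1 f"
    and "\<bar>j\<bar> \<le> int J \<Longrightarrow> ip (\<lambda>t. f t - g t) (cas j) = 0"
proof -
  let ?V = "dilate \<gamma> (besov_ball s P\<^sub>0)"
  obtain g\<^sub>0 where g\<^sub>0: "g\<^sub>0 \<in> besov_ball s P\<^sub>0" "g = (\<lambda>t. \<gamma> * g\<^sub>0 t)"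
    using near by (auto simp: nearest_point_def dilate_def)
  have g\<^sub>0L: "g\<^sub>0 \<in> unit_L2" using g\<^sub>0(1) by (simp add: besov_ball_def L2_per_def)
  then show gL: "g \<in> unit_L2" unfolding g\<^sub>0(2) by (rule unit_L2_scale)
  have norm_swap: "L2_norm1 (\<lambda>t. u t - v t) = L2_norm1 (\<lambda>t. v t - u t)" for u v
    by (simp add: L2_norm1_def power2_commute)
  have min: "L2_norm1 (\<lambda>t. f t - g t) \<le> L2_norm1 (\<lambda>t. f t - v t)" if "v \<in> ?V" for v
  proof -
    have "L2_norm1 (\<lambda>t. g t - f t) = (INF g'\<in>?V. L2_norm1 (\<lambda>t. g' t - f t))"
      using near by (simp add: nearest_point_def)
    also have "... \<le> L2_norm1 (\<lambda>t. v t - f t)"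
      by (rule cINF_lower[OF _ that]) (auto intro!: bdd_belowI2[of _ 0] L2_norm1_nonneg)
    finally show ?thesis by (simp only: norm_swap[of f])
  qed
  have "(\<lambda>t. 0) \<in> ?V"
    using zero_in_besov_ball[of P\<^sub>0 s] \<open>0 < P\<^sub>0\<close> by (auto simp: dilate_def image_iff intro!: bexI[of _ "\<lambda>t. 0"])
  from min[OF this] show fg: "L2_norm1 (\<lambda>t. f t - g t) \<le> L2_norm1 f" by simp
  define d where "d = (\<lambda>t. f t - g t)"
  have dL: "d \<in> unit_L2" unfolding d_def by (intro unit_L2_diff f gL)
  define p where "p = (\<lambda>t. \<Sum>j\<in>freqs J. ip d (cas j) * cas j t)"
  have pL: "p \<in> unit_L2" unfolding p_def by (rule cas_sum_unit_L2)
  have dp: "ip (\<lambda>t. d t - p t) (\<lambda>t. d t - p t) = ip d d - (\<Sum>j\<in>freqs J. (ip d (cas j))^2)"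
    unfolding p_def by (subst ip_minus_cas_sum) (auto simp: dL)
  have g'norm: "L2_norm1 (\<lambda>t. g t + p t) \<le> 3 * L2_norm1 f"
  proof -
    have "L2_norm1 g \<le> 2 * L2_norm1 f"
    proof -
      have "L2_norm1 (\<lambda>t. f t + (- 1) * d t) \<le> L2_norm1 f + L2_norm1 (\<lambda>t. (- 1) * d t)"
        by (rule L2_norm1_triangle[OF f unit_L2_scale[OF dL]])
      then show ?thesis using fg unfolding L2_norm1_scale by (simp add: d_def)
    qed
    moreover have "L2_norm1 p \<le> L2_norm1 f"
    proof -
      have "(L2_norm1 p)^2 \<le> (L2_norm1 d)^2"
        unfolding L2_norm1_sq p_def by (subst ip_cas_sums) (use Bessel[of "freqs J" d] dL in \<open>auto simp: power2_eq_square\<close>)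
      then have "L2_norm1 p \<le> L2_norm1 d" by (rule power2_le_imp_le) (rule L2_norm1_nonneg)
      then show ?thesis using fg by (simp add: d_def)
    qed
    moreover have "L2_norm1 (\<lambda>t. g t + p t) \<le> L2_norm1 g + L2_norm1 p" by (rule L2_norm1_triangle[OF gL pL])
    ultimately show ?thesis by linarith
  qed
  define g' where "g' = (\<lambda>t. g\<^sub>0 t + (\<Sum>j\<in>freqs J. (ip d (cas j) / \<gamma>) * cas j t))"
  have g': "(\<lambda>t. g t + p t) = (\<lambda>t. \<gamma> * g' t)"
    using \<open>0 < \<gamma>\<close> by (auto simp: g'_def g\<^sub>0(2) p_def distrib_left sum_distrib_left)
  have "real J powr (2 * s) * ip g' g' \<le> P\<^sub>0"
  proof -
    have "\<gamma>^2 * ip g' g' = (L2_norm1 (\<lambda>t. g t + p t))^2"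
      unfolding L2_norm1_sq g' ip_scale_left ip_scale_right by (simp add: power2_eq_square)
    also have "... \<le> (3 * L2_norm1 f)^2" by (rule power_mono[OF g'norm L2_norm1_nonneg])
    also have "... = 9 * ip f f" by (simp add: power_mult_distrib L2_norm1_sq)
    finally have "real J powr (2 * s) * (\<gamma>^2 * ip g' g') \<le> real J powr (2 * s) * (9 * ip f f)" by (rule mult_left_mono) simp
    then have "\<gamma>^2 * (real J powr (2 * s) * ip g' g') \<le> \<gamma>^2 * P\<^sub>0" using small by (simp add: mult_ac)
    then show ?thesis using \<open>0 < \<gamma>\<close> by simp
  qed
  then have "g' \<in> besov_ball s P\<^sub>0"
    unfolding g'_def L2_norm1_sq[symmetric] by (rule besov_ball_add_low_frequencies[OF g\<^sub>0(1) \<open>0 < s\<close>])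
  then have "(\<lambda>t. g t + p t) \<in> ?V" unfolding g' dilate_def by blast
  from min[OF this] have "L2_norm1 d \<le> L2_norm1 (\<lambda>t. d t - p t)" by (simp add: d_def diff_diff_eq)
  then have "(L2_norm1 d)^2 \<le> (L2_norm1 (\<lambda>t. d t - p t))^2" by (intro power_mono L2_norm1_nonneg)
  then have "(\<Sum>j\<in>freqs J. (ip d (cas j))^2) \<le> 0" unfolding L2_norm1_sq dp by simp
  then have z: "(\<Sum>j\<in>freqs J. (ip d (cas j))^2) = 0" by (intro antisym sum_nonneg) auto
  assume "\<bar>j\<bar> \<le> int J"
  then have "j \<in> freqs J" by auto
  then show "ip (\<lambda>t. f t - g t) (cas j) = 0"
    using z by (subst (asm) sum_nonneg_eq_0_iff) (auto simp: d_def)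
qed

section \<open>Error probabilities\<close>

text \<open>The two events differ only where the variables are more than \<delta> apart or where
  \<open>Y\<close> comes within \<delta> of the level.\<close>

lemma (in prob_space) prob_le_threshold_diff:
  fixes X Y :: "'a \<Rightarrow> real"
  assumes [measurable]: "X \<in> borel_measurable M" "Y \<in> borel_measurable M"
  shows "\<bar>prob {z \<in> space M. X z \<le> x} - prob {z \<in> space M. Y z \<le> x}\<bar>
    \<le> prob {z \<in> space M. \<delta> < \<bar>X z - Y z\<bar>} + prob {z \<in> space M. \<bar>Y z - x\<bar> \<le> \<delta>}"
proof -
  let ?D = "{z \<in> space M. \<delta> < \<bar>X z - Y z\<bar>}" and ?N = "{z \<in> space M. \<bar>Y z - x\<bar> \<le> \<delta>}"
  have le: "prob A \<le> prob B + (prob ?D + prob ?N)"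
    if [measurable]: "A \<in> events" "B \<in> events"
      and sub: "A \<subseteq> B \<union> (?D \<union> ?N)" for A B
  proof -
    have "prob A \<le> prob (B \<union> (?D \<union> ?N))"
      by (rule finite_measure_mono[OF sub]) measurable
    also have "... \<le> prob B + prob (?D \<union> ?N)"
      by (rule measure_Un_le) measurable
    also have "prob (?D \<union> ?N)
        \<le> prob ?D + prob ?N"
      by (rule measure_Un_le) measurable
    finally show ?thesis by simp
  qed
  have "prob {z \<in> space M. X z \<le> x} \<le> prob {z \<in> space M. Y z \<le> x}
      + (prob ?D + prob ?N)"
    by (rule le) auto
  moreover have "prob {z \<in> space M. Y z \<le> x} \<le> prob {z \<in> space M. X z \<le> x}
      + (prob ?D + prob ?N)"
    by (rule le) auto
  ultimately show ?thesis by linarith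
qed

text \<open>If m is the floor of \<open>w / h\<close>, there are 2m + 1 integers of modulus at most
  m, and this is at least \<open>w / h\<close> even for m = 0.\<close>

lemma card_freqs_below:
  assumes "0 < h" "0 < w" "w / h \<le> real N"
  shows "w / h \<le> real (card {j \<in> freqs N. \<bar>of_int j * h\<bar> \<le> w})"
proof -
  define m where "m = nat \<lfloor>w / h\<rfloor>"
  have pos: "0 \<le> w / h" using assms by simp
  have m: "real m \<le> w / h" "w / h \<le> real m + 1"
    unfolding m_def using pos by (simp_all add: of_nat_nat)
  have sub: "{- int m..int m} \<subseteq> {j \<in> freqs N. \<bar>of_int j * h\<bar> \<le> w}"
  proof
    fix j assume j: "j \<in> {- int m..int m}"
    then have "\<bar>real_of_int j\<bar> \<le> real m" by (simp add: abs_le_iff)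
    then have "\<bar>real_of_int j\<bar> \<le> w / h" using m by linarith
    then have 1: "\<bar>of_int j * h\<bar> \<le> w" using assms by (simp add: abs_mult field_simps)
    have "real m \<le> real N" using m assms by linarith
    then have "m \<le> N" by simp
    then show "j \<in> {j \<in> freqs N. \<bar>of_int j * h\<bar> \<le> w}" using j 1 by auto
  qed
  have fin: "finite {j \<in> freqs N. \<bar>of_int j * h\<bar> \<le> w}"
    by (rule finite_subset[of _ "freqs N"]) auto
  have "w / h \<le> real (card {- int m..int m})" using m by simp
  also have "... \<le> real (card {j \<in> freqs N. \<bar>of_int j * h\<bar> \<le> w})"
    by (intro of_nat_mono card_mono[OF fin sub])
  finally show ?thesis .
qed

section \<open>The test statistic and its error probabilities\<close>

context kernel_model
begin

definition stat_scale :: "real \<Rightarrow> nat \<Rightarrow> real \<Rightarrow> real" where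
  "stat_scale \<sigma> n h = real n * sqrt h / (\<sigma>^2 * kernel_kappa K)"

definition center :: "real \<Rightarrow> nat \<Rightarrow> real \<Rightarrow> real" where
  "center \<sigma> n h = \<sigma>^2 / (real n * h) * (LBINT t. (K t)^2)"

definition partial_stat :: "real \<Rightarrow> nat \<Rightarrow> real \<Rightarrow> (real \<Rightarrow> real) \<Rightarrow> nat \<Rightarrow> 'a \<Rightarrow> real" where
  "partial_stat \<sigma> n h f N z = stat_scale \<sigma> n h * (partial_energy \<sigma> n h f N z - center \<sigma> n h)"

abbreviation stat :: "real \<Rightarrow> nat \<Rightarrow> real \<Rightarrow> (real \<Rightarrow> real) \<Rightarrow> 'a \<Rightarrow> real" where
  "stat \<sigma> n h f \<equiv> kernel_stat M K \<sigma> n h (observation W \<sigma> n f)"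

lemma stat_eq: "stat \<sigma> n h f z = stat_scale \<sigma> n h * (estimator_energy \<sigma> n h f z - center \<sigma> n h)"
  by (simp add: kernel_stat_def stat_scale_def center_def estimator_energy_def)

lemma stat_measurable: "0 < h \<Longrightarrow> f \<in> unit_L2 \<Longrightarrow> stat \<sigma> n h f \<in> borel_measurable M"
  unfolding stat_eq[abs_def] using estimator_energy_measurable[of h f \<sigma> n] by measurable

lemma partial_stat_measurable [measurable]: "partial_stat \<sigma> n h f N \<in> borel_measurable M"
  unfolding partial_stat_def by measurable

lemma stat_scale_pos: "kernel_kappa K > 0 \<Longrightarrow> \<sigma> > 0 \<Longrightarrow> n \<ge> 1 \<Longrightarrow> h > 0 \<Longrightarrow> stat_scale \<sigma> n h > 0"
  by (simp add: stat_scale_def)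

lemma stat_approx:
  assumes "kernel_kappa K > 0" "\<sigma> > 0" "n \<ge> 1" "h > 0" "f \<in> unit_L2" "\<delta> > 0" "\<epsilon> > 0"
  shows "\<forall>\<^sub>F N in sequentially. prob {z \<in> space M. \<delta> < \<bar>stat \<sigma> n h f z - partial_stat \<sigma> n h f N z\<bar>} \<le> \<epsilon>"
proof -
  have s: "stat_scale \<sigma> n h > 0" using assms by (intro stat_scale_pos)
  have eq: "\<delta> < \<bar>stat \<sigma> n h f z - partial_stat \<sigma> n h f N z\<bar>
      \<longleftrightarrow> \<delta> / stat_scale \<sigma> n h < \<bar>estimator_energy \<sigma> n h f z - partial_energy \<sigma> n h f N z\<bar>" for N z
  proof -
    have "stat \<sigma> n h f z - partial_stat \<sigma> n h f N z = stat_scale \<sigma> n h * (estimator_energy \<sigma> n h f z - partial_energy \<sigma> n h f N z)"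
      unfolding stat_eq partial_stat_def by (simp add: algebra_simps)
    then show ?thesis using s by (simp add: abs_mult pos_divide_less_eq mult.commute)
  qed
  show ?thesis unfolding eq
    by (rule estimator_energy_approx) (use assms s in auto)
qed

text \<open>In units of the noise level the weights are \<open>sqrt h / kernel_kappa K\<close> times
  the squared multiplier. At least \<open>w / h\<close> frequencies have multiplier at least 1/2,
  each contributing at least \<open>h / (16 * (kernel_kappa K)^2)\<close> to the sum of squared
  weights. The bandwidth cancels, so \<delta> can be fixed before \<open>n\<close>, \<open>h\<close>
  and \<open>f\<close>; centering only moves the level \<open>x\<close>.\<close>

lemma partial_stat_anti_concentration:
  assumes \<kappa>: "kernel_kappa K > 0" and \<sigma>: "\<sigma> > 0" and \<epsilon>: "\<epsilon> > 0"
  obtains \<delta> where "0 < \<delta>" "\<And>n h f x. n \<ge> 1 \<Longrightarrow> h > 0 \<Longrightarrow>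
    \<forall>\<^sub>F N in sequentially. prob {z \<in> space M. \<bar>partial_stat \<sigma> n h f N z - x\<bar> \<le> \<delta>} \<le> \<epsilon>"
proof -
  let ?\<kappa> = "kernel_kappa K"
  define w where "w = 1 / (8 * pi * (B + 1))"
  have w: "0 < w" using B_nonneg by (simp add: w_def)
  have b: "0 < w / (16 * ?\<kappa>^2)" using w \<kappa> by simp
  obtain \<delta> where \<delta>: "0 < \<delta>"
    and anti: "\<And>J (\<xi> :: int \<Rightarrow> 'a \<Rightarrow> real) c m x. finite J \<Longrightarrow> indep_vars (\<lambda>_. borel) \<xi> J \<Longrightarrow>
       (\<And>j. j \<in> J \<Longrightarrow> distr M borel (\<xi> j) = std_normal_distribution) \<Longrightarrow> w / (16 * ?\<kappa>^2) \<le> (\<Sum>j\<in>J. (c j)^2) \<Longrightarrow>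
       prob {z \<in> space M. \<bar>(\<Sum>j\<in>J. c j * (m j + \<xi> j z)^2) - x\<bar> \<le> \<delta>} \<le> \<epsilon>"
    by (rule quadratic_form_anti_concentration[OF b \<epsilon>], rule that, assumption, blast)
  show ?thesis
  proof
    show "0 < \<delta>" by (rule \<delta>)
    fix n :: nat and h :: real and f and x :: real
    assume n: "n \<ge> 1" and h: "h > 0"
    let ?a = "\<sigma> / sqrt (real n)"
    have a: "0 < ?a" using \<sigma> n by simp
    define c where "c = (\<lambda>j. stat_scale \<sigma> n h * (multiplier h j)^2 * ?a^2)"
    define m where "m = (\<lambda>j. ip f (cas j) / ?a)"
    have sa: "stat_scale \<sigma> n h * ?a^2 = sqrt h / ?\<kappa>"
      using n \<sigma> by (simp add: stat_scale_def power_divide)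
    show "\<forall>\<^sub>F N in sequentially. prob {z \<in> space M. \<bar>partial_stat \<sigma> n h f N z - x\<bar> \<le> \<delta>} \<le> \<epsilon>"
      using eventually_ge_at_top[of "nat \<lceil>w / h\<rceil>"]
    proof eventually_elim
      case (elim N)
      then have N: "w / h \<le> real N" by linarith
      have ps: "partial_stat \<sigma> n h f N z - x = (\<Sum>j\<in>freqs N. c j * (m j + W (cas j) z)^2) - (x + stat_scale \<sigma> n h * center \<sigma> n h)" for z
      proof -
        have "c j * (m j + W (cas j) z)^2 = stat_scale \<sigma> n h * ((multiplier h j)^2 * (obs_coeff \<sigma> n f j z)^2)" for j
        proof -
          have "obs_coeff \<sigma> n f j z = ?a * (m j + W (cas j) z)"
          proof -
            have gen: "A + b * v = b * (A / b + v)" if "b \<noteq> 0" for A b v :: real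
              using that by (simp add: distrib_left)
            show ?thesis unfolding obs_coeff_def m_def by (rule gen[OF less_imp_neq[OF a, symmetric]])
          qed
          then show ?thesis by (simp only: c_def power_mult_distrib mult_ac)
        qed
        then show ?thesis
          by (simp add: partial_stat_def partial_energy_def sum_distrib_left[symmetric] right_diff_distrib)
      qed
      have "w / (16 * ?\<kappa>^2) \<le> (\<Sum>j\<in>freqs N. (c j)^2)"
      proof -
        let ?L = "{j \<in> freqs N. \<bar>of_int j * h\<bar> \<le> w}"
        have cj: "c j = sqrt h / ?\<kappa> * (multiplier h j)^2" for j
          unfolding c_def sa[symmetric] by (simp only: mult_ac)
        have low: "h / (16 * ?\<kappa>^2) \<le> (c j)^2" if "j \<in> ?L" for j
        proof -
          have "1 / 2 \<le> multiplier h j"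
            unfolding multiplier_def using that by (intro kernel_ft_near_0) (simp add: w_def)
          then have "(1 / 2) ^ 4 \<le> (multiplier h j) ^ 4" by (intro power_mono) auto
          then have "h / ?\<kappa>^2 * (1 / 2) ^ 4 \<le> h / ?\<kappa>^2 * (multiplier h j) ^ 4" using h by (intro mult_left_mono) auto
          also have "... = (c j)^2" unfolding cj using h by (simp add: power_mult_distrib power_divide)
          finally show ?thesis by (simp add: power_divide mult.commute)
        qed
        have "w / (16 * ?\<kappa>^2) = w / h * (h / (16 * ?\<kappa>^2))" using h by simp
        also have "... \<le> real (card ?L) * (h / (16 * ?\<kappa>^2))"
          using h by (intro mult_right_mono card_freqs_below w N) auto
        also have "... = (\<Sum>j\<in>?L. h / (16 * ?\<kappa>^2))" by simp
        also have "... \<le> (\<Sum>j\<in>?L. (c j)^2)" by (intro sum_mono low)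
        also have "... \<le> (\<Sum>j\<in>freqs N. (c j)^2)" by (intro sum_mono2) auto
        finally show ?thesis .
      qed
      then show ?case unfolding ps
        by (intro anti indep_W_cas distr_W_cas) auto
    qed
  qed
qed

text \<open>Both signals are observed with the same noise, so the squares of the noise cancel,
  leaving a deterministic term and a term linear in the noise.\<close>

lemma partial_energy_diff:
  "partial_energy \<sigma> n h p N z - partial_energy \<sigma> n h q N z
   = (\<Sum>j\<in>freqs N. (multiplier h j)^2 * ((ip p (cas j))^2 - (ip q (cas j))^2))
     + 2 * (\<sigma> / sqrt (real n)) * (\<Sum>j\<in>freqs N. ((multiplier h j)^2 * (ip p (cas j) - ip q (cas j))) * W (cas j) z)"
  unfolding partial_energy_def obs_coeff_def sum_distrib_left sum_subtractf[symmetric] sum.distrib[symmetric]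
  by (intro sum.cong) (auto simp: power2_eq_square algebra_simps)

lemma noise_sum_expectation:
  "(\<integral>\<^sup>+z. ennreal ((\<Sum>j\<in>freqs N. e j * W (cas j) z)^2) \<partial>M) = ennreal (\<Sum>j\<in>freqs N. (e j)^2)"
proof -
  let ?g = "\<lambda>u. \<Sum>j\<in>freqs N. e j * cas j u"
  have "(\<integral>\<^sup>+z. ennreal ((\<Sum>j\<in>freqs N. e j * W (cas j) z)^2) \<partial>M) = (\<integral>\<^sup>+z. ennreal ((W ?g z)^2) \<partial>M)"
    using W_sum[of "freqs N" cas e, OF _ cas_unit_L2] by (intro nn_integral_cong_AE) (auto elim!: eventually_mono)
  also have "... = ennreal (\<integral>z. (W ?g z)^2 \<partial>M)"
    by (rule nn_integral_eq_integral) (auto intro: W_square cas_sum_unit_L2)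
  also have "(\<integral>z. (W ?g z)^2 \<partial>M) = (\<Sum>j\<in>freqs N. (e j)^2)"
    unfolding W_square(2)[OF cas_sum_unit_L2] by (subst ip_cas_sums) (auto simp: power2_eq_square)
  finally show ?thesis .
qed

text \<open>\<open>y1\<close> keeps the deterministic part below \<open>\<delta> / 2\<close>, and
  \<open>y2\<close> is Chebyshev's inequality for the linear noise at level
  \<open>\<delta> / 2\<close>. The 32 is 4 from squaring the factor 2 of the noise term, 2 from the
  squared coefficient difference and 4 from halving \<delta>. The scale of the statistic leads to
  \<open>G1\<close> in the first part and, multiplied by the noise level and squared, to
  \<open>G2\<close> in the second.\<close>

lemma partial_stat_close:
  assumes \<kappa>: "kernel_kappa K > 0" and \<sigma>: "\<sigma> > 0" and n: "n \<ge> 1" and h: "h > 0"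
    and p: "p \<in> unit_L2" and q: "q \<in> unit_L2" and \<delta>: "0 < \<delta>"
    and low: "\<And>j. \<bar>j\<bar> \<le> int J \<Longrightarrow> ip p (cas j) = ip q (cas j)"
    and high: "\<And>j. int J < \<bar>j\<bar> \<Longrightarrow> (multiplier h j)^2 \<le> y"
    and G1: "real n * sqrt h * (ip p p + ip q q) \<le> G" and G2: "real n * h * (ip p p + ip q q) \<le> G"
    and y1: "y * G / (\<sigma>^2 * kernel_kappa K) \<le> \<delta> / 2"
    and y2: "32 * y^2 * G / (\<sigma>^2 * (kernel_kappa K)^2 * \<delta>^2) \<le> \<epsilon>"
  shows "prob {z \<in> space M. \<delta> < \<bar>partial_stat \<sigma> n h p N z - partial_stat \<sigma> n h q N z\<bar>} \<le> \<epsilon>"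
proof -
  let ?s = "stat_scale \<sigma> n h" and ?A = "\<lambda>j. (ip p (cas j))^2" and ?B = "\<lambda>j. (ip q (cas j))^2" and ?T = "\<lambda>z. partial_stat \<sigma> n h p N z - partial_stat \<sigma> n h q N z"
  let ?\<kappa> = "kernel_kappa K" and ?a = "\<sigma> / sqrt (real n)" and ?S = "ip p p + ip q q"
  have y0: "0 \<le> y" using high[of "int J + 1"] by (intro order_trans[OF zero_le_power2]) simp
  define d where "d = (\<lambda>j. ip p (cas j) - ip q (cas j))"
  define e where "e = (\<lambda>j. (multiplier h j)^2 * d j)"
  define D where "D = (\<Sum>j\<in>freqs N. (multiplier h j)^2 * (?A j - ?B j))"
  define Y where "Y = (\<lambda>z. \<Sum>j\<in>freqs N. e j * W (cas j) z)"
  have [measurable]: "Y \<in> borel_measurable M" unfolding Y_def by measurable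
  have s: "?s > 0" using \<kappa> \<sigma> n h by (rule stat_scale_pos)
  have S: "(\<Sum>j\<in>freqs N. ?A j + ?B j) \<le> ?S"
    unfolding sum.distrib by (intro add_mono Bessel p q) auto
  have D: "\<bar>D\<bar> \<le> y * ?S"
  proof -
    have "\<bar>D\<bar> \<le> (\<Sum>j\<in>freqs N. y * (?A j + ?B j))"
      unfolding D_def
    proof (rule order_trans[OF sum_abs sum_mono])
      fix j
      show "\<bar>(multiplier h j)^2 * (?A j - ?B j)\<bar> \<le> y * (?A j + ?B j)"
      proof (cases "\<bar>j\<bar> \<le> int J")
        case True
        then show ?thesis using low[OF True] y0 by simp
      next
        case False
        have "\<bar>?A j - ?B j\<bar> \<le> ?A j + ?B j" by (simp add: abs_le_iff)
        then show ?thesis unfolding abs_mult using high[of j] False y0 by (intro mult_mono) auto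
      qed
    qed
    also have "... \<le> y * ?S" unfolding sum_distrib_left[symmetric] by (intro mult_left_mono S y0)
    finally show ?thesis .
  qed
  have E: "(\<Sum>j\<in>freqs N. (e j)^2) \<le> y^2 * (2 * ?S)"
  proof -
    have "(\<Sum>j\<in>freqs N. (e j)^2) \<le> (\<Sum>j\<in>freqs N. y^2 * (2 * (?A j + ?B j)))"
    proof (rule sum_mono)
      fix j
      show "(e j)^2 \<le> y^2 * (2 * (?A j + ?B j))"
      proof (cases "\<bar>j\<bar> \<le> int J")
        case True
        then show ?thesis using low[OF True] by (simp add: e_def d_def)
      next
        case False
        have 1: "(d j)^2 \<le> 2 * (?A j + ?B j)"
          unfolding d_def using zero_le_power2[of "ip p (cas j) + ip q (cas j)"] by (simp add: power2_eq_square algebra_simps)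
        have 2: "((multiplier h j)^2)^2 \<le> y^2" using high[of j] False by (intro power_mono) auto
        show ?thesis unfolding e_def power_mult_distrib using 1 2 by (intro mult_mono) auto
      qed
    qed
    also have "... \<le> y^2 * (2 * ?S)"
      unfolding sum_distrib_left[symmetric] by (intro mult_left_mono S) auto
    finally show ?thesis .
  qed
  have diff: "?T z = ?s * D + 2 * ?s * ?a * Y z" for z
  proof -
    have "?T z = ?s * (partial_energy \<sigma> n h p N z - partial_energy \<sigma> n h q N z)"
      by (simp add: partial_stat_def algebra_simps)
    then show ?thesis unfolding partial_energy_diff D_def Y_def e_def d_def by (simp add: distrib_left)
  qed
  have det: "\<bar>?s * D\<bar> \<le> \<delta> / 2"
  proof -
    have "\<bar>?s * D\<bar> = ?s * \<bar>D\<bar>" using s by (simp add: abs_mult)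
    also have "... \<le> ?s * (y * ?S)" using D s by (intro mult_left_mono) auto
    also have "... = y * (real n * sqrt h * ?S) / (\<sigma>^2 * ?\<kappa>)" by (simp add: stat_scale_def)
    also have "... \<le> y * G / (\<sigma>^2 * ?\<kappa>)" using \<kappa> y0 G1 by (intro divide_right_mono mult_left_mono) auto
    finally show ?thesis using y1 by linarith
  qed
  let ?Z = "\<lambda>z. (2 * ?s * ?a * Y z)^2"
  have "prob {z \<in> space M. \<delta> < \<bar>?T z\<bar>}
      \<le> prob {z \<in> space M. (\<delta> / 2)^2 < \<bar>?Z z\<bar>}"
  proof (rule finite_measure_mono)
    show "{z \<in> space M. \<delta> < \<bar>?T z\<bar>} \<subseteq> {z \<in> space M. (\<delta> / 2)^2 < \<bar>?Z z\<bar>}"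
    proof safe
      fix z assume "\<delta> < \<bar>?T z\<bar>"
      moreover have "\<delta> / 2 < \<bar>b\<bar>" if "\<delta> < \<bar>a + b\<bar>" "\<bar>a\<bar> \<le> \<delta> / 2" for a b :: real
        using that by linarith
      ultimately have "\<delta> / 2 < \<bar>2 * ?s * ?a * Y z\<bar>" using det unfolding diff by blast
      then have "(\<delta> / 2)^2 < \<bar>2 * ?s * ?a * Y z\<bar>^2" using \<delta> by (intro power_strict_mono) auto
      then show "(\<delta> / 2)^2 < \<bar>?Z z\<bar>" by (simp only: abs_power2 power2_abs)
    qed
  qed measurable
  also have "... \<le> (4 * (?s * ?a)^2 * (y^2 * (2 * ?S))) / (\<delta> / 2)^2"
  proof (rule prob_le_nn_expectation)
    have "(\<integral>\<^sup>+z. ennreal \<bar>?Z z\<bar> \<partial>M) = (\<integral>\<^sup>+z. ennreal (4 * (?s * ?a)^2) * ennreal ((Y z)^2) \<partial>M)"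
    proof (rule nn_integral_cong)
      fix z
      have e: "(2 * A * a * v)^2 = 4 * (A * a)^2 * v^2" for A a v :: real
        by (simp add: power_mult_distrib)
      have "\<bar>?Z z\<bar> = 4 * (?s * ?a)^2 * (Y z)^2" unfolding abs_power2 by (rule e)
      then show "ennreal \<bar>?Z z\<bar> = ennreal (4 * (?s * ?a)^2) * ennreal ((Y z)^2)"
        by (simp only:) (rule ennreal_mult, auto)
    qed
    also have "... = ennreal (4 * (?s * ?a)^2) * (\<integral>\<^sup>+z. ennreal ((Y z)^2) \<partial>M)"
      by (rule nn_integral_cmult) measurable
    also have "(\<integral>\<^sup>+z. ennreal ((Y z)^2) \<partial>M) = ennreal (\<Sum>j\<in>freqs N. (e j)^2)"
      unfolding Y_def by (rule noise_sum_expectation)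
    also have "ennreal (4 * (?s * ?a)^2) * ... \<le> ennreal (4 * (?s * ?a)^2) * ennreal (y^2 * (2 * ?S))"
      by (intro mult_left_mono ennreal_leI E) auto
    also have "... = ennreal (4 * (?s * ?a)^2 * (y^2 * (2 * ?S)))"
      by (rule ennreal_mult[symmetric]) (auto intro!: mult_nonneg_nonneg add_nonneg_nonneg ip_self_nonneg)
    finally show "(\<integral>\<^sup>+z. ennreal \<bar>?Z z\<bar> \<partial>M) \<le> ennreal (4 * (?s * ?a)^2 * (y^2 * (2 * ?S)))" .
  qed (use \<delta> in \<open>auto intro!: mult_nonneg_nonneg add_nonneg_nonneg ip_self_nonneg\<close>)
  also have "... = 32 * y^2 * (real n * h * ?S) / (\<sigma>^2 * ?\<kappa>^2 * \<delta>^2)"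
  proof -
    have "(?s * ?a)^2 = real n * h / (\<sigma>^2 * ?\<kappa>^2)"
      using n \<sigma> \<kappa> h unfolding stat_scale_def
      by (simp add: power_mult_distrib power_divide) (simp add: power2_eq_square power4_eq_xxxx field_simps)
    then show ?thesis using \<delta> \<sigma> \<kappa> by (simp add: power_divide)
  qed
  also have "... \<le> 32 * y^2 * G / (\<sigma>^2 * ?\<kappa>^2 * \<delta>^2)"
    using G2 by (intro divide_right_mono mult_left_mono) auto
  finally show ?thesis using y2 by linarith
qed

text \<open>\<eta> depends on the kernel, \<sigma>, \<epsilon> and \<open>G\<close> only. This
  allows the cut-off, hence \<gamma>, to be chosen before \<open>n\<close> and the
  alternatives.\<close>

lemma type2_error_close:
  assumes \<kappa>: "kernel_kappa K > 0" and \<sigma>: "\<sigma> > 0" and \<epsilon>: "\<epsilon> > 0" and G: "0 \<le> G"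
  obtains \<eta> where "0 < \<eta>"
    "\<And>n h p q J x. n \<ge> 1 \<Longrightarrow> h > 0 \<Longrightarrow> p \<in> unit_L2 \<Longrightarrow> q \<in> unit_L2 \<Longrightarrow>
      (\<And>j. \<bar>j\<bar> \<le> int J \<Longrightarrow> ip p (cas j) = ip q (cas j)) \<Longrightarrow>
      (\<And>j. int J < \<bar>j\<bar> \<Longrightarrow> \<bar>kernel_ft K (of_int j * h)\<bar> \<le> \<eta>) \<Longrightarrow>
      real n * sqrt h * (ip p p + ip q q) \<le> G \<Longrightarrow> real n * h * (ip p p + ip q q) \<le> G \<Longrightarrow>
      \<bar>type2_error M W K \<sigma> n h x p - type2_error M W K \<sigma> n h x q\<bar> \<le> \<epsilon>"
proof -
  let ?\<kappa> = "kernel_kappa K"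
  have \<epsilon>8: "0 < \<epsilon> / 8" using \<epsilon> by simp
  obtain \<delta> where \<delta>: "0 < \<delta>" and anti: "\<And>n h f x. n \<ge> 1 \<Longrightarrow> h > 0 \<Longrightarrow>
    \<forall>\<^sub>F N in sequentially. prob {z \<in> space M. \<bar>partial_stat \<sigma> n h f N z - x\<bar> \<le> \<delta>} \<le> \<epsilon> / 8"
    by (rule partial_stat_anti_concentration[OF \<kappa> \<sigma> \<epsilon>8], rule that, assumption, blast)
  have t1: "((\<lambda>y. y * G / (\<sigma>^2 * ?\<kappa>)) \<longlongrightarrow> 0 * G / (\<sigma>^2 * ?\<kappa>)) (at_right 0)"
    and t2: "((\<lambda>y. 32 * y^2 * G / (\<sigma>^2 * ?\<kappa>^2 * \<delta>^2)) \<longlongrightarrow> 32 * 0^2 * G / (\<sigma>^2 * ?\<kappa>^2 * \<delta>^2)) (at_right 0)"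
    using \<kappa> \<sigma> \<delta> by (intro tendsto_intros; simp)+
  have "\<forall>\<^sub>F y in at_right 0. y * G / (\<sigma>^2 * ?\<kappa>) < \<delta> / 2"
    by (rule order_tendstoD(2)[OF t1]) (use \<delta> in simp)
  moreover have "\<forall>\<^sub>F y in at_right 0. 32 * y^2 * G / (\<sigma>^2 * ?\<kappa>^2 * \<delta>^2) < \<epsilon> / 8"
    by (rule order_tendstoD(2)[OF t2]) (use \<epsilon> in simp)
  ultimately have "\<forall>\<^sub>F y in at_right 0. y * G / (\<sigma>^2 * ?\<kappa>) < \<delta> / 2 \<and> 32 * y^2 * G / (\<sigma>^2 * ?\<kappa>^2 * \<delta>^2) < \<epsilon> / 8 \<and> 0 < y"
    using eventually_at_right_less[of "0::real"] by eventually_elim auto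
  then obtain y where y: "y * G / (\<sigma>^2 * ?\<kappa>) < \<delta> / 2" "32 * y^2 * G / (\<sigma>^2 * ?\<kappa>^2 * \<delta>^2) < \<epsilon> / 8" "0 < y"
    using eventually_happens' trivial_limit_at_right_real by blast
  show ?thesis
  proof
    \<comment> \<open>\<open>y\<close> bounds the squared multiplier, so the transform itself has to
      stay below the root.\<close>
    show "0 < sqrt y" using y by simp
    fix n :: nat and h p q J x
    assume n: "n \<ge> 1" and h: "h > 0" and p: "p \<in> unit_L2" and q: "q \<in> unit_L2"
      and low: "\<And>j. \<bar>j\<bar> \<le> int J \<Longrightarrow> ip p (cas j) = ip q (cas j)"
      and high: "\<And>j. int J < \<bar>j\<bar> \<Longrightarrow> \<bar>kernel_ft K (of_int j * h)\<bar> \<le> sqrt y"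
      and G1: "real n * sqrt h * (ip p p + ip q q) \<le> G" and G2: "real n * h * (ip p p + ip q q) \<le> G"
    have high': "(multiplier h j)^2 \<le> y" if "int J < \<bar>j\<bar>" for j
      using power_mono[OF high[OF that], of 2] y(3) by (simp add: multiplier_def)
    note [measurable] = stat_measurable[OF h p] stat_measurable[OF h q]
    let ?Q = "\<lambda>A. prob {z \<in> space M. A z} \<le> \<epsilon> / 8" and ?P = "\<lambda>f N. partial_stat \<sigma> n h f N"
    \<comment> \<open>\<open>N\<close> may depend on everything, including \<open>p\<close>,
      \<open>q\<close> and \<open>x\<close>, because the truncation does not occur in the
      conclusion; \<delta> was fixed before them.\<close>
    have "\<forall>\<^sub>F N in sequentially.
        ?Q (\<lambda>z. \<delta> < \<bar>stat \<sigma> n h p z - ?P p N z\<bar>) \<and>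
        ?Q (\<lambda>z. \<delta> < \<bar>stat \<sigma> n h q z - ?P q N z\<bar>) \<and>
        ?Q (\<lambda>z. \<bar>?P p N z - x\<bar> \<le> \<delta>) \<and>
        ?Q (\<lambda>z. \<bar>?P q N z - x\<bar> \<le> \<delta>)"
      by (intro eventually_conj stat_approx anti \<kappa> \<sigma> n h p q \<delta> \<epsilon>8)
    then obtain N where N:
      "?Q (\<lambda>z. \<delta> < \<bar>stat \<sigma> n h p z - ?P p N z\<bar>)"
      "?Q (\<lambda>z. \<delta> < \<bar>stat \<sigma> n h q z - ?P q N z\<bar>)"
      "?Q (\<lambda>z. \<bar>?P p N z - x\<bar> \<le> \<delta>)"
      "?Q (\<lambda>z. \<bar>?P q N z - x\<bar> \<le> \<delta>)"
      using eventually_happens' sequentially_bot by blast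
    have pq: "?Q (\<lambda>z. \<delta> < \<bar>?P p N z - ?P q N z\<bar>)"
      by (rule partial_stat_close[OF \<kappa> \<sigma> n h p q \<delta> low high' G1 G2]) (use y in auto)
    have m: "?P p N \<in> borel_measurable M" "?P q N \<in> borel_measurable M" by measurable
    \<comment> \<open>Three comparisons, from the statistic at \<open>p\<close> to its truncation,
      between the truncations, and back to the statistic at \<open>q\<close>, each costing at most
      \<open>2 * (\<epsilon> / 8)\<close>.\<close>
    show "\<bar>type2_error M W K \<sigma> n h x p - type2_error M W K \<sigma> n h x q\<bar> \<le> \<epsilon>"
      unfolding type2_error_def
      using prob_le_threshold_diff[OF stat_measurable[OF h p] m(1), of \<sigma> n x \<delta>]
        prob_le_threshold_diff[OF stat_measurable[OF h q] m(2), of \<sigma> n x \<delta>]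
        prob_le_threshold_diff[OF m, of x \<delta>] N pq \<epsilon> by linarith
  qed
qed

lemma type2_error_zero:
  assumes "0 < h"
  shows "type2_error M W K \<sigma> n h x (\<lambda>t. 0) = 1 - type1_error M W K \<sigma> n h x"
proof -
  note [measurable] = stat_measurable[OF assms unit_L2_zero]
  have "{z \<in> space M. stat \<sigma> n h (\<lambda>t. 0) z \<le> x} = space M - {z \<in> space M. stat \<sigma> n h (\<lambda>t. 0) z > x}"
    by auto
  then show ?thesis unfolding type1_error_def type2_error_def by (simp add: prob_compl)
qed

text \<open>Division by zero makes the statistic identically 0, so the test rejects always if
  \<open>x < 0\<close> and never otherwise.\<close>

lemma type1_error_degenerate:
  "kernel_kappa K = 0 \<Longrightarrow> type1_error M W K \<sigma> n h x \<in> {0, 1}"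
  by (cases "x < 0") (auto simp: type1_error_def kernel_stat_def prob_space)

end

section \<open>Choice of the constants and the uniform comparison of alternatives\<close>

lemma smoothing_kernel_imp_kernel:
  assumes "smoothing_kernel K"
  obtains B where "kernel K B"
proof -
  obtain B where "\<forall>t. \<bar>K t\<bar> \<le> B" using assms by (auto simp: smoothing_kernel_def)
  then have "kernel K B"
    using assms unfolding smoothing_kernel_def kernel_def by (metis (no_types))
  then show ?thesis by (rule that)
qed

lemma bandwidth_bounds:
  assumes "bandwidths r h"
  obtains c\<^sub>1 c\<^sub>2 where "0 < c\<^sub>1" "0 < c\<^sub>2"
    "\<And>n. n \<ge> 1 \<Longrightarrow> c\<^sub>1 * real n powr (4 * r - 2) \<le> h n" "\<And>n. n \<ge> 1 \<Longrightarrow> h n \<le> c\<^sub>2 * real n powr (4 * r - 2)"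
proof -
  obtain a b where ab: "0 < a" "a \<le> b" "\<And>n. n \<ge> 1 \<Longrightarrow> a * h n \<le> real n powr (4 * r - 2)"
    "\<And>n. n \<ge> 1 \<Longrightarrow> real n powr (4 * r - 2) \<le> b * h n"
    using assms by (auto simp: bandwidths_def same_order_def)
  show ?thesis
    \<comment> \<open>\<open>same_order\<close> bounds the rate by multiples of \<open>h\<close>;
      solving for \<open>h\<close> inverts the constants and exchanges their roles.\<close>
    by (rule that[of "1 / b" "1 / a"]) (use ab in \<open>auto simp: field_simps\<close>)
qed

theorem theorem5p3:
  fixes M :: "'a measure" and W :: "(real \<Rightarrow> real) \<Rightarrow> 'a \<Rightarrow> real" and K :: "real \<Rightarrow> real"
    and \<sigma> r s P\<^sub>0 \<alpha> \<epsilon> c C :: real and h x :: "nat \<Rightarrow> real"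
  assumes "white_noise M W" and "0 < \<sigma>" and "smoothing_kernel K"
    and "0 < r" and "r < 1/2" and "s = r / (2 - 4 * r)" and "0 < P\<^sub>0"
    and "bandwidths r h"
    and "0 < \<alpha>" and "\<alpha> < 1"
    and "(\<lambda>n. type1_error M W K \<sigma> n (h n) (x n)) \<sim>[sequentially] (\<lambda>n. \<alpha>)"
    and "0 < \<epsilon>" and "0 < c" and "c < C"
  shows "\<exists>\<gamma>\<^sub>\<epsilon>>0. \<exists>n\<^sub>\<epsilon>. \<forall>f :: nat \<Rightarrow> real \<Rightarrow> real.
    (\<forall>n\<ge>1. f n \<in> L2_per \<and> c * real n powr (- r) \<le> L2_norm1 (f n)
                        \<and> L2_norm1 (f n) \<le> C * real n powr (- r)) \<longrightarrow>
    consistent M W K \<sigma> r f \<longrightarrow>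
    (\<forall>n>n\<^sub>\<epsilon>. \<forall>\<gamma>>\<gamma>\<^sub>\<epsilon>. \<forall>f\<^sub>\<gamma>. nearest_point (dilate \<gamma> (besov_ball s P\<^sub>0)) (f n) f\<^sub>\<gamma> \<longrightarrow>
       \<bar>type2_error M W K \<sigma> n (h n) (x n) (f n) - type2_error M W K \<sigma> n (h n) (x n) f\<^sub>\<gamma>\<bar> \<le> \<epsilon> \<and>
       type2_error M W K \<sigma> n (h n) (x n) (\<lambda>t. f n t - f\<^sub>\<gamma> t) \<ge> 1 - \<alpha> - \<epsilon>)"
proof -
  obtain B where "kernel K B" using smoothing_kernel_imp_kernel[OF assms(3)] .
  then interpret kernel_model M W K B
    using assms(1) by (simp add: kernel_model_def white_noise_space_def)
  have C: "0 < C" using assms by simp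
  have s: "0 < s" using assms by simp
  have type1_lim: "(\<lambda>n. type1_error M W K \<sigma> n (h n) (x n)) \<longlonglongrightarrow> \<alpha>"
    using assms(11) by (rule asymp_equivD_const)
  have hpos: "0 < h n" if "n \<ge> 1" for n using assms(8) that by (simp add: bandwidths_def)
  have \<kappa>: "kernel_kappa K > 0"
    \<comment> \<open>otherwise division by zero makes the statistic constant, excluding a level in \<open>(0, 1)\<close>\<close>
  proof (rule ccontr)
    assume "\<not> kernel_kappa K > 0"
    moreover have "kernel_kappa K \<ge> 0" by (simp add: kernel_kappa_def)
    ultimately have "kernel_kappa K = 0" by simp
    then have deg: "type1_error M W K \<sigma> n (h n) (x n) \<in> {0, 1}" for n by (rule type1_error_degenerate)
    have "closed {0, 1::real}" by simp
    then have "\<alpha> \<in> {0, 1}"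
      by (rule Lim_in_closed_set[OF _ _ _ type1_lim]) (use deg in auto)
    then show False using assms(9,10) by auto
  qed
  obtain c\<^sub>1 c\<^sub>2 where c12: "0 < c\<^sub>1" "0 < c\<^sub>2"
    and h1: "\<And>n. n \<ge> 1 \<Longrightarrow> c\<^sub>1 * real n powr (4 * r - 2) \<le> h n"
    and h2: "\<And>n. n \<ge> 1 \<Longrightarrow> h n \<le> c\<^sub>2 * real n powr (4 * r - 2)"
    using bandwidth_bounds[OF assms(8)] by blast
  \<comment> \<open>The 5 allows for the squared norm of \<open>f\<close> and up to four times that
    bound for the nearest point; \<open>sqrt c\<^sub>2\<close> and \<open>c\<^sub>2\<close> serve
    the two scales \<open>sqrt (h n)\<close> and \<open>h n\<close>.\<close>
  define G where "G = (sqrt c\<^sub>2 + c\<^sub>2) * (5 * C^2)"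
  have G0: "0 \<le> G" using c12 by (simp add: G_def)
  have sq: "(C * real n powr (- r))^2 = C^2 * real n powr (- 2 * r)" for n
    unfolding power_mult_distrib power2_eq_square[of "real n powr (- r)"] powr_add[symmetric] by simp
  \<comment> \<open>The powers of n add up to 1 + (2r - 1) - 2r = 0 in the first bound and to 1 +
    (4r - 2) - 2r = 2r - 1 in the second, which is negative because r < 1/2.\<close>
  have G1: "real n * sqrt (h n) * S \<le> G" and G2: "real n * h n * S \<le> G"
    if n: "n \<ge> 1" and S: "0 \<le> S" "S \<le> 5 * (C * real n powr (- r))^2" for n S
  proof -
    have n0: "0 < real n" using n by simp
    have pw: "real n = real n powr 1" using n0 by simp
    have "sqrt (h n) \<le> sqrt (c\<^sub>2 * real n powr (4 * r - 2))" by (intro real_sqrt_le_mono h2 n)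
    also have "... = sqrt c\<^sub>2 * real n powr (2 * r - 1)"
    proof -
      have "real n powr (4 * r - 2) = (real n powr (2 * r - 1))^2"
        unfolding power2_eq_square powr_add[symmetric] by simp
      then show ?thesis by (simp add: real_sqrt_mult)
    qed
    finally have sh: "sqrt (h n) \<le> sqrt c\<^sub>2 * real n powr (2 * r - 1)" .
    have "real n * sqrt (h n) * S \<le> real n * (sqrt c\<^sub>2 * real n powr (2 * r - 1)) * (5 * (C^2 * real n powr (- 2 * r)))"
      using sh S hpos[OF n] c12 unfolding sq by (intro mult_mono mult_nonneg_nonneg) auto
    also have "... = sqrt c\<^sub>2 * (5 * C^2) * (real n powr 1 * real n powr (2 * r - 1) * real n powr (- 2 * r))"
      using pw by (simp add: mult_ac)
    also have "real n powr 1 * real n powr (2 * r - 1) * real n powr (- 2 * r) = 1"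
      using n0 by (simp only: powr_add[symmetric]) simp
    finally show "real n * sqrt (h n) * S \<le> G" using c12 C by (simp add: G_def distrib_right add_increasing2)
    have "real n * h n * S \<le> real n * (c\<^sub>2 * real n powr (4 * r - 2)) * (5 * (C^2 * real n powr (- 2 * r)))"
      using h2[OF n] S hpos[OF n] c12 unfolding sq by (intro mult_mono mult_nonneg_nonneg) auto
    also have "... = c\<^sub>2 * (5 * C^2) * (real n powr 1 * real n powr (4 * r - 2) * real n powr (- 2 * r))"
      using pw by (simp add: mult_ac)
    also have "real n powr 1 * real n powr (4 * r - 2) * real n powr (- 2 * r) = real n powr (2 * r - 1)"
      using n0 by (simp only: powr_add[symmetric]) simp
    also have "c\<^sub>2 * (5 * C^2) * real n powr (2 * r - 1) \<le> c\<^sub>2 * (5 * C^2) * 1"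
    proof (rule mult_left_mono)
      have "real n powr (2 * r - 1) \<le> real n powr 0" using n assms(5) by (intro powr_mono) auto
      then show "real n powr (2 * r - 1) \<le> 1" using n0 by simp
    qed (use c12 in auto)
    finally show "real n * h n * S \<le> G" using c12 C by (simp add: G_def distrib_right add_increasing)
  qed
  have \<epsilon>2: "0 < \<epsilon> / 2" using assms(12) by simp
  obtain \<eta> where \<eta>: "0 < \<eta>" and close: "\<And>n h p q J x. n \<ge> 1 \<Longrightarrow> h > 0 \<Longrightarrow> p \<in> unit_L2 \<Longrightarrow> q \<in> unit_L2 \<Longrightarrow>
      (\<And>j. \<bar>j\<bar> \<le> int J \<Longrightarrow> ip p (cas j) = ip q (cas j)) \<Longrightarrow>
      (\<And>j. int J < \<bar>j\<bar> \<Longrightarrow> \<bar>kernel_ft K (of_int j * h)\<bar> \<le> \<eta>) \<Longrightarrow>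
      real n * sqrt h * (ip p p + ip q q) \<le> G \<Longrightarrow> real n * h * (ip p p + ip q q) \<le> G \<Longrightarrow>
      \<bar>type2_error M W K \<sigma> n h x p - type2_error M W K \<sigma> n h x q\<bar> \<le> \<epsilon> / 2"
    by (rule type2_error_close[OF \<kappa> assms(2) \<epsilon>2 G0], rule that, assumption, blast)
  obtain \<Lambda> where \<Lambda>: "0 < \<Lambda>" and van: "\<And>z. \<Lambda> \<le> \<bar>z\<bar> \<Longrightarrow> \<bar>kernel_ft K z\<bar> \<le> \<eta>"
    using kernel_ft_vanishes[OF \<eta>] by blast
  \<comment> \<open>Frequencies beyond \<open>L * real n powr (2 - 4 * r)\<close> satisfy
    \<open>\<bar>of_int j * h n\<bar> \<ge> \<Lambda>\<close> by the lower bandwidth bound, so the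
    transform is at most \<eta> there.\<close>
  define L where "L = \<Lambda> / c\<^sub>1"
  have L: "0 < L" using \<Lambda> c12 by (simp add: L_def)
  \<comment> \<open>Solves \<open>\<gamma>0^2 * P\<^sub>0 = L powr (2 * s) * (9 * C^2)\<close>, the
    condition of \<open>nearest_point_low_frequencies\<close> once the powers of n have
    cancelled.\<close>
  define \<gamma>0 where "\<gamma>0 = sqrt (L powr (2 * s) * (9 * C^2) / P\<^sub>0)"
  have \<gamma>0: "0 < \<gamma>0" using L C assms(7) by (simp add: \<gamma>0_def)
  \<comment> \<open>The convergence of the level alone determines \<open>n\<^sub>\<epsilon>\<close>;
    the other bounds hold for all \<open>n \<ge> 1\<close>.\<close>
  have "\<forall>\<^sub>F n in sequentially. type1_error M W K \<sigma> n (h n) (x n) < \<alpha> + \<epsilon> / 2"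
    using type1_lim \<epsilon>2 by (intro order_tendstoD) auto
  then obtain n0 where n0: "\<And>n. n \<ge> n0 \<Longrightarrow> type1_error M W K \<sigma> n (h n) (x n) < \<alpha> + \<epsilon> / 2"
    by (auto simp: eventually_sequentially)
  show ?thesis
  proof (rule exI[of _ \<gamma>0], rule conjI[OF \<gamma>0], rule exI[of _ n0], intro allI impI)
    fix F :: "nat \<Rightarrow> real \<Rightarrow> real" and n \<gamma> g
    assume F: "\<forall>n\<ge>1. F n \<in> L2_per \<and> c * real n powr - r \<le> L2_norm1 (F n) \<and> L2_norm1 (F n) \<le> C * real n powr - r"
      and n: "n0 < n" and \<gamma>: "\<gamma>0 < \<gamma>" and near': "nearest_point (dilate \<gamma> (besov_ball s P\<^sub>0)) (F n) g"
    define f where "f = F n"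
    note near = near'[folded f_def]
    let ?\<beta> = "type2_error M W K \<sigma> n (h n) (x n)" and ?d = "\<lambda>t. f t - g t" and ?n = "real n" and ?R = "(C * real n powr (- r))^2"
    have n1: "n \<ge> 1" and nr: "0 < real n" using n by auto
    have fL: "f \<in> unit_L2" and norm: "L2_norm1 f \<le> C * ?n powr (- r)"
      using F n1 by (auto simp: f_def L2_per_def)
    define J where "J = nat \<lfloor>L * ?n powr (2 - 4 * r)\<rfloor>"
    have J: "real J \<le> L * ?n powr (2 - 4 * r)" "L * ?n powr (2 - 4 * r) < real J + 1"
      unfolding J_def using L by (simp_all add: of_nat_nat)
    have ff: "ip f f \<le> ?R"
      unfolding L2_norm1_sq[symmetric] by (rule power_mono[OF norm L2_norm1_nonneg])
    have small: "real J powr (2 * s) * (9 * ip f f) \<le> \<gamma>^2 * P\<^sub>0"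
    proof -
      have "2 - 4 * r \<noteq> 0" using assms(5) by simp
      \<comment> \<open>This is where the value of \<open>s\<close> enters: the ball weight at the
        cut-off grows like n^(2r) and cancels the decay of the squared norm of
        \<open>f\<close>.\<close>
      then have s2: "(2 - 4 * r) * (2 * s) = 2 * r" unfolding assms(6) by simp
      have "real J powr (2 * s) \<le> (L * ?n powr (2 - 4 * r)) powr (2 * s)"
        using J s by (intro powr_mono2) auto
      also have "... = L powr (2 * s) * ?n powr (2 * r)"
        using L nr by (simp add: powr_mult powr_powr s2)
      finally have "real J powr (2 * s) * (9 * ip f f) \<le> (L powr (2 * s) * ?n powr (2 * r)) * (9 * (C^2 * ?n powr (- 2 * r)))"
        using ff unfolding sq[of n] by (intro mult_mono) (auto simp: ip_self_nonneg)
      also have "... = L powr (2 * s) * (9 * C^2) * (?n powr (2 * r) * ?n powr (- 2 * r))" by (simp only: mult_ac)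
      also have "?n powr (2 * r) * ?n powr (- 2 * r) = 1"
        using nr by (simp only: powr_add[symmetric]) simp
      also have "L powr (2 * s) * (9 * C^2) * 1 = \<gamma>0^2 * P\<^sub>0"
        using assms(7) by (simp add: \<gamma>0_def)
      also have "... \<le> \<gamma>^2 * P\<^sub>0" using \<gamma> \<gamma>0 assms(7) by (intro mult_right_mono power_mono) auto
      finally show ?thesis .
    qed
    have \<gamma>p: "0 < \<gamma>" using \<gamma> \<gamma>0 by simp
    note near_facts = nearest_point_low_frequencies[OF fL near \<gamma>p s assms(7) small]
    have gL: "g \<in> unit_L2" by (rule near_facts(1))
    have dL: "?d \<in> unit_L2" by (rule unit_L2_diff[OF fL gL])
    have high: "\<bar>kernel_ft K (of_int j * h n)\<bar> \<le> \<eta>" if "int J < \<bar>j\<bar>" for j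
    proof (rule van)
      have "L * ?n powr (2 - 4 * r) \<le> \<bar>real_of_int j\<bar>" using J that by linarith
      then have "L * ?n powr (2 - 4 * r) * (c\<^sub>1 * ?n powr (4 * r - 2)) \<le> \<bar>real_of_int j\<bar> * h n"
        using h1[OF n1] c12 by (intro mult_mono) auto
      also have "L * ?n powr (2 - 4 * r) * (c\<^sub>1 * ?n powr (4 * r - 2)) = \<Lambda> * (?n powr (2 - 4 * r) * ?n powr (4 * r - 2))"
        using c12 by (simp add: L_def)
      also have "?n powr (2 - 4 * r) * ?n powr (4 * r - 2) = 1"
        using nr by (simp only: powr_add[symmetric]) simp
      finally show "\<Lambda> \<le> \<bar>of_int j * h n\<bar>" using hpos[OF n1] by (simp add: abs_mult)
    qed
    have dd: "ip ?d ?d \<le> ?R"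
    proof -
      have "ip ?d ?d \<le> ip f f"
        unfolding L2_norm1_sq[symmetric] by (rule power_mono[OF near_facts(2) L2_norm1_nonneg])
      then show ?thesis using ff by linarith
    qed
    \<comment> \<open>Parallelogram inequality for \<open>g = f - ?d\<close>: the squared norm is at
      most \<open>2 * ip f f + 2 * ip ?d ?d\<close>.\<close>
    have gg: "ip g g \<le> 4 * ?R"
    proof -
      have "g = (\<lambda>t. f t - (f t - g t))" by auto
      then have "ip g g = ip (\<lambda>t. f t - (f t - g t)) (\<lambda>t. f t - (f t - g t))" by simp
      also have "... = ip f f - 2 * ip f ?d + ip ?d ?d"
        using ip_diff_left[OF fL dL] ip_diff_right[OF fL dL] fL dL unit_L2_diff[OF fL dL]
        by (simp add: ip_commute[of ?d f])
      also have "... \<le> 4 * ?R"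
      proof -
        have "0 \<le> ip (\<lambda>t. f t + (f t - g t)) (\<lambda>t. f t + (f t - g t))" by (rule ip_self_nonneg)
        also have "... = ip f f + 2 * ip f ?d + ip ?d ?d"
          using ip_add_left[OF fL dL] ip_add_right[OF fL dL] fL dL unit_L2_add[OF fL dL]
          by (simp add: ip_commute[of ?d f])
        finally show ?thesis using ff dd by linarith
      qed
      finally show ?thesis .
    qed
    have "\<bar>?\<beta> f - ?\<beta> g\<bar> \<le> \<epsilon> / 2"
    proof (rule close[OF n1 hpos[OF n1] fL gL _ high])
      show "ip f (cas j) = ip g (cas j)" if "\<bar>j\<bar> \<le> int J" for j
        using near_facts(3)[OF that] by (simp add: ip_diff_left fL gL cas_unit_L2)
      show "?n * sqrt (h n) * (ip f f + ip g g) \<le> G" "real n * h n * (ip f f + ip g g) \<le> G"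
        using ff gg ip_self_nonneg[of f] ip_self_nonneg[of g] by (auto intro!: G1 G2 n1)
    qed
    \<comment> \<open>The difference has no frequencies up to \<open>J\<close>, so the test hardly
      tells it from 0, where the type II error is one minus the level. One half of \<epsilon> goes
      here, the other into the convergence of the level.\<close>
    moreover have "\<bar>?\<beta> ?d - ?\<beta> (\<lambda>t. 0)\<bar> \<le> \<epsilon> / 2"
    proof (rule close[OF n1 hpos[OF n1] dL unit_L2_zero _ high])
      show "ip ?d (cas j) = ip (\<lambda>t. 0) (cas j)" if "\<bar>j\<bar> \<le> int J" for j
        using near_facts(3)[OF that] by (simp add: ip_zero_left)
      have "ip ?d ?d \<le> 5 * ?R"
        using dd zero_le_power2[of "C * ?n powr (- r)"] by linarith
      then show "?n * sqrt (h n) * (ip ?d ?d + ip (\<lambda>t. 0) (\<lambda>t. 0)) \<le> G"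
        "real n * h n * (ip ?d ?d + ip (\<lambda>t. 0) (\<lambda>t. 0)) \<le> G"
        using ip_self_nonneg[of ?d] by (auto simp: ip_zero_left intro!: G1 G2 n1)
    qed
    moreover have "?\<beta> (\<lambda>t. 0) = 1 - type1_error M W K \<sigma> n (h n) (x n)"
      by (rule type2_error_zero[OF hpos[OF n1]])
    moreover have "type1_error M W K \<sigma> n (h n) (x n) < \<alpha> + \<epsilon> / 2" using n by (intro n0) simp
    ultimately show "\<bar>?\<beta> (F n) - ?\<beta> g\<bar> \<le> \<epsilon> \<and> ?\<beta> (\<lambda>t. F n t - g t) \<ge> 1 - \<alpha> - \<epsilon>"
      unfolding f_def[symmetric] using assms(12) by (intro conjI) linarith+
  qed
qed

end
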